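(* Let $\nu>0$, and let $\nu_0$ and $x_0(\nu)$ be the roots defined in the context. 1) If $\nu\ge\nu_0$, then $\sigma_{\mathrm p}(L_\nu)=\emptyset$, while if $\nu<\nu_0$, then $\sigma_{\mathrm p}(L_\nu)$ is the one-point set containing $$\|L_\nu\|=\frac{4}{1-4x_0^2(\nu)}.$$ 2) The function $\nu\mapsto\|L_\nu\|$, $(0,\nu_0)\to(4,\infty)$, is real analytic and strictly decreasing. 3) We have the lower bound $$\|L_\nu\|\ge\max\left(4,\nu\psi'(\nu)\right),$$ where $\psi=\Gamma'/\Gamma$ is the Digamma function. 4) For $\nu\to0+$, we have the asymptotic expansion $$\|L_\nu\|=\frac1\nu+\frac{\pi^2}{6}\nu+\zeta(3)\,\nu^2+O(\nu^3),$$ where $\zeta(3)$ is Apéry's constant.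
   Context: $\sigma_{\mathrm p}$ denotes the point spectrum (set of eigenvalues). For $\nu>0$, $L_\nu$ is the bounded operator on $\ell^2(\mathbb{N}_0)$, $\mathbb{N}_0=\{0,1,2,\dots\}$, whose matrix in the standard basis is $\left(\frac{1}{\max(m,n)+\nu}\right)_{m,n=0}^\infty$ (the Hilbert $L$-operator), and $\|L_\nu\|$ is its operator norm. The hypergeometric function at unit argument is ${}_3F_2(a_1,a_2,a_3;b_1,b_2;1)=\sum_{k=0}^\infty\frac{(a_1)_k(a_2)_k(a_3)_k}{k!\,(b_1)_k(b_2)_k}$, with $(a)_k=a(a+1)\cdots(a+k-1)$, for $\mathrm{Re}(b_1+b_2-a_1-a_2-a_3)>0$. $\nu_0$ denotes the unique positive zero of the function $\nu\mapsto{}_3F_2\left(-\tfrac12,\tfrac12,\tfrac32;1,\nu+\tfrac12;1\right)$ (it lies in $(0,1/2)$). For $0<\nu<\nu_0$, $x_0(\nu)$ denotes the unique zero in $(0,1/2)$ of the function $x\mapsto{}_3F_2\left(x-\tfrac12,x+\tfrac12,x+\tfrac32;2x+1,x+\nu+\tfrac12;1\right)$. *)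

theory Defs
  imports "HOL-Analysis.Analysis" "HOL-Library.Landau_Symbols"
begin

section \<open>The Hilbert space of square-summable complex sequences\<close>

typedef ell2 = "{f :: nat \<Rightarrow> complex. summable (\<lambda>n. (cmod (f n))\<^sup>2)}"
  morphisms ell2_nth Abs_ell2
  by (rule exI[of _ "\<lambda>_. 0"]) simp

setup_lifting type_definition_ell2

lemma ell2_eqI: "(\<And>n. ell2_nth x n = ell2_nth y n) \<Longrightarrow> x = y"
  by (metis ell2_nth_inject ext)

lemma summable_ell2: "summable (\<lambda>n. (cmod (ell2_nth x n))\<^sup>2)"
  using ell2_nth[of x] by simp

lemma cmod_add_sq_le: "(cmod (a + b))\<^sup>2 \<le> 2 * (cmod a)\<^sup>2 + 2 * (cmod b)\<^sup>2"
proof -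
  have "(cmod (a + b))\<^sup>2 \<le> (cmod a + cmod b)\<^sup>2"
    by (intro power_mono norm_triangle_ineq norm_ge_zero)
  also have "\<dots> \<le> 2 * (cmod a)\<^sup>2 + 2 * (cmod b)\<^sup>2"
    using sum_squares_bound[of "cmod a" "cmod b"] by (simp add: power2_sum)
  finally show ?thesis .
qed

lemma summable_sq_add:
  assumes "summable (\<lambda>n. (cmod (f n))\<^sup>2)" "summable (\<lambda>n. (cmod (g n))\<^sup>2)"
  shows "summable (\<lambda>n. (cmod (f n + g n))\<^sup>2)"
  by (rule summable_comparison_test'[where N = 0,
        OF summable_add[OF summable_mult[OF assms(1), of 2] summable_mult[OF assms(2), of 2]]])
     (use cmod_add_sq_le in auto)

lemma summable_sq_mult:
  assumes "summable (\<lambda>n. (cmod (f n))\<^sup>2)"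
  shows "summable (\<lambda>n. (cmod (c * f n))\<^sup>2)"
  using summable_mult[OF assms, of "(cmod c)\<^sup>2"] by (simp add: norm_mult power_mult_distrib)

lemma summable_inner_ell2: "summable (\<lambda>n. inner (ell2_nth x n) (ell2_nth y n))"
proof (rule summable_comparison_test'[where N = 0, OF summable_add[OF summable_ell2[of x] summable_ell2[of y]]])
  fix n
  have "\<bar>inner (ell2_nth x n) (ell2_nth y n)\<bar> \<le> cmod (ell2_nth x n) * cmod (ell2_nth y n)"
    by (rule Cauchy_Schwarz_ineq2)
  also have "\<dots> \<le> (cmod (ell2_nth x n))\<^sup>2 + (cmod (ell2_nth y n))\<^sup>2"
    using sum_squares_bound[of "cmod (ell2_nth x n)" "cmod (ell2_nth y n)"]
      mult_nonneg_nonneg[OF norm_ge_zero[of "ell2_nth x n"] norm_ge_zero[of "ell2_nth y n"]]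
    by linarith
  finally show "norm (inner (ell2_nth x n) (ell2_nth y n)) \<le> (cmod (ell2_nth x n))\<^sup>2 + (cmod (ell2_nth y n))\<^sup>2"
    by simp
qed

lift_definition scaleC_ell2 :: "complex \<Rightarrow> ell2 \<Rightarrow> ell2" is "\<lambda>c f n. c * f n"
  using summable_sq_mult by auto

instantiation ell2 :: real_vector
begin

lift_definition zero_ell2 :: ell2 is "\<lambda>_. 0"
  by simp

lift_definition plus_ell2 :: "ell2 \<Rightarrow> ell2 \<Rightarrow> ell2" is "\<lambda>f g n. f n + g n"
  using summable_sq_add by auto

lift_definition uminus_ell2 :: "ell2 \<Rightarrow> ell2" is "\<lambda>f n. - f n"
  by simp

lift_definition minus_ell2 :: "ell2 \<Rightarrow> ell2 \<Rightarrow> ell2" is "\<lambda>f g n. f n - g n"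
  subgoal for f g using summable_sq_add[of f "\<lambda>n. - g n"] by simp
  done

lift_definition scaleR_ell2 :: "real \<Rightarrow> ell2 \<Rightarrow> ell2" is "\<lambda>r f n. of_real r * f n"
  using summable_sq_mult by auto

instance
proof
  fix x y z :: ell2 and r s :: real
  show "x + y + z = x + (y + z)" by transfer (simp add: algebra_simps)
  show "x + y = y + x" by transfer (simp add: algebra_simps)
  show "0 + x = x" by transfer simp
  show "- x + x = 0" by transfer simp
  show "x - y = x + - y" by transfer simp
  show "r *\<^sub>R (x + y) = r *\<^sub>R x + r *\<^sub>R y" by transfer (simp add: algebra_simps)
  show "(r + s) *\<^sub>R x = r *\<^sub>R x + s *\<^sub>R x" by transfer (simp add: algebra_simps)
  show "r *\<^sub>R s *\<^sub>R x = (r * s) *\<^sub>R x" by transfer (simp add: algebra_simps)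
  show "1 *\<^sub>R x = x" by transfer simp
qed

end

(* The library's real_inner class needs a real-valued form; "inner" below is the real part of the
   usual complex inner product. It induces the usual norm of the complex Hilbert space. *)
instantiation ell2 :: real_inner
begin

definition inner_ell2 :: "ell2 \<Rightarrow> ell2 \<Rightarrow> real" where
  "inner_ell2 x y = (\<Sum>n. inner (ell2_nth x n) (ell2_nth y n))"

definition norm_ell2 :: "ell2 \<Rightarrow> real" where
  "norm_ell2 x = sqrt (\<Sum>n. (cmod (ell2_nth x n))\<^sup>2)"

definition sgn_ell2 :: "ell2 \<Rightarrow> ell2" where
  "sgn_ell2 x = x /\<^sub>R norm x"

definition dist_ell2 :: "ell2 \<Rightarrow> ell2 \<Rightarrow> real" where
  "dist_ell2 x y = norm (x - y)"

definition uniformity_ell2 :: "(ell2 \<times> ell2) filter" where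
  "uniformity_ell2 = (INF e\<in>{0<..}. principal {(x, y). dist x y < e})"

definition open_ell2 :: "ell2 set \<Rightarrow> bool" where
  "open_ell2 U \<longleftrightarrow> (\<forall>x\<in>U. eventually (\<lambda>(x', y). x' = x \<longrightarrow> y \<in> U) uniformity)"

instance
proof
  fix x y z :: ell2 and r :: real and U :: "ell2 set"
  show "sgn x = x /\<^sub>R norm x" by (rule sgn_ell2_def)
  show "dist x y = norm (x - y)" by (rule dist_ell2_def)
  show "(uniformity :: (ell2 \<times> ell2) filter) = (INF e\<in>{0<..}. principal {(x, y). dist x y < e})"
    by (rule uniformity_ell2_def)
  show "open U \<longleftrightarrow> (\<forall>x\<in>U. eventually (\<lambda>(x', y). x' = x \<longrightarrow> y \<in> U) uniformity)"
    by (rule open_ell2_def)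
  show "inner x y = inner y x"
    by (simp add: inner_ell2_def inner_commute)
  show "inner (x + y) z = inner x z + inner y z"
    by (simp add: inner_ell2_def plus_ell2.rep_eq inner_add_left suminf_add summable_inner_ell2)
  have "inner (of_real r * a) b = r * inner a b" for a b :: complex
    by (simp add: inner_complex_def algebra_simps)
  then show "inner (r *\<^sub>R x) y = r * inner x y"
    by (simp add: inner_ell2_def scaleR_ell2.rep_eq suminf_mult summable_inner_ell2)
  have sq: "inner x x = (\<Sum>n. (cmod (ell2_nth x n))\<^sup>2)"
    by (simp add: inner_ell2_def dot_square_norm)
  show "0 \<le> inner x x"
    unfolding sq by (intro suminf_nonneg summable_ell2) simp
  show "inner x x = 0 \<longleftrightarrow> x = 0"
    unfolding sq using suminf_eq_zero_iff[OF summable_ell2[of x]]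
    by (auto simp: zero_ell2.rep_eq intro: ell2_eqI)
  show "norm x = sqrt (inner x x)"
    unfolding sq by (rule norm_ell2_def)
qed

end

definition point_spectrum :: "(ell2 \<Rightarrow> ell2) \<Rightarrow> complex set" where
  "point_spectrum T = {z. \<exists>f. f \<noteq> 0 \<and> T f = scaleC_ell2 z f}"


section \<open>The Hilbert L-operator\<close>

(* For nu > 0 the sequence under Abs_ell2 is square-summable, see ell2_nth_hilbert_L below;
   other values of nu are irrelevant. *)
definition hilbert_L :: "real \<Rightarrow> ell2 \<Rightarrow> ell2" where
  "hilbert_L \<nu> f =
     Abs_ell2 (\<lambda>m. \<Sum>n. complex_of_real (1 / (real (max m n) + \<nu>)) * ell2_nth f n)"

text \<open>Boundedness follows from the Schur test with weights \<open>1 / sqrt (n + 1)\<close>.\<close>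

lemma schur_row_sum:
  fixes m N :: nat
  defines "S \<equiv> (\<Sum>n<N. 1 / (real (max m n) + 1) * (1 / sqrt (real n + 1)))"
  shows "S \<le> 4 / sqrt (real m + 1)"
proof -
  have step1: "1 / sqrt (real n + 1) \<le> 2 * sqrt (real n + 1) - 2 * sqrt (real n)" for n
  proof -
    define a b where "a = sqrt (real n + 1)" and "b = sqrt (real n)"
    have ab: "a > 0" "b \<ge> 0" "a\<^sup>2 = b\<^sup>2 + 1" by (simp_all add: a_def b_def)
    have "1 \<le> (2 * a - 2 * b) * a"
      using ab zero_le_power2[of "a - b"] by (simp add: power2_eq_square algebra_simps)
    then have "1 / a \<le> 2 * a - 2 * b" using ab by (simp add: pos_divide_le_eq)
    then show ?thesis by (simp add: a_def b_def)
  qed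
  have step2: "1 / (real n + 1) * (1 / sqrt (real n + 1)) \<le> 2 / sqrt (real n) - 2 / sqrt (real n + 1)"
    if "n > 0" for n
  proof -
    define a b where "a = sqrt (real n + 1)" and "b = sqrt (real n)"
    have ab: "a > 0" "b > 0" "a\<^sup>2 = b\<^sup>2 + 1" using that by (simp_all add: a_def b_def)
    have le: "b \<le> a" by (simp add: a_def b_def)
    have "2 / b - 2 / a = 2 * (a - b) / (a * b)"
      using ab by (simp add: field_simps)
    moreover have "(a - b) * (a + b) = 1"
      using ab by (simp add: power2_eq_square algebra_simps)
    then have "a - b = 1 / (a + b)"
      using ab by (simp add: field_simps)
    ultimately have "2 / b - 2 / a = 2 / ((a + b) * (a * b))"
      by simp
    also have "\<dots> \<ge> 2 / (2 * a * (a * a))"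
      using ab le by (intro divide_left_mono mult_mono mult_pos_pos) auto
    finally have "1 / (a * a) * (1 / a) \<le> 2 / b - 2 / a" using ab by (simp add: mult_ac)
    moreover have "a * a = real n + 1" by (simp add: a_def)
    ultimately show ?thesis by (simp add: a_def b_def)
  qed
  have low: "(\<Sum>n<N. 1 / (real (max m n) + 1) * (1 / sqrt (real n + 1))) \<le> 2 * sqrt (real N) / (real m + 1)"
    if "N \<le> Suc m" for N
    using that
  proof (induction N)
    case (Suc N)
    have "1 / (real (max m N) + 1) * (1 / sqrt (real N + 1)) = (1 / sqrt (real N + 1)) / (real m + 1)"
      using Suc.prems by (simp add: max_def)
    also have "\<dots> \<le> (2 * sqrt (real N + 1) - 2 * sqrt (real N)) / (real m + 1)"
      by (intro divide_right_mono step1) simp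
    finally show ?case
      using Suc by (simp add: diff_divide_distrib add.commute)
  qed simp
  have at: "2 * sqrt (real (Suc m)) / (real m + 1) = 2 / sqrt (real m + 1)"
    by (simp add: real_div_sqrt field_simps add.commute)
  have high: "(\<Sum>n<Suc m + k. 1 / (real (max m n) + 1) * (1 / sqrt (real n + 1)))
      \<le> 4 / sqrt (real m + 1) - 2 / sqrt (real (Suc m + k))" for k
  proof (induction k)
    case 0
    then show ?case using low[of "Suc m"] at by (simp add: add.commute)
  next
    case (Suc k)
    have le: "1 / (real (max m (Suc m + k)) + 1) * (1 / sqrt (real (Suc m + k) + 1))
        \<le> 2 / sqrt (real (Suc m + k)) - 2 / sqrt (real (Suc m + k) + 1)"
      using step2[of "Suc m + k"] by (simp add: max_def)
    have e1: "real (Suc m + Suc k) = real (Suc m + k) + 1" by simp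
    have "{..<Suc m + Suc k} = insert (Suc m + k) {..<Suc m + k}" by auto
    then have e2: "(\<Sum>n<Suc m + Suc k. 1 / (real (max m n) + 1) * (1 / sqrt (real n + 1)))
        = 1 / (real (max m (Suc m + k)) + 1) * (1 / sqrt (real (Suc m + k) + 1))
          + (\<Sum>n<Suc m + k. 1 / (real (max m n) + 1) * (1 / sqrt (real n + 1)))"
      by (simp only: sum.insert finite_lessThan lessThan_iff less_irrefl not_False_eq_True)
    show ?case
      unfolding e1 e2 by (rule order_trans[OF add_mono[OF le Suc.IH]]) simp
  qed
  show ?thesis
  proof (cases "N \<le> Suc m")
    case True
    have "2 * sqrt (real N) / (real m + 1) \<le> 2 * sqrt (real (Suc m)) / (real m + 1)"
      using True by (intro divide_right_mono) auto
    then have "S \<le> 2 / sqrt (real m + 1)"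
      using low[OF True] at unfolding S_def by linarith
    also have "\<dots> \<le> 4 / sqrt (real m + 1)" by (intro divide_right_mono) auto
    finally show ?thesis .
  next
    case False
    then have N: "N = Suc m + (N - Suc m)" by simp
    show ?thesis
      unfolding S_def by (subst N, rule order_trans[OF high]) simp
  qed
qed

lemma schur_test_finite:
  fixes g :: "nat \<Rightarrow> real"
  assumes "\<And>n. g n \<ge> 0"
  shows "(\<Sum>m<M. (\<Sum>n<N. 1 / (real (max m n) + 1) * g n)\<^sup>2) \<le> 16 * (\<Sum>n<N. (g n)\<^sup>2)"
proof -
  define K where "K m n = 1 / (real (max m n) + 1)" for m n :: nat
  define w where "w n = 1 / sqrt (real n + 1)" for n :: nat
  have K: "K m n \<ge> 0" "K m n = K n m" for m n by (auto simp: K_def max.commute)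
  have w: "w n > 0" for n by (simp add: w_def)
  have row: "(\<Sum>n<N. K m n * w n) \<le> 4 * w m" for m N
    using schur_row_sum[of m N] by (simp add: K_def w_def)
  have CS: "(\<Sum>n<N. K m n * g n)\<^sup>2 \<le> 4 * w m * (\<Sum>n<N. K m n * (g n)\<^sup>2 / w n)" for m
  proof -
    have "(\<Sum>n<N. K m n * g n) = (\<Sum>n<N. sqrt (K m n * w n) * sqrt (K m n * (g n)\<^sup>2 / w n))"
    proof (rule sum.cong)
      fix n
      have "sqrt (K m n * w n) * sqrt (K m n * (g n)\<^sup>2 / w n) = sqrt ((K m n * g n)\<^sup>2)"
        unfolding real_sqrt_mult[symmetric] using w[of n]
        by (simp add: power2_eq_square field_simps)
      then show "K m n * g n = sqrt (K m n * w n) * sqrt (K m n * (g n)\<^sup>2 / w n)"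
        using K assms by simp
    qed simp
    then have "(\<Sum>n<N. K m n * g n)\<^sup>2
       \<le> (\<Sum>n<N. (sqrt (K m n * w n))\<^sup>2) * (\<Sum>n<N. (sqrt (K m n * (g n)\<^sup>2 / w n))\<^sup>2)"
      by (simp only: Cauchy_Schwarz_ineq_sum)
    also have "\<dots> = (\<Sum>n<N. K m n * w n) * (\<Sum>n<N. K m n * (g n)\<^sup>2 / w n)"
      using K(1) less_imp_le[OF w] by simp
    also have "\<dots> \<le> 4 * w m * (\<Sum>n<N. K m n * (g n)\<^sup>2 / w n)"
      using K(1) less_imp_le[OF w] by (intro mult_right_mono row sum_nonneg) simp
    finally show ?thesis .
  qed
  have "(\<Sum>m<M. (\<Sum>n<N. K m n * g n)\<^sup>2) \<le> (\<Sum>m<M. 4 * w m * (\<Sum>n<N. K m n * (g n)\<^sup>2 / w n))"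
    by (intro sum_mono CS)
  also have "\<dots> = (\<Sum>m<M. \<Sum>n<N. (4 * (g n)\<^sup>2 / w n) * (K n m * w m))"
  proof -
    have "4 * w m * (K m n * (g n)\<^sup>2 / w n) = (4 * (g n)\<^sup>2 / w n) * (K n m * w m)" for m n
      unfolding K(2)[of m n] by simp
    then show ?thesis unfolding sum_distrib_left by (intro sum.cong refl)
  qed
  also have "\<dots> = (\<Sum>n<N. (4 * (g n)\<^sup>2 / w n) * (\<Sum>m<M. K n m * w m))"
    by (subst sum.swap) (simp add: sum_distrib_left)
  also have "\<dots> \<le> (\<Sum>n<N. (4 * (g n)\<^sup>2 / w n) * (4 * w n))"
    using less_imp_le[OF w] by (intro sum_mono mult_left_mono row) auto
  also have "\<dots> = 16 * (\<Sum>n<N. (g n)\<^sup>2)"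
    unfolding sum_distrib_left using w by (intro sum.cong refl) (simp add: less_imp_neq[OF w, symmetric])
  finally show ?thesis by (simp add: K_def)
qed

lemma hilbert_L_kernel_le:
  assumes "\<nu> > 0"
  shows "1 / (real k + \<nu>) \<le> max 1 (1 / \<nu>) * (1 / (real k + 1))"
proof -
  have "real k + 1 \<le> max 1 (1 / \<nu>) * (real k + \<nu>)"
  proof (cases "\<nu> \<le> 1")
    case True
    have "real k * \<nu> \<le> real k" using True by (simp add: mult_left_le)
    then show ?thesis using True assms by (simp add: max_def field_simps)
  next
    case False
    then show ?thesis by (simp add: max_def)
  qed
  then show ?thesis using assms by (simp add: field_simps)
qed

lemma summable_hilbert_L_row:
  assumes "\<nu> > 0"
  shows "summable (\<lambda>n. complex_of_real (1 / (real (max m n) + \<nu>)) * ell2_nth f n)"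
proof (rule summable_comparison_test'[where N = 0])
  define c where "c = max 1 (1 / \<nu>)"
  have "summable (\<lambda>n. 1 / (real n + 1)\<^sup>2)"
    using summable_Suc_iff[of "\<lambda>n. inverse ((real n)\<^sup>2)"] inverse_power_summable[of 2, where 'a = real]
    by (simp add: inverse_eq_divide add.commute)
  then show "summable (\<lambda>n. c\<^sup>2 * (1 / (real n + 1)\<^sup>2) + (cmod (ell2_nth f n))\<^sup>2)"
    by (intro summable_add summable_mult summable_ell2)
  fix n
  have "1 / (real (max m n) + \<nu>) \<le> 1 / (real n + \<nu>)"
    using assms by (intro divide_left_mono) auto
  also have "\<dots> \<le> c * (1 / (real n + 1))"
    unfolding c_def by (rule hilbert_L_kernel_le[OF assms])
  finally have "norm (complex_of_real (1 / (real (max m n) + \<nu>)) * ell2_nth f n)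
      \<le> c * (1 / (real n + 1)) * cmod (ell2_nth f n)"
    using assms by (simp only: norm_mult norm_of_real) (intro mult_right_mono, auto)
  also have "\<dots> \<le> (c * (1 / (real n + 1)))\<^sup>2 + (cmod (ell2_nth f n))\<^sup>2"
  proof -
    define x y where "x = c * (1 / (real n + 1))" and "y = cmod (ell2_nth f n)"
    have "x \<ge> 0" "y \<ge> 0" by (simp_all add: x_def y_def c_def)
    then have "x * y \<ge> 0" by simp
    then have "x * y \<le> x\<^sup>2 + y\<^sup>2" using sum_squares_bound[of x y] by linarith
    then show ?thesis by (simp only: x_def y_def)
  qed
  finally show "norm (complex_of_real (1 / (real (max m n) + \<nu>)) * ell2_nth f n)
      \<le> c\<^sup>2 * (1 / (real n + 1)\<^sup>2) + (cmod (ell2_nth f n))\<^sup>2"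
    by (simp add: power_divide power_mult_distrib)
qed

lemma hilbert_L_partial_sum_le:
  assumes "\<nu> > 0"
  shows "(\<Sum>m<M. (cmod (\<Sum>n. complex_of_real (1 / (real (max m n) + \<nu>)) * ell2_nth f n))\<^sup>2)
         \<le> (4 * max 1 (1 / \<nu>) * norm f)\<^sup>2"
proof -
  define c where "c = max 1 (1 / \<nu>)"
  have c: "c \<ge> 0" by (simp add: c_def)
  let ?a = "\<lambda>m n. complex_of_real (1 / (real (max m n) + \<nu>)) * ell2_nth f n"
  have "(\<lambda>N. \<Sum>m<M. (cmod (\<Sum>n<N. ?a m n))\<^sup>2) \<longlonglongrightarrow> (\<Sum>m<M. (cmod (\<Sum>n. ?a m n))\<^sup>2)"
    by (intro tendsto_intros summable_LIMSEQ summable_hilbert_L_row assms)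
  moreover have "(\<Sum>m<M. (cmod (\<Sum>n<N. ?a m n))\<^sup>2) \<le> (4 * c * norm f)\<^sup>2" for N
  proof -
    have "cmod (\<Sum>n<N. ?a m n) \<le> c * (\<Sum>n<N. 1 / (real (max m n) + 1) * cmod (ell2_nth f n))" for m
    proof -
      have "cmod (\<Sum>n<N. ?a m n) \<le> (\<Sum>n<N. cmod (?a m n))" by (rule norm_sum)
      also have "\<dots> \<le> (\<Sum>n<N. c * (1 / (real (max m n) + 1)) * cmod (ell2_nth f n))"
      proof (rule sum_mono)
        fix n
        have "cmod (?a m n) = 1 / (real (max m n) + \<nu>) * cmod (ell2_nth f n)"
          using assms by (simp only: norm_mult norm_of_real) simp
        also have "\<dots> \<le> c * (1 / (real (max m n) + 1)) * cmod (ell2_nth f n)"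
          using hilbert_L_kernel_le[OF assms, of "max m n"] unfolding c_def
          by (intro mult_right_mono) auto
        finally show "cmod (?a m n) \<le> c * (1 / (real (max m n) + 1)) * cmod (ell2_nth f n)" .
      qed
      finally show ?thesis by (simp add: sum_distrib_left mult.assoc)
    qed
    then have "(\<Sum>m<M. (cmod (\<Sum>n<N. ?a m n))\<^sup>2)
        \<le> (\<Sum>m<M. (c * (\<Sum>n<N. 1 / (real (max m n) + 1) * cmod (ell2_nth f n)))\<^sup>2)"
      by (intro sum_mono power_mono) auto
    also have "\<dots> = c\<^sup>2 * (\<Sum>m<M. (\<Sum>n<N. 1 / (real (max m n) + 1) * cmod (ell2_nth f n))\<^sup>2)"
      by (simp only: power_mult_distrib sum_distrib_left[where r = "c\<^sup>2"])
    also have "\<dots> \<le> c\<^sup>2 * (16 * (\<Sum>n<N. (cmod (ell2_nth f n))\<^sup>2))"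
      by (intro mult_left_mono schur_test_finite) auto
    also have "\<dots> \<le> c\<^sup>2 * (16 * (norm f)\<^sup>2)"
      using sum_le_suminf[OF summable_ell2[of f], of "{..<N}"]
        suminf_nonneg[OF summable_ell2[of f]]
      by (intro mult_left_mono) (auto simp: norm_ell2_def)
    finally show ?thesis by (simp add: power_mult_distrib)
  qed
  ultimately show ?thesis
    unfolding c_def by (intro LIMSEQ_le_const2) auto
qed

lemma summable_hilbert_L:
  assumes "\<nu> > 0"
  shows "summable (\<lambda>m. (cmod (\<Sum>n. complex_of_real (1 / (real (max m n) + \<nu>)) * ell2_nth f n))\<^sup>2)"
  by (rule summableI_nonneg_bounded[OF _ hilbert_L_partial_sum_le[OF assms]]) simp

lemma ell2_nth_hilbert_L:
  assumes "\<nu> > 0"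
  shows "ell2_nth (hilbert_L \<nu> f) m = (\<Sum>n. complex_of_real (1 / (real (max m n) + \<nu>)) * ell2_nth f n)"
  unfolding hilbert_L_def using summable_hilbert_L[OF assms] by (subst Abs_ell2_inverse) auto

lemma norm_hilbert_L_le:
  assumes "\<nu> > 0"
  shows "norm (hilbert_L \<nu> f) \<le> 4 * max 1 (1 / \<nu>) * norm f"
proof -
  have "(\<Sum>m. (cmod (ell2_nth (hilbert_L \<nu> f) m))\<^sup>2) \<le> (4 * max 1 (1 / \<nu>) * norm f)\<^sup>2"
    unfolding ell2_nth_hilbert_L[OF assms]
    by (rule suminf_le_const[OF summable_hilbert_L hilbert_L_partial_sum_le]) (fact assms)+
  then show ?thesis
    unfolding norm_ell2_def[of "hilbert_L \<nu> f"] by (intro real_le_lsqrt) auto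
qed

lemma bounded_linear_hilbert_L:
  assumes "\<nu> > 0"
  shows "bounded_linear (hilbert_L \<nu>)"
proof (rule bounded_linear_intro)
  fix f g :: ell2 and r :: real
  note row = summable_hilbert_L_row[OF assms]
  show "hilbert_L \<nu> (f + g) = hilbert_L \<nu> f + hilbert_L \<nu> g"
    by (rule ell2_eqI)
       (simp only: ell2_nth_hilbert_L[OF assms] plus_ell2.rep_eq distrib_left suminf_add[OF row row])
  show "hilbert_L \<nu> (r *\<^sub>R f) = r *\<^sub>R hilbert_L \<nu> f"
    by (rule ell2_eqI)
       (simp only: ell2_nth_hilbert_L[OF assms] scaleR_ell2.rep_eq suminf_mult[OF row, symmetric] mult.left_commute)
  show "norm (hilbert_L \<nu> f) \<le> norm f * (4 * max 1 (1 / \<nu>))"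
    using norm_hilbert_L_le[OF assms, of f] by (simp add: mult_ac)
qed


section \<open>Special functions and constants\<close>

definition hyp3F2_at_1 :: "real \<Rightarrow> real \<Rightarrow> real \<Rightarrow> real \<Rightarrow> real \<Rightarrow> real" where
  "hyp3F2_at_1 a1 a2 a3 b1 b2 =
     (\<Sum>k. pochhammer a1 k * pochhammer a2 k * pochhammer a3 k
          / (fact k * pochhammer b1 k * pochhammer b2 k))"

definition nu0 :: real where
  "nu0 = (THE \<nu>. \<nu> > 0 \<and> hyp3F2_at_1 (-1/2) (1/2) (3/2) 1 (\<nu> + 1/2) = 0)"

definition x0 :: "real \<Rightarrow> real" where
  "x0 \<nu> = (THE x. x \<in> {0<..<1/2} \<and>
             hyp3F2_at_1 (x - 1/2) (x + 1/2) (x + 3/2) (2 * x + 1) (x + \<nu> + 1/2) = 0)"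

definition zeta3 :: real where
  "zeta3 = (\<Sum>k. 1 / real (Suc k) ^ 3)"

definition real_analytic_on :: "(real \<Rightarrow> real) \<Rightarrow> real set \<Rightarrow> bool" where
  "real_analytic_on f S \<longleftrightarrow> (\<forall>x\<in>S. \<exists>F. (\<lambda>h. f (x + h)) has_fps_expansion F)"

end

theory Submission
  imports Defs "HOL-Complex_Analysis.Complex_Analysis" "HOL-Real_Asymp.Real_Asymp"
begin

text \<open>
  An eigenvector of \<open>L\<^sub>\<nu>\<close> is determined by its partial sums, which satisfy the discrete Euler equation
  \<open>S(t+1) - 2 S(t) + S(t-1) = - S(t) / (z t (t - 1))\<close> on \<open>\<nu> + \<nat>\<close>, where \<open>z = 4 / (1 - 4 x\<^sup>2)\<close> is the eigenvalue.
  For \<open>0 \<le> x < 1/2\<close> the minimal solution at infinity is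
  \<open>\<Gamma>(t+1) / \<Gamma>(t+x+1/2)\<close> times the hypergeometric value of the statement with \<open>\<nu>\<close> replaced by \<open>t\<close>,
  so \<open>z > 4\<close> is an eigenvalue iff this value vanishes at \<open>t = \<nu>\<close>;
  for \<open>z < 4\<close> an energy estimate and for \<open>z = 4\<close> the behaviour of order \<open>\<surd>t\<close> exclude eigenvalues.
  The eigenvector for \<open>z > 4\<close> is positive, whence \<open>z\<close> is the norm by the Schur test and in particular \<open>x\<close> is unique.
  As the hypergeometric value increases with \<open>t\<close> and equals \<open>1\<close> at \<open>x = 1/2\<close>, existence and monotonicity of
  \<open>x\<^sub>0\<close> follow from the intermediate value theorem.
  The Schur test also shows that \<open>\<nu> \<parallel>L\<^sub>\<nu>\<parallel>\<close> is nondecreasing, hence \<open>x\<^sub>0\<close> is locally Lipschitz, which forces the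
  zero \<open>x\<^sub>0(\<nu>)\<close> to be simple; analyticity is then the implicit function theorem.
  The asymptotics come from eliminating the first coordinate of the eigenvector.
\<close>

section \<open>Square-summable sequences\<close>

text \<open>Since 1/z = 1/4 - x^2, the growth rates at infinity are t^(1/2 + x) and t^(1/2 - x).
  They are complex for z < 4 and coincide for z = 4; only for z > 4 does one of them have
  square-summable increments. Gamma asymptotics are avoided: whenever a boundary term or a
  Casoratian must vanish, it is shown to converge and to remain summable after division by n, which
  the harmonic series permits only for limit 0.

  Monotonicity of the hypergeometric value in x is not established, so sign changes produce zeros
  but do not exclude further ones, nor zeros for \<nu> \<ge> \<open>nu0\<close>. That absence is
  deduced from uniqueness by following the sign of the value down to x = 0.

  Lipschitz dependence makes the zero simple as follows: for the zero belonging to s < \<nu>, the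
  value at \<nu> is at least c (\<nu> - s), while the zero has moved by at most K (\<nu> - s), so
  the difference quotient in x stays above c / K.

  In the expansion, the coefficient of \<nu>^2 arises as 3 zeta(3) - 2 zeta(3): a quadratic form at
  the vector with entries 1/(n + 1), and the first-order change of the sum of 1/(n + 1 +
  \<nu>)^2.\<close>

text \<open>A nonzero limit would make the harmonic series converge. With a constant sequence
  \<open>b\<close> this is the divergence of that series itself, the form in which several
  contradictions below are reached.\<close>

lemma limit_zero_if_summable_over_n:
  fixes b :: "nat \<Rightarrow> real"
  assumes lim: "b \<longlonglongrightarrow> l" and summ: "summable (\<lambda>n. b n / (real n + 1))"
    and nonneg: "\<And>n. b n \<ge> 0"
  shows "l = 0"
proof (rule ccontr)
  assume "l \<noteq> 0"
  moreover have "l \<ge> 0" using lim nonneg by (intro LIMSEQ_le_const) auto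
  ultimately have l: "l > 0" by simp
  have "eventually (\<lambda>n. b n > l / 2) sequentially"
    using lim l by (intro order_tendstoD) auto
  then obtain N where N: "\<And>n. n \<ge> N \<Longrightarrow> b n > l / 2"
    by (auto simp: eventually_sequentially)
  have "summable (\<lambda>n. 1 / (real n + 1))"
  proof (rule summable_comparison_test'[OF summable_mult[OF summ, of "2 / l"]])
    fix n assume "n \<ge> N"
    then have "1 \<le> 2 / l * b n" using N[of n] l by (simp add: field_simps)
    then have "1 / (real n + 1) \<le> (2 / l * b n) / (real n + 1)"
      by (intro divide_right_mono) auto
    then show "norm (1 / (real n + 1)) \<le> 2 / l * (b n / (real n + 1))" by simp
  qed
  then have "summable (\<lambda>n. inverse (real (Suc n)))"
    by (simp add: inverse_eq_divide add.commute)
  then have "summable (\<lambda>n. inverse (real n))"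
    using summable_Suc_iff[of "\<lambda>n. inverse (real n)"] by blast
  then show False
    using not_summable_harmonic[where 'a = real] by (simp add: inverse_eq_divide)
qed

lemma summable_product_of_squares:
  fixes a b :: "nat \<Rightarrow> real"
  assumes "summable (\<lambda>n. (a n)\<^sup>2)" "summable (\<lambda>n. (b n)\<^sup>2)"
  shows "summable (\<lambda>n. \<bar>a n * b n\<bar>)"
proof (rule summable_comparison_test'[OF summable_add[OF assms], where N = 0])
  fix n
  have "2 * (\<bar>a n\<bar> * \<bar>b n\<bar>) \<le> (a n)\<^sup>2 + (b n)\<^sup>2"
    using sum_squares_bound[of "\<bar>a n\<bar>" "\<bar>b n\<bar>"] by (simp add: mult.assoc)
  moreover have "0 \<le> \<bar>a n\<bar> * \<bar>b n\<bar>" by simp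
  ultimately show "norm \<bar>a n * b n\<bar> \<le> (a n)\<^sup>2 + (b n)\<^sup>2"
    unfolding abs_mult real_norm_def by linarith
qed

lemma ell2_nth_tendsto_0: "ell2_nth f \<longlonglongrightarrow> 0"
proof -
  have "(\<lambda>n. (cmod (ell2_nth f n))\<^sup>2) \<longlonglongrightarrow> 0"
    by (rule summable_LIMSEQ_zero[OF summable_ell2])
  then have "(\<lambda>n. sqrt ((cmod (ell2_nth f n))\<^sup>2)) \<longlonglongrightarrow> sqrt 0"
    by (rule tendsto_real_sqrt)
  then show ?thesis by (simp add: tendsto_norm_zero_iff)
qed

lemma norm_ell2_sq: "(norm f)\<^sup>2 = (\<Sum>n. (cmod (ell2_nth f n))\<^sup>2)"
  by (simp add: norm_ell2_def suminf_nonneg summable_ell2)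

definition real_ell2 :: "(nat \<Rightarrow> real) \<Rightarrow> ell2" where
  "real_ell2 v = Abs_ell2 (\<lambda>n. complex_of_real (v n))"

lemma ell2_nth_real_ell2:
  assumes "summable (\<lambda>n. (v n)\<^sup>2)"
  shows "ell2_nth (real_ell2 v) n = complex_of_real (v n)"
  unfolding real_ell2_def using assms by (subst Abs_ell2_inverse) auto

lemma norm_real_ell2_sq:
  assumes "summable (\<lambda>n. (v n)\<^sup>2)"
  shows "(norm (real_ell2 v))\<^sup>2 = (\<Sum>n. (v n)\<^sup>2)"
  by (simp add: norm_ell2_sq ell2_nth_real_ell2[OF assms])

text \<open>The half-open range gives \<open>psum f 0 = 0\<close>, which later becomes the initial
  condition \<open>s 0 = 0\<close>; the entry with index m belongs to the point \<nu> + m of the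
  difference equation.\<close>

definition psum :: "ell2 \<Rightarrow> nat \<Rightarrow> complex" where
  "psum f m = (\<Sum>n<m. ell2_nth f n)"

lemma psum_0 [simp]: "psum f 0 = 0"
  and psum_Suc: "psum f (Suc m) = psum f m + ell2_nth f m"
  by (simp_all add: psum_def)

section \<open>The quadratic form of the Hilbert L-operator\<close>

lemma hilbert_L_real_nth:
  assumes "\<nu> > 0" "summable (\<lambda>n. (v n)\<^sup>2)"
  shows "summable (\<lambda>n. 1 / (real (max m n) + \<nu>) * v n)"
    and "ell2_nth (hilbert_L \<nu> (real_ell2 v)) m = complex_of_real (\<Sum>n. 1 / (real (max m n) + \<nu>) * v n)"
proof -
  have "summable (\<lambda>n. complex_of_real (1 / (real (max m n) + \<nu>) * v n))"
    using summable_hilbert_L_row[OF assms(1), of m "real_ell2 v"]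
    by (simp only: ell2_nth_real_ell2[OF assms(2)] of_real_mult)
  then show s: "summable (\<lambda>n. 1 / (real (max m n) + \<nu>) * v n)"
    by (simp only: summable_of_real_iff)
  show "ell2_nth (hilbert_L \<nu> (real_ell2 v)) m = complex_of_real (\<Sum>n. 1 / (real (max m n) + \<nu>) * v n)"
    unfolding ell2_nth_hilbert_L[OF assms(1)] suminf_of_real[OF s]
    by (simp only: ell2_nth_real_ell2[OF assms(2)] of_real_mult)
qed

text \<open>A discrete Hardy inequality, read off from the boundedness of the operator: in row m the
  columns n \<le> m carry the constant kernel 1/(m + \<nu>), so the averaged partial sum of |f| is
  at most the m-th entry of the operator applied to |f|.\<close>

lemma summable_psum_sq:
  assumes "\<nu> > 0"
  shows "summable (\<lambda>m. (cmod (psum f (Suc m)) / (real m + \<nu>))\<^sup>2)"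
proof -
  define v where "v n = cmod (ell2_nth f n)" for n
  have v: "summable (\<lambda>n. (v n)\<^sup>2)" unfolding v_def by (rule summable_ell2)
  show ?thesis
  proof (rule summable_comparison_test'[OF summable_ell2[of "hilbert_L \<nu> (real_ell2 v)"], where N = 0])
    fix m
    have "cmod (psum f (Suc m)) / (real m + \<nu>) \<le> (\<Sum>n<Suc m. v n) / (real m + \<nu>)"
      unfolding psum_def v_def using assms by (intro divide_right_mono norm_sum) auto
    also have "\<dots> = (\<Sum>n<Suc m. 1 / (real (max m n) + \<nu>) * v n)"
      unfolding sum_divide_distrib by (intro sum.cong) (auto simp: max_def)
    also have "\<dots> \<le> (\<Sum>n. 1 / (real (max m n) + \<nu>) * v n)"
      using assms by (intro sum_le_suminf hilbert_L_real_nth v) (auto simp: v_def)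
    finally have le: "cmod (psum f (Suc m)) / (real m + \<nu>) \<le> (\<Sum>n. 1 / (real (max m n) + \<nu>) * v n)" .
    then have "cmod (psum f (Suc m)) / (real m + \<nu>) \<le> cmod (ell2_nth (hilbert_L \<nu> (real_ell2 v)) m)"
      unfolding hilbert_L_real_nth(2)[OF assms v] norm_of_real by linarith
    then show "norm ((cmod (psum f (Suc m)) / (real m + \<nu>))\<^sup>2)
        \<le> (cmod (ell2_nth (hilbert_L \<nu> (real_ell2 v)) m))\<^sup>2"
      using assms by (simp add: power_mono del: power_divide)
  qed
qed

text \<open>Rows m and m + 1 of the matrix agree in every column n > m and differ by one constant in
  the columns n \<le> m. This is what turns the eigenvalue equation into a difference equation for
  partial sums.\<close>

lemma hilbert_L_nth_diff:
  assumes "\<nu> > 0"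
  shows "ell2_nth (hilbert_L \<nu> f) m - ell2_nth (hilbert_L \<nu> f) (Suc m)
    = psum f (Suc m) / complex_of_real ((real m + \<nu>) * (real m + 1 + \<nu>))"
proof -
  let ?K = "\<lambda>m n. complex_of_real (1 / (real (max m n) + \<nu>))"
  have K: "?K m n - ?K (Suc m) n = (if n < Suc m then 1 / complex_of_real ((real m + \<nu>) * (real m + 1 + \<nu>)) else 0)" for n
  proof (cases "n < Suc m")
    case True
    then have "1 / (real (max m n) + \<nu>) - 1 / (real (max (Suc m) n) + \<nu>) = 1 / ((real m + \<nu>) * (real m + 1 + \<nu>))"
      using assms by (simp add: max_absorb1 diff_frac_eq algebra_simps)
    then show ?thesis using True by (metis of_real_diff of_real_divide of_real_1)
  next
    case False
    then show ?thesis by (simp add: max_def)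
  qed
  have "ell2_nth (hilbert_L \<nu> f) m - ell2_nth (hilbert_L \<nu> f) (Suc m)
      = (\<Sum>n. (?K m n - ?K (Suc m) n) * ell2_nth f n)"
    unfolding ell2_nth_hilbert_L[OF assms] left_diff_distrib
    by (rule suminf_diff[OF summable_hilbert_L_row summable_hilbert_L_row]) (fact assms)+
  also have "\<dots> = (\<Sum>n<Suc m. (?K m n - ?K (Suc m) n) * ell2_nth f n)"
    by (rule suminf_finite) (simp_all only: K finite_lessThan, auto)
  also have "\<dots> = psum f (Suc m) / complex_of_real ((real m + \<nu>) * (real m + 1 + \<nu>))"
    unfolding K psum_def sum_divide_distrib by (intro sum.cong) auto
  finally show ?thesis .
qed

lemma inner_complex_divide_real: "inner (a / complex_of_real r) b = inner a b / r"
  by (simp add: inner_complex_def add_divide_distrib)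

lemma summable_psum_form:
  assumes "\<nu> > 0"
  shows "summable (\<lambda>k. inner (psum f (Suc k)) (psum g (Suc k)) / ((real k + \<nu>) * (real k + 1 + \<nu>)))"
proof (rule summable_comparison_test'[where N = 0])
  show "summable (\<lambda>k. \<bar>(cmod (psum f (Suc k)) / (real k + \<nu>)) * (cmod (psum g (Suc k)) / (real k + \<nu>))\<bar>)"
    by (intro summable_product_of_squares summable_psum_sq assms)
  fix k
  have "\<bar>inner (psum f (Suc k)) (psum g (Suc k))\<bar> \<le> cmod (psum f (Suc k)) * cmod (psum g (Suc k))"
    by (rule Cauchy_Schwarz_ineq2)
  then show "norm (inner (psum f (Suc k)) (psum g (Suc k)) / ((real k + \<nu>) * (real k + 1 + \<nu>)))
      \<le> \<bar>(cmod (psum f (Suc k)) / (real k + \<nu>)) * (cmod (psum g (Suc k)) / (real k + \<nu>))\<bar>"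
    using assms by (simp add: abs_mult) (intro frac_le, auto)
qed

lemma sum_inner_by_parts:
  "(\<Sum>m<N. inner (u m) (ell2_nth g m))
     = inner (u N) (psum g N) + (\<Sum>m<N. inner (u m - u (Suc m)) (psum g (Suc m)))"
  by (induction N) (simp_all add: psum_Suc inner_add_right inner_diff_left)

text \<open>Summation by parts diagonalises the form in terms of partial sums, so symmetry and
  positivity become visible. The boundary term converges because both other terms do; divided by N
  it is dominated by a product of two square-summable sequences, hence its limit is 0.\<close>

lemma inner_hilbert_L:
  assumes "\<nu> > 0"
  shows "inner (hilbert_L \<nu> f) g
    = (\<Sum>k. inner (psum f (Suc k)) (psum g (Suc k)) / ((real k + \<nu>) * (real k + 1 + \<nu>)))"
    (is "_ = ?Q")
proof -
  define u where "u = ell2_nth (hilbert_L \<nu> f)"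
  define b where "b N = inner (u N) (psum g N)" for N
  have diff: "inner (u m - u (Suc m)) (psum g (Suc m))
      = inner (psum f (Suc m)) (psum g (Suc m)) / ((real m + \<nu>) * (real m + 1 + \<nu>))" for m
    unfolding u_def hilbert_L_nth_diff[OF assms] by (rule inner_complex_divide_real)
  have "(\<lambda>N. \<Sum>m<N. inner (u m) (ell2_nth g m)) \<longlonglongrightarrow> inner (hilbert_L \<nu> f) g"
    unfolding u_def inner_ell2_def by (intro summable_LIMSEQ summable_inner_ell2)
  moreover have "(\<lambda>N. \<Sum>m<N. inner (u m - u (Suc m)) (psum g (Suc m))) \<longlonglongrightarrow> ?Q"
    unfolding diff by (intro summable_LIMSEQ summable_psum_form assms)
  ultimately have "(\<lambda>N. (\<Sum>m<N. inner (u m) (ell2_nth g m)) - (\<Sum>m<N. inner (u m - u (Suc m)) (psum g (Suc m))))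
      \<longlonglongrightarrow> inner (hilbert_L \<nu> f) g - ?Q"
    by (rule tendsto_diff)
  then have lim: "b \<longlonglongrightarrow> inner (hilbert_L \<nu> f) g - ?Q"
    unfolding sum_inner_by_parts b_def by simp
  have "summable (\<lambda>n. \<bar>b (Suc n)\<bar> / (real n + 1))"
  proof (rule summable_comparison_test'[where N = 0])
    have "summable (\<lambda>n. (cmod (u (Suc n)))\<^sup>2)"
      unfolding u_def using summable_ell2 by (subst summable_Suc_iff)
    then show "summable (\<lambda>n. \<bar>cmod (u (Suc n)) * (cmod (psum g (Suc n)) / (real n + 1))\<bar>)"
      by (intro summable_product_of_squares summable_psum_sq) auto
    fix n
    have "\<bar>b (Suc n)\<bar> \<le> cmod (u (Suc n)) * cmod (psum g (Suc n))"
      unfolding b_def by (rule Cauchy_Schwarz_ineq2)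
    then show "norm (\<bar>b (Suc n)\<bar> / (real n + 1)) \<le> \<bar>cmod (u (Suc n)) * (cmod (psum g (Suc n)) / (real n + 1))\<bar>"
      by (simp add: abs_mult divide_right_mono)
  qed
  moreover have "(\<lambda>n. \<bar>b (Suc n)\<bar>) \<longlonglongrightarrow> \<bar>inner (hilbert_L \<nu> f) g - ?Q\<bar>"
    using LIMSEQ_Suc[OF lim] by (rule tendsto_rabs)
  ultimately have "\<bar>inner (hilbert_L \<nu> f) g - ?Q\<bar> = 0"
    by (intro limit_zero_if_summable_over_n[where b = "\<lambda>n. \<bar>b (Suc n)\<bar>"]) auto
  then show ?thesis by simp
qed

lemma hilbert_L_symmetric:
  assumes "\<nu> > 0"
  shows "inner (hilbert_L \<nu> f) g = inner f (hilbert_L \<nu> g)"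
  using inner_hilbert_L[OF assms, of f g] inner_hilbert_L[OF assms, of g f]
  by (simp add: inner_commute)

lemma hilbert_L_nonneg:
  assumes "\<nu> > 0"
  shows "inner (hilbert_L \<nu> f) f \<ge> 0"
  unfolding inner_hilbert_L[OF assms]
  using assms by (intro suminf_nonneg summable_psum_form) auto

lemma norm_hilbert_L_le_onorm:
  assumes "\<nu> > 0"
  shows "norm (hilbert_L \<nu> f) \<le> onorm (hilbert_L \<nu>) * norm f"
  by (rule onorm[OF bounded_linear_hilbert_L[OF assms]])

lemma onorm_hilbert_L_nonneg:
  assumes "\<nu> > 0"
  shows "onorm (hilbert_L \<nu>) \<ge> 0"
  by (rule onorm_pos_le[OF bounded_linear_hilbert_L[OF assms]])

lemma hilbert_L_form_le:
  assumes "\<nu> > 0"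
  shows "inner (hilbert_L \<nu> f) f \<le> onorm (hilbert_L \<nu>) * (norm f)\<^sup>2"
proof -
  have "inner (hilbert_L \<nu> f) f \<le> norm (hilbert_L \<nu> f) * norm f"
    by (rule norm_cauchy_schwarz)
  also have "\<dots> \<le> onorm (hilbert_L \<nu>) * norm f * norm f"
    by (intro mult_right_mono norm_hilbert_L_le_onorm assms) auto
  finally show ?thesis by (simp add: power2_eq_square mult.assoc)
qed

text \<open>Cauchy--Schwarz for the semi-inner product \<open>\<langle>Lf, g\<rangle>\<close>, applied with \<open>g = Lf\<close>.\<close>

lemma norm_hilbert_L_sq_le:
  assumes "\<nu> > 0"
  shows "(norm (hilbert_L \<nu> f))\<^sup>2 \<le> onorm (hilbert_L \<nu>) * inner (hilbert_L \<nu> f) f"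
proof -
  let ?L = "hilbert_L \<nu>"
  define g c where "g = ?L f" and "c = onorm ?L"
  have lin: "linear ?L" using bounded_linear_hilbert_L[OF assms] by (rule bounded_linear.linear)
  have quad: "0 \<le> inner (?L f) f - 2 * t * (norm g)\<^sup>2 + t\<^sup>2 * (c * (norm g)\<^sup>2)" for t
  proof -
    have "0 \<le> inner (?L (f - t *\<^sub>R g)) (f - t *\<^sub>R g)" by (rule hilbert_L_nonneg[OF assms])
    also have "\<dots> = inner (?L f) f - 2 * t * inner (?L f) g + t\<^sup>2 * inner (?L g) g"
      using hilbert_L_symmetric[OF assms, of g f]
      by (simp add: linear_diff[OF lin] linear_scale[OF lin] inner_diff_left inner_diff_right
          inner_commute algebra_simps power2_eq_square)
    also have "\<dots> \<le> inner (?L f) f - 2 * t * inner (?L f) g + t\<^sup>2 * (c * (norm g)\<^sup>2)"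
      using hilbert_L_form_le[OF assms, of g] by (auto simp: c_def intro: mult_left_mono)
    finally show ?thesis by (simp add: g_def dot_square_norm)
  qed
  show ?thesis
  proof (cases "c = 0")
    case True
    then have "norm g \<le> 0" using norm_hilbert_L_le_onorm[OF assms, of f] by (simp add: c_def g_def)
    then show ?thesis using True by (simp add: c_def g_def)
  next
    case False
    then have "c > 0" using onorm_hilbert_L_nonneg[OF assms] by (simp add: c_def)
    then show ?thesis using quad[of "1 / c"]
      by (simp add: c_def g_def field_simps power2_eq_square)
  qed
qed

text \<open>Schur test with a free positive weight: Cauchy--Schwarz splits the kernel into
  \<open>K * w\<close> and \<open>K * g^2 / w\<close>, and by symmetry the row bound serves again as
  the column bound. Taking a positive eigenvector as weight makes the bound sharp.\<close>

lemma hilbert_L_onorm_le: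
  assumes \<nu>: "\<nu> > 0" and w: "\<And>n. w n > 0"
    and row: "\<And>m N. (\<Sum>n<N. 1 / (real (max m n) + \<nu>) * w n) \<le> \<mu> * w m"
  shows "onorm (hilbert_L \<nu>) \<le> \<mu>"
proof (rule onorm_bound)
  define K where "K m n = 1 / (real (max m n) + \<nu>)" for m n :: nat
  have K: "K m n \<ge> 0" "K m n = K n m" for m n using \<nu> by (auto simp: K_def max.commute)
  note row' = row[folded K_def]
  \<comment> \<open>The empty row sum, \<open>N = 0\<close>, already forces \<mu> to be
    nonnegative.\<close>
  have "0 \<le> \<mu> * w 0" using row[of 0 0] by simp
  then show \<mu>: "\<mu> \<ge> 0" using w[of 0] by (simp add: zero_le_mult_iff)
  fix f
  define g where "g n = cmod (ell2_nth f n)" for n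
  have CS: "(\<Sum>n<N. K m n * g n)\<^sup>2 \<le> \<mu> * w m * (\<Sum>n<N. K m n * (g n)\<^sup>2 / w n)" for m N
  proof -
    have "(\<Sum>n<N. K m n * g n) = (\<Sum>n<N. sqrt (K m n * w n) * sqrt (K m n * (g n)\<^sup>2 / w n))"
    proof (rule sum.cong)
      fix n
      have "sqrt (K m n * w n) * sqrt (K m n * (g n)\<^sup>2 / w n) = sqrt ((K m n * g n)\<^sup>2)"
        unfolding real_sqrt_mult[symmetric] using w[of n]
        by (simp add: power2_eq_square field_simps)
      then show "K m n * g n = sqrt (K m n * w n) * sqrt (K m n * (g n)\<^sup>2 / w n)"
        using K by (simp add: g_def)
    qed simp
    then have "(\<Sum>n<N. K m n * g n)\<^sup>2
       \<le> (\<Sum>n<N. (sqrt (K m n * w n))\<^sup>2) * (\<Sum>n<N. (sqrt (K m n * (g n)\<^sup>2 / w n))\<^sup>2)"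
      by (simp only: Cauchy_Schwarz_ineq_sum)
    also have "\<dots> = (\<Sum>n<N. K m n * w n) * (\<Sum>n<N. K m n * (g n)\<^sup>2 / w n)"
      using K(1) less_imp_le[OF w] by simp
    also have "\<dots> \<le> \<mu> * w m * (\<Sum>n<N. K m n * (g n)\<^sup>2 / w n)"
      using K(1) less_imp_le[OF w] by (intro mult_right_mono row' sum_nonneg) simp
    finally show ?thesis .
  qed
  have fin: "(\<Sum>m<M. (\<Sum>n<N. K m n * g n)\<^sup>2) \<le> \<mu>\<^sup>2 * (\<Sum>n<N. (g n)\<^sup>2)" for M N
  proof -
    have "(\<Sum>m<M. (\<Sum>n<N. K m n * g n)\<^sup>2) \<le> (\<Sum>m<M. \<mu> * w m * (\<Sum>n<N. K m n * (g n)\<^sup>2 / w n))"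
      by (intro sum_mono CS)
    also have "\<dots> = (\<Sum>m<M. \<Sum>n<N. (\<mu> * (g n)\<^sup>2 / w n) * (K n m * w m))"
    proof -
      have "\<mu> * w m * (K m n * (g n)\<^sup>2 / w n) = (\<mu> * (g n)\<^sup>2 / w n) * (K n m * w m)" for m n
        unfolding K(2)[of m n] by simp
      then show ?thesis unfolding sum_distrib_left by (intro sum.cong refl)
    qed
    also have "\<dots> = (\<Sum>n<N. (\<mu> * (g n)\<^sup>2 / w n) * (\<Sum>m<M. K n m * w m))"
      by (subst sum.swap) (simp add: sum_distrib_left)
    also have "\<dots> \<le> (\<Sum>n<N. (\<mu> * (g n)\<^sup>2 / w n) * (\<mu> * w n))"
      using less_imp_le[OF w] \<mu> by (intro sum_mono mult_left_mono row') auto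
    also have "\<dots> = \<mu>\<^sup>2 * (\<Sum>n<N. (g n)\<^sup>2)"
      unfolding sum_distrib_left using w
      by (intro sum.cong refl) (simp add: less_imp_neq[OF w, symmetric] power2_eq_square)
    finally show ?thesis .
  qed
  have part: "(\<Sum>m<M. (cmod (ell2_nth (hilbert_L \<nu> f) m))\<^sup>2) \<le> (\<mu> * norm f)\<^sup>2" for M
  proof (rule LIMSEQ_le_const2)
    let ?a = "\<lambda>m n. complex_of_real (1 / (real (max m n) + \<nu>)) * ell2_nth f n"
    show "(\<lambda>N. \<Sum>m<M. (cmod (\<Sum>n<N. ?a m n))\<^sup>2) \<longlonglongrightarrow> (\<Sum>m<M. (cmod (ell2_nth (hilbert_L \<nu> f) m))\<^sup>2)"
      unfolding ell2_nth_hilbert_L[OF \<nu>]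
      by (intro tendsto_intros summable_LIMSEQ summable_hilbert_L_row \<nu>)
    have "(\<Sum>m<M. (cmod (\<Sum>n<N. ?a m n))\<^sup>2) \<le> (\<mu> * norm f)\<^sup>2" for N
    proof -
      have "cmod (\<Sum>n<N. ?a m n) \<le> (\<Sum>n<N. K m n * g n)" for m
      proof -
        have "cmod (?a m n) = K m n * g n" for n
          unfolding K_def g_def norm_mult norm_of_real using \<nu> by simp
        then show ?thesis using norm_sum[of "?a m" "{..<N}"] by simp
      qed
      then have "(\<Sum>m<M. (cmod (\<Sum>n<N. ?a m n))\<^sup>2) \<le> (\<Sum>m<M. (\<Sum>n<N. K m n * g n)\<^sup>2)"
        by (intro sum_mono power_mono) auto
      also have "\<dots> \<le> \<mu>\<^sup>2 * (\<Sum>n<N. (g n)\<^sup>2)" by (rule fin)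
      also have "\<dots> \<le> \<mu>\<^sup>2 * (norm f)\<^sup>2"
        unfolding norm_ell2_sq g_def by (intro mult_left_mono sum_le_suminf summable_ell2) auto
      finally show ?thesis by (simp add: power_mult_distrib)
    qed
    then show "\<exists>N0. \<forall>N\<ge>N0. (\<Sum>m<M. (cmod (\<Sum>n<N. ?a m n))\<^sup>2) \<le> (\<mu> * norm f)\<^sup>2" by blast
  qed
  have "(norm (hilbert_L \<nu> f))\<^sup>2 \<le> (\<mu> * norm f)\<^sup>2"
    unfolding norm_ell2_sq by (rule suminf_le_const[OF summable_ell2 part])
  then show "norm (hilbert_L \<nu> f) \<le> \<mu> * norm f"
    using \<mu> by (simp add: power2_le_iff_abs_le)
qed

section \<open>The hypergeometric series\<close>

text \<open>The term of index k + 1 of the series in the statement, divided by its factor z - 1/2.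
  It is positive for real z \<ge> 0 and t > 0, so all signs sit in that factor. The type is generic
  because both the real values and their complex extension are needed.\<close>

definition hg :: "'a::{real_normed_field,banach} \<Rightarrow> 'a \<Rightarrow> nat \<Rightarrow> 'a" where
  "hg z t k = pochhammer (z + 1/2) k * pochhammer (z + 1/2) (Suc k) * pochhammer (z + 3/2) (Suc k)
     / (fact (Suc k) * pochhammer (2 * z + 1) (Suc k) * pochhammer (z + t + 1/2) (Suc k))"

definition hF :: "'a::{real_normed_field,banach} \<Rightarrow> 'a \<Rightarrow> 'a" where
  "hF z t = 1 + (z - 1/2) * (\<Sum>k. hg z t k)"

text \<open>Raabe's test: the limit is 1 + B + E - 3 A. For the true parameters x + 1/2, 2 x + 1 and
  x + t + 1/2 the excess B + E - 3 A equals t.\<close>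

lemma summable_pochhammer_quotient:
  fixes A B E :: real
  assumes "A > 0" "B > 0" "E > 0" "B + E > 3 * A"
  shows "summable (\<lambda>k. pochhammer A k * pochhammer A (Suc k) * pochhammer (A + 1) (Suc k)
     / (fact (Suc k) * pochhammer B (Suc k) * pochhammer E (Suc k)))" (is "summable ?f")
proof (rule raabes_test_convergence)
  have pos: "?f k > 0" for k
    using assms by (intro divide_pos_pos mult_pos_pos pochhammer_pos) auto
  then show "\<forall>\<^sub>F k in sequentially. 0 < ?f k" by simp
  have ratio: "?f k / ?f (Suc k)
      = (real k + 2) * (B + real k + 1) * (E + real k + 1) / ((A + real k) * (A + real k + 1) * (A + real k + 2))" for k
  proof -
    have p: "pochhammer A k > 0" "pochhammer (A + 1) k > 0" "pochhammer B (Suc k) > 0" "pochhammer E (Suc k) > 0"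
      using assms by (auto intro!: pochhammer_pos)
    have q: "pochhammer A (Suc k) = pochhammer A k * (A + real k)"
      "pochhammer A (Suc (Suc k)) = pochhammer A k * (A + real k) * (A + real k + 1)"
      "pochhammer (A + 1) (Suc k) = pochhammer (A + 1) k * (A + real k + 1)"
      "pochhammer (A + 1) (Suc (Suc k)) = pochhammer (A + 1) k * (A + real k + 1) * (A + real k + 2)"
      by (simp_all add: pochhammer_Suc algebra_simps)
    have q': "pochhammer B (Suc (Suc k)) = pochhammer B (Suc k) * (B + real k + 1)"
      "pochhammer E (Suc (Suc k)) = pochhammer E (Suc k) * (E + real k + 1)"
      "fact (Suc (Suc k)) = (fact (Suc k) :: real) * (real k + 2)"
      by (simp_all add: pochhammer_Suc[of _ "Suc k"] algebra_simps)
    have A: "A + real k > 0" "A + real k + 1 > 0" "A + real k + 2 > 0" "B + real k + 1 > 0" "E + real k + 1 > 0"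
      using assms by auto
    have f: "(fact (Suc k) :: real) > 0" by simp
    show ?thesis
      unfolding q q' using p A f by (simp del: fact_Suc pochhammer_Suc add: divide_simps)
  qed
  have "(\<lambda>k. real k * (?f k / ?f (Suc k) - 1)) \<longlonglongrightarrow> 1 + B + E - 3 * A"
    unfolding ratio by real_asymp
  then have "(\<lambda>k. ereal (real k * (?f k / ?f (Suc k) - 1))) \<longlonglongrightarrow> ereal (1 + B + E - 3 * A)"
    by (rule tendsto_ereal)
  then have "liminf (\<lambda>k. ereal (real k * (?f k / ?f (Suc k) - 1))) = ereal (1 + B + E - 3 * A)"
    by (intro lim_imp_Liminf) auto
  then show "1 < liminf (\<lambda>k. ereal (real k * (?f k / ?f (Suc k) - 1)))"
    using assms by (simp add: one_ereal_def)
qed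

lemma norm_pochhammer_le:
  fixes z :: "'a::real_normed_field"
  assumes "norm (z - of_real c) \<le> \<eta>" "c \<ge> 0"
  shows "norm (pochhammer z k) \<le> pochhammer (c + \<eta>) k"
proof -
  have "norm (z + of_nat i) \<le> c + \<eta> + real i" for i
  proof -
    have "z + of_nat i = (z - of_real c) + of_real (c + real i)" by simp
    then have "norm (z + of_nat i) \<le> norm (z - of_real c) + norm (of_real (c + real i) :: 'a)"
      by (metis norm_triangle_ineq)
    moreover have "norm (of_real (c + real i) :: 'a) = c + real i"
      using assms(2) by (simp only: norm_of_real)
    ultimately show ?thesis using assms by linarith
  qed
  then show ?thesis
    unfolding pochhammer_prod prod_norm[symmetric] by (intro prod_mono) auto
qed

lemma norm_pochhammer_ge:
  fixes z :: "'a::real_normed_field"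
  assumes "norm (z - of_real c) \<le> \<eta>" "c \<ge> \<eta>"
  shows "norm (pochhammer z k) \<ge> pochhammer (c - \<eta>) k"
proof -
  have \<eta>: "\<eta> \<ge> 0" using assms(1) norm_ge_zero order_trans by blast
  have "norm (z + of_nat i) \<ge> c - \<eta> + real i" for i
  proof -
    have "z + of_nat i = of_real (c + real i) - (of_real c - z)" by simp
    then have "norm (z + of_nat i) \<ge> norm (of_real (c + real i) :: 'a) - norm (of_real c - z)"
      by (metis norm_triangle_ineq2)
    moreover have "norm (of_real (c + real i) :: 'a) = c + real i"
      using assms(2) \<eta> by (simp only: norm_of_real)
    ultimately show ?thesis using assms by (simp only: norm_minus_commute[of "of_real c"])
  qed
  then show ?thesis
    using assms unfolding pochhammer_prod prod_norm[symmetric] by (intro prod_mono) auto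
qed

text \<open>Enlarging the numerator parameters and shrinking the denominator parameters gives one
  summable majorant near a real point. It feeds the Weierstrass test for continuity as well as for
  holomorphy.\<close>

lemma hg_locally_dominated:
  fixes x t :: real
  assumes "x \<ge> 0" "t > 0"
  obtains \<eta> M where "\<eta> > 0" "summable M" "\<eta> < t" "\<eta> < 1/2"
    "\<And>(z::'a::{real_normed_field,banach}) s k. norm (z - of_real x) \<le> \<eta> \<Longrightarrow> norm (s - of_real t) \<le> \<eta> \<Longrightarrow> norm (hg z s k) \<le> M k"
    "\<And>(z::'a::{real_normed_field,banach}) s k. norm (z - of_real x) \<le> \<eta> \<Longrightarrow> norm (s - of_real t) \<le> \<eta> \<Longrightarrow>
       pochhammer (2 * z + 1) k \<noteq> 0 \<and> pochhammer (z + s + 1/2) k \<noteq> 0"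
proof
  \<comment> \<open>With this perturbation B + E - 3 A becomes t - 7 \<eta>, which t / 8 keeps
    positive.\<close>
  define \<eta> where "\<eta> = min (t / 8) (1 / 8)"
  have \<eta>: "\<eta> > 0" "\<eta> \<le> t / 8" "\<eta> \<le> 1/8" using assms by (auto simp: \<eta>_def)
  define A B E where "A = x + 1/2 + \<eta>" and "B = 2 * x + 1 - 2 * \<eta>" and "E = x + t + 1/2 - 2 * \<eta>"
  have ABE: "A > 0" "B > 0" "E > 0" "B + E > 3 * A"
    using assms \<eta> by (auto simp: A_def B_def E_def)
  define M where "M k = pochhammer A k * pochhammer A (Suc k) * pochhammer (A + 1) (Suc k)
     / (fact (Suc k) * pochhammer B (Suc k) * pochhammer E (Suc k))" for k
  show "\<eta> > 0" "\<eta> < t" "\<eta> < 1/2"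
    using \<eta> assms by auto
  show "summable M"
    unfolding M_def by (rule summable_pochhammer_quotient[OF ABE])
  fix z s :: 'a and k
  assume z: "norm (z - of_real x) \<le> \<eta>" and s: "norm (s - of_real t) \<le> \<eta>"
  have h: "of_real (1/2) = (1/2 :: 'a)" "of_real (3/2) = (3/2 :: 'a)" by simp_all
  have u1: "norm (z + 1/2 - of_real (x + 1/2)) \<le> \<eta>" and u2: "norm (z + 3/2 - of_real (x + 3/2)) \<le> \<eta>"
    using z by (simp_all add: of_real_add h del: of_real_divide)
  have l1: "norm (2 * z + 1 - of_real (2 * x + 1)) \<le> 2 * \<eta>"
  proof -
    have "2 * z + 1 - of_real (2 * x + 1) = 2 * (z - of_real x)" by simp
    then have "norm (2 * z + 1 - of_real (2 * x + 1)) = 2 * norm (z - of_real x)"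
      by (metis norm_mult norm_numeral)
    then show ?thesis using z by simp
  qed
  have l2: "norm (z + s + 1/2 - of_real (x + t + 1/2)) \<le> 2 * \<eta>"
  proof -
    have "z + s + 1/2 - of_real (x + t + 1/2) = (z - of_real x) + (s - of_real t)" by simp
    then have "norm (z + s + 1/2 - of_real (x + t + 1/2)) \<le> norm (z - of_real x) + norm (s - of_real t)"
      by (metis norm_triangle_ineq)
    then show ?thesis using z s by linarith
  qed
  have U: "norm (pochhammer (z + 1/2) n) \<le> pochhammer A n" "norm (pochhammer (z + 3/2) n) \<le> pochhammer (A + 1) n" for n
    using norm_pochhammer_le[OF u1, of n] norm_pochhammer_le[OF u2, of n] assms by (auto simp: A_def add_ac)
  have L: "norm (pochhammer (2 * z + 1) n) \<ge> pochhammer B n" "norm (pochhammer (z + s + 1/2) n) \<ge> pochhammer E n" for n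
    using norm_pochhammer_ge[OF l1, of n] norm_pochhammer_ge[OF l2, of n] assms \<eta> by (auto simp: B_def E_def)
  have LP: "pochhammer B n > 0" "pochhammer E n > 0" for n using ABE by (auto intro: pochhammer_pos)
  have UP: "pochhammer A n > 0" "pochhammer (A + 1) n > 0" for n using ABE by (auto intro: pochhammer_pos)
  show "pochhammer (2 * z + 1) k \<noteq> 0 \<and> pochhammer (z + s + 1/2) k \<noteq> 0"
    using L[of k] LP[of k] by auto
  show "norm (hg z s k) \<le> M k"
    unfolding hg_def M_def norm_mult norm_divide norm_fact
    using U L LP UP
    by (intro frac_le mult_mono mult_nonneg_nonneg mult_pos_pos) (auto intro: less_imp_le)
qed

lemma hg_of_real: "hg (of_real x) (of_real t) k = (of_real (hg x t k) :: 'a::{real_normed_field,banach})"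
proof -
  have h: "of_real x + 1/2 = (of_real (x + 1/2) :: 'a)" "of_real x + 3/2 = (of_real (x + 3/2) :: 'a)"
    "2 * of_real x + 1 = (of_real (2 * x + 1) :: 'a)" "of_real x + of_real t + 1/2 = (of_real (x + t + 1/2) :: 'a)"
    by simp_all
  show ?thesis unfolding hg_def h by (simp only: pochhammer_of_real of_real_mult of_real_divide of_real_fact)
qed

lemma hg_pos:
  fixes x t :: real
  assumes "x \<ge> 0" "t > 0"
  shows "hg x t k > 0"
  unfolding hg_def using assms by (intro divide_pos_pos mult_pos_pos pochhammer_pos) auto

lemma summable_hg:
  fixes x t :: real
  assumes "x \<ge> 0" "t > 0"
  shows "summable (hg x t)"
proof -
  obtain \<eta> M where *: "\<eta> > 0" "summable M" "\<And>(z::real) s k. norm (z - of_real x) \<le> \<eta> \<Longrightarrow> norm (s - of_real t) \<le> \<eta> \<Longrightarrow> norm (hg z s k) \<le> M k"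
    using hg_locally_dominated[OF assms, where 'a = real] by metis
  show ?thesis by (rule summable_comparison_test'[OF *(2), where N = 0]) (use *(1,3) in auto)
qed

lemma hF_of_real:
  assumes "x \<ge> 0" "t > 0"
  shows "hF (of_real x) (of_real t) = (of_real (hF x t) :: 'a::{real_normed_field,banach})"
proof -
  have "(\<Sum>k. hg (of_real x) (of_real t) k) = (of_real (\<Sum>k. hg x t k) :: 'a)"
    unfolding hg_of_real by (rule suminf_of_real[OF summable_hg[OF assms], symmetric])
  then show ?thesis by (simp add: hF_def)
qed

text \<open>The complete series including the term of index 0. The telescoping proof of the
  recurrence works with these terms, whereas sign and monotonicity arguments use
  \<open>hg\<close>.\<close>

definition hterm :: "real \<Rightarrow> real \<Rightarrow> nat \<Rightarrow> real" where
  "hterm x t k = pochhammer (x - 1/2) k * pochhammer (x + 1/2) k * pochhammer (x + 3/2) k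
          / (fact k * pochhammer (2 * x + 1) k * pochhammer (x + t + 1/2) k)"

lemma hterm_0: "hterm x t 0 = 1"
  and hterm_Suc: "hterm x t (Suc k) = (x - 1/2) * hg x t k"
proof -
  have "pochhammer (x - 1/2) (Suc k) = (x - 1/2) * pochhammer (x + 1/2) k"
    using pochhammer_rec[of "x - 1/2" k] by (simp add: algebra_simps)
  then show "hterm x t (Suc k) = (x - 1/2) * hg x t k" by (simp only: hterm_def hg_def) simp
qed (simp add: hterm_def)

lemma hterm_sums:
  assumes "x \<ge> 0" "t > 0"
  shows "hterm x t sums hF x t"
proof -
  have "(\<lambda>k. hterm x t (Suc k)) sums ((x - 1/2) * (\<Sum>k. hg x t k))"
    unfolding hterm_Suc by (intro sums_mult summable_sums summable_hg assms)
  then have "hterm x t sums ((x - 1/2) * (\<Sum>k. hg x t k) + hterm x t 0)" by (rule sums_Suc)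
  then show ?thesis by (simp add: hF_def hterm_0 add.commute)
qed

lemma hyp3F2_eq_hF:
  assumes "x \<ge> 0" "t > 0"
  shows "hyp3F2_at_1 (x - 1/2) (x + 1/2) (x + 3/2) (2 * x + 1) (x + t + 1/2) = hF x t"
  unfolding hyp3F2_at_1_def hterm_def[symmetric] by (rule sums_unique[OF hterm_sums[OF assms], symmetric])

lemma hg_antimono:
  fixes x t t' :: real
  assumes "x \<ge> 0" "0 < t" "t \<le> t'"
  shows "hg x t' k \<le> hg x t k"
proof -
  have "pochhammer (x + t + 1/2) (Suc k) \<le> pochhammer (x + t' + 1/2) (Suc k)"
    unfolding pochhammer_prod using assms by (intro prod_mono) auto
  then show ?thesis
    unfolding hg_def using assms
    by (intro divide_left_mono mult_left_mono mult_nonneg_nonneg mult_pos_pos pochhammer_pos less_imp_le[OF pochhammer_pos]) auto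
qed

lemma hg_0:
  fixes x t :: real
  assumes "x \<ge> 0"
  shows "hg x t 0 = (x + 3/2) / (2 * x + 2 * t + 1)"
proof -
  have "hg x t 0 = ((x + 1/2) * (x + 3/2)) / ((x + 1/2) * (2 * x + 2 * t + 1))"
    by (simp add: hg_def algebra_simps)
  then show ?thesis using assms by simp
qed

text \<open>The differences of all terms are nonnegative and only the one with k = 0 is kept. Being
  explicit, it gives strict monotonicity in t here and a linear lower bound in the proof that the
  zero is simple.\<close>

lemma hF_diff_ge:
  fixes x t t' :: real
  assumes "0 \<le> x" "x \<le> 1/2" "0 < t" "t \<le> t'"
  shows "hF x t' - hF x t \<ge> (1/2 - x) * (hg x t 0 - hg x t' 0)"
proof -
  have s: "summable (hg x t)" "summable (hg x t')" using assms by (auto intro!: summable_hg)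
  have "(\<Sum>k<1. hg x t k - hg x t' k) \<le> (\<Sum>k. hg x t k - hg x t' k)"
    using assms hg_antimono by (intro sum_le_suminf summable_diff s) auto
  also have "\<dots> = (\<Sum>k. hg x t k) - (\<Sum>k. hg x t' k)" by (rule suminf_diff[OF s, symmetric])
  finally have "(1/2 - x) * (hg x t 0 - hg x t' 0) \<le> (1/2 - x) * ((\<Sum>k. hg x t k) - (\<Sum>k. hg x t' k))"
    using assms by (intro mult_left_mono) auto
  then show ?thesis by (simp add: hF_def algebra_simps)
qed

lemma hF_less:
  fixes x t t' :: real
  assumes "0 \<le> x" "x < 1/2" "0 < t" "t < t'"
  shows "hF x t < hF x t'"
proof -
  have "hg x t 0 - hg x t' 0 > 0" unfolding hg_0[OF assms(1)] using assms by (simp add: frac_less2)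
  then have "(1/2 - x) * (hg x t 0 - hg x t' 0) > 0" using assms by simp
  then show ?thesis using hF_diff_ge[of x t t'] assms by linarith
qed

lemma hF_le_1:
  fixes x t :: real
  assumes "0 \<le> x" "x \<le> 1/2" "0 < t"
  shows "hF x t \<le> 1"
proof -
  have "0 \<le> (\<Sum>k. hg x t k)" using assms by (intro suminf_nonneg summable_hg less_imp_le[OF hg_pos]) auto
  then have "0 \<le> (1/2 - x) * (\<Sum>k. hg x t k)" using assms by (intro mult_nonneg_nonneg) auto
  then show ?thesis by (simp add: hF_def algebra_simps)
qed

lemma hF_tendsto_1:
  fixes x :: real
  assumes "0 \<le> x" "x \<le> 1/2"
  shows "((\<lambda>t. hF x t) \<longlongrightarrow> 1) at_top"
proof -
  define C where "C = (1/2 - x) * (x + 3/2) * (\<Sum>k. hg x 1 k)"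
  have lower: "hF x t \<ge> 1 - C / (x + t + 1/2)" if t: "t \<ge> 1" for t
  proof -
    \<comment> \<open>Splitting off the first Pochhammer factor isolates the decay in t; the
      remaining factors only grow with t and are replaced by their values at t = 1.\<close>
    have "hg x t k \<le> (x + 3/2) / (x + t + 1/2) * hg x 1 k" for k
    proof -
      have p: "pochhammer (x + t + 1/2) (Suc k) = (x + t + 1/2) * pochhammer (x + t + 3/2) k" for t
        by (simp add: pochhammer_rec algebra_simps)
      have "pochhammer (x + 5/2) k \<le> pochhammer (x + t + 3/2) k"
        unfolding pochhammer_prod using assms t by (intro prod_mono) auto
      then have le: "(x + t + 1/2) * pochhammer (x + 5/2) k \<le> pochhammer (x + t + 1/2) (Suc k)"
        unfolding p using assms t by (intro mult_left_mono) auto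
      define N D where "N = pochhammer (x + 1/2) k * pochhammer (x + 1/2) (Suc k) * pochhammer (x + 3/2) (Suc k)"
        and "D = fact (Suc k) * pochhammer (2 * x + 1) (Suc k)"
      have ND: "N > 0" "D > 0" unfolding N_def D_def using assms by (auto intro!: mult_pos_pos pochhammer_pos)
      have q: "pochhammer (x + 5/2) k > 0" using assms by (auto intro!: pochhammer_pos)
      have "hg x t k = N / (D * pochhammer (x + t + 1/2) (Suc k))" by (simp only: hg_def N_def D_def)
      also have "\<dots> \<le> N / (D * ((x + t + 1/2) * pochhammer (x + 5/2) k))"
        using ND q le assms t by (intro divide_left_mono mult_left_mono mult_pos_pos pochhammer_pos) auto
      also have "\<dots> = (x + 3/2) / (x + t + 1/2) * (N / (D * ((x + 3/2) * pochhammer (x + 5/2) k)))"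
        using assms t by simp
      also have "N / (D * ((x + 3/2) * pochhammer (x + 5/2) k)) = hg x 1 k"
      proof -
        have "pochhammer (x + 1 + 1/2) (Suc k) = (x + 3/2) * pochhammer (x + 5/2) k"
          using p[of 1] by (simp add: add.commute)
        then show ?thesis by (simp only: hg_def N_def D_def)
      qed
      finally show ?thesis .
    qed
    then have "(\<Sum>k. hg x t k) \<le> (\<Sum>k. (x + 3/2) / (x + t + 1/2) * hg x 1 k)"
      using assms t by (intro suminf_le summable_mult summable_hg) auto
    also have "\<dots> = (x + 3/2) / (x + t + 1/2) * (\<Sum>k. hg x 1 k)"
      using assms by (intro suminf_mult summable_hg) auto
    finally have "(1/2 - x) * (\<Sum>k. hg x t k) \<le> (1/2 - x) * ((x + 3/2) / (x + t + 1/2) * (\<Sum>k. hg x 1 k))"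
      using assms by (intro mult_left_mono) auto
    then show ?thesis by (simp add: hF_def C_def algebra_simps)
  qed
  have lim: "((\<lambda>t. 1 - C / (x + t + 1/2)) \<longlongrightarrow> 1) at_top" by real_asymp
  show ?thesis
  proof (rule tendsto_sandwich[OF _ _ lim tendsto_const])
    show "\<forall>\<^sub>F t in at_top. 1 - C / (x + t + 1/2) \<le> hF x t"
      using eventually_ge_at_top[of 1] by eventually_elim (rule lower)
    show "\<forall>\<^sub>F t in at_top. hF x t \<le> 1"
      using eventually_gt_at_top[of 0] by eventually_elim (use hF_le_1 assms in auto)
  qed
qed

lemma hF_half: "hF (1/2) t = (1::real)"
  by (simp add: hF_def)

text \<open>At x = t = 0 the terms decay only like 1/k, so their sum diverges. A finite partial sum
  exceeding 2 persists for small t > 0, and with the factor -1/2 this makes the value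
  negative.\<close>

lemma hF_0_neg: "\<exists>t>0. t < \<epsilon> \<and> hF 0 t < (0::real)" if \<epsilon>: "\<epsilon> > 0" for \<epsilon> :: real
proof -
  define h where "h = hg (0::real) 0"
  have rec: "h (Suc k) = h k * ((real k + 1/2) * (real k + 5/2) / (real k + 2)\<^sup>2)" for k
  proof -
    have "pochhammer (1/2 :: real) (Suc k) > 0" "pochhammer (1/2 :: real) k > 0" "pochhammer (1 :: real) (Suc k) > 0"
      by (auto intro!: pochhammer_pos)
    then show ?thesis
      unfolding h_def hg_def power2_eq_square
      by (simp add: pochhammer_Suc[of _ "Suc k"] pochhammer_Suc[of _ k] divide_simps) (simp add: algebra_simps)
  qed
  have ge: "h (Suc k) \<ge> h 1 / (real k + 1)" for k
  proof (induction k)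
    case (Suc k)
    have p: "(real k + 1) / (real k + 2) \<le> (real (Suc k) + 1/2) * (real (Suc k) + 5/2) / (real (Suc k) + 2)\<^sup>2"
      by (simp add: divide_simps power2_eq_square) (simp add: algebra_simps)
    have "h 1 / (real k + 2) = h 1 / (real k + 1) * ((real k + 1) / (real k + 2))" by simp
    also have "\<dots> \<le> h (Suc k) * ((real (Suc k) + 1/2) * (real (Suc k) + 5/2) / (real (Suc k) + 2)\<^sup>2)"
    proof (rule mult_mono[OF Suc p])
      have "0 \<le> h 1 / (real k + 1)" unfolding h_def hg_def
        by (intro divide_nonneg_nonneg mult_nonneg_nonneg less_imp_le[OF pochhammer_pos]) auto
      then show "0 \<le> h (Suc k)" using Suc by linarith
    qed auto
    also have "\<dots> = h (Suc (Suc k))" by (rule rec[symmetric])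
    finally show ?case by (simp add: add.commute)
  qed simp
  have h1: "h 1 > 0" unfolding h_def hg_def by (intro divide_pos_pos mult_pos_pos pochhammer_pos) auto
  have hp: "h k > 0" for k unfolding h_def hg_def by (intro divide_pos_pos mult_pos_pos pochhammer_pos) auto
  have "\<not> summable h"
  proof
    assume "summable h"
    then have "summable (\<lambda>k. h (Suc k))" by (subst summable_Suc_iff)
    then have "summable (\<lambda>k. 1 / h 1 * h (Suc k))" by (rule summable_mult)
    then have "summable (\<lambda>n. 1 / (real n + 1))"
    proof (rule summable_comparison_test'[where N = 0])
      fix n show "norm (1 / (real n + 1)) \<le> 1 / h 1 * h (Suc n)"
        using ge[of n] h1 by (simp add: field_simps)
    qed
    then show False
      using limit_zero_if_summable_over_n[of "\<lambda>_. 1" 1] by simp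
  qed
  then have "\<exists>N. (\<Sum>k<N. h k) > 2"
    using summableI_nonneg_bounded[of h 2] hp by (force simp: not_less less_imp_le)
  then obtain N where N: "(\<Sum>k<N. h k) > 2" by blast
  have "((\<lambda>t. \<Sum>k<N. hg 0 t k) \<longlongrightarrow> (\<Sum>k<N. hg 0 0 k)) (at_right (0::real))"
  proof (rule tendsto_sum)
    fix k
    have "pochhammer (1/2::real) (Suc k) > 0" "pochhammer (1::real) (Suc k) > 0" by (auto intro!: pochhammer_pos)
    then show "((\<lambda>t. hg 0 t k) \<longlongrightarrow> hg 0 0 k) (at_right (0::real))"
      unfolding hg_def pochhammer_prod
      by (intro tendsto_intros) (auto simp: pochhammer_prod simp del: prod.atLeast0_lessThan_Suc)
  qed
  then have "eventually (\<lambda>t. (\<Sum>k<N. hg 0 t k) > 2) (at_right (0::real))"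
    using N by (intro order_tendstoD) (auto simp: h_def)
  moreover have "eventually (\<lambda>t. 0 < t \<and> t < \<epsilon>) (at_right (0::real))"
    using that by (intro eventually_at_rightI[of 0 \<epsilon>]) auto
  ultimately have "eventually (\<lambda>t. (\<Sum>k<N. hg 0 t k) > 2 \<and> 0 < t \<and> t < \<epsilon>) (at_right (0::real))"
    by (rule eventually_conj)
  then obtain t where t: "(\<Sum>k<N. hg 0 t k) > 2" "0 < t" "t < \<epsilon>"
    using eventually_happens[of _ "at_right (0::real)"] by (auto simp: trivial_limit_at_right_real)
  have "(\<Sum>k<N. hg 0 t k) \<le> (\<Sum>k. hg 0 t k)"
    using t by (intro sum_le_suminf summable_hg less_imp_le[OF hg_pos]) auto
  then have "hF 0 t < 0" using t by (simp add: hF_def)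
  then show ?thesis using t by blast
qed

section \<open>Joint continuity of the hypergeometric value\<close>

lemma continuous_on_hF_box:
  assumes M: "summable M"
    and dom: "\<And>(z::'a::{real_normed_field,banach}) s k. norm (z - x) \<le> \<eta> \<Longrightarrow> norm (s - t) \<le> \<eta> \<Longrightarrow> norm (hg z s k) \<le> M k"
    and nz: "\<And>(z::'a) s k. norm (z - x) \<le> \<eta> \<Longrightarrow> norm (s - t) \<le> \<eta> \<Longrightarrow>
       pochhammer (2 * z + 1) k \<noteq> 0 \<and> pochhammer (z + s + 1/2) k \<noteq> 0"
  shows "continuous_on (cball x \<eta> \<times> cball t \<eta>) (\<lambda>(z, s). hF z s)"
proof -
  define S where "S = cball x \<eta> \<times> cball t \<eta>"
  have S: "norm (fst p - x) \<le> \<eta>" "norm (snd p - t) \<le> \<eta>" if "p \<in> S" for p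
    using that by (auto simp: S_def dist_norm norm_minus_commute)
  have "continuous_on S (\<lambda>p. \<Sum>k. hg (fst p) (snd p) k)"
  proof (rule uniform_limit_theorem)
    show "uniform_limit S (\<lambda>n p. \<Sum>k<n. hg (fst p) (snd p) k) (\<lambda>p. \<Sum>k. hg (fst p) (snd p) k) sequentially"
      using S dom by (intro Weierstrass_m_test[OF _ M]) auto
    have pc: "continuous_on S (\<lambda>p. pochhammer (f p) n)" if "continuous_on S f" for f :: "'a \<times> 'a \<Rightarrow> 'a" and n
      unfolding pochhammer_prod using that by (intro continuous_intros)
    have "continuous_on S (\<lambda>p. hg (fst p) (snd p) k)" for k
      unfolding hg_def
    proof (intro continuous_on_divide continuous_on_mult continuous_on_const pc ballI)
      fix p assume "p \<in> S"
      then show "fact (Suc k) * pochhammer (2 * fst p + 1) (Suc k) * pochhammer (fst p + snd p + 1/2) (Suc k) \<noteq> 0"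
        using nz[OF S, of p p "Suc k"] by (simp del: fact_Suc)
    qed (intro continuous_intros)+
    then show "\<forall>\<^sub>F n in sequentially. continuous_on S (\<lambda>p. \<Sum>k<n. hg (fst p) (snd p) k)"
      by (intro always_eventually allI continuous_on_sum) auto
  qed simp
  then have "continuous_on S (\<lambda>p. hF (fst p) (snd p))"
    unfolding hF_def by (intro continuous_intros)
  then show ?thesis by (simp only: S_def case_prod_unfold)
qed

lemma isCont_hF:
  fixes x t :: real
  assumes "x \<ge> 0" "t > 0"
  shows "isCont (\<lambda>(z::'a::{real_normed_field,banach}, s). hF z s) (of_real x, of_real t)"
proof -
  obtain \<eta> M where \<eta>: "\<eta> > 0" and M: "summable M"
    and dom: "\<And>(z::'a) s k. norm (z - of_real x) \<le> \<eta> \<Longrightarrow> norm (s - of_real t) \<le> \<eta> \<Longrightarrow> norm (hg z s k) \<le> M k"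
    and nz: "\<And>(z::'a) s k. norm (z - of_real x) \<le> \<eta> \<Longrightarrow> norm (s - of_real t) \<le> \<eta> \<Longrightarrow>
       pochhammer (2 * z + 1) k \<noteq> 0 \<and> pochhammer (z + s + 1/2) k \<noteq> 0"
    using hg_locally_dominated[OF assms, where 'a = 'a] by metis
  define S where "S = cball (of_real x :: 'a) \<eta> \<times> cball (of_real t :: 'a) \<eta>"
  have "continuous_on S (\<lambda>(z, s). hF z s)"
    unfolding S_def by (rule continuous_on_hF_box[OF M dom nz])
  moreover have "(of_real x, of_real t) \<in> interior S"
  proof (rule interiorI)
    show "open (ball (of_real x :: 'a) \<eta> \<times> ball (of_real t :: 'a) \<eta>)" by (intro open_Times open_ball)
    show "(of_real x, of_real t) \<in> ball (of_real x :: 'a) \<eta> \<times> ball (of_real t :: 'a) \<eta>" using \<eta> by simp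
    show "ball (of_real x :: 'a) \<eta> \<times> ball (of_real t :: 'a) \<eta> \<subseteq> S"
      unfolding S_def by (intro Sigma_mono ball_subset_cball)
  qed
  ultimately show ?thesis by (rule continuous_on_interior)
qed

lemma continuous_on_hF:
  fixes f g :: "'b::topological_space \<Rightarrow> real"
  assumes "continuous_on A f" "continuous_on A g" "\<And>y. y \<in> A \<Longrightarrow> f y \<ge> 0 \<and> g y > 0"
  shows "continuous_on A (\<lambda>y. hF (f y) (g y))"
proof -
  have "continuous_on ({0..} \<times> {0<..}) (\<lambda>(z::real, s). hF z s)"
    using isCont_hF[where 'a = real] by (intro continuous_at_imp_continuous_on) auto
  then have "continuous_on A (\<lambda>y. case (f y, g y) of (z, s) \<Rightarrow> hF z s)"
  proof (rule continuous_on_compose2)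
    show "continuous_on A (\<lambda>y. (f y, g y))" by (intro continuous_on_Pair assms)
    show "(\<lambda>y. (f y, g y)) ` A \<subseteq> {0..} \<times> {0<..}" using assms(3) by auto
  qed
  then show ?thesis by simp
qed

section \<open>The three-term recurrence in t\<close>

text \<open>The telescoping identity for a single index k with the common factor \<open>c k\<close>
  removed: on the left the recurrence operator, on the right the difference of two consecutive
  values of the certificate \<open>U\<close> below. Here a = x + 1/2.\<close>

lemma hF_recurrence_algebra:
  fixes t y a k :: real
  assumes "t > 0" "y > 0" "y = t + a + k"
  shows "t * (t - 1) * ((t + 1) / y - 2 + (y - 1) / t) + a * (1 - a)
    = k * (2 * a + k - 1) - (a + k - 1) * (a + k) * (a + k + 1) / y"
proof -
  define b where "b = a + k"
  have b: "b = y - t" "k = b - a" using assms by (auto simp: b_def)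
  have 1: "(t + 1) / y - 2 + (y - 1) / t = b * (b - 1) / (t * y)"
    unfolding b using assms(1,2) by (simp add: divide_simps) (simp add: algebra_simps)
  have "t * (t - 1) * ((t + 1) / y - 2 + (y - 1) / t) = (t - 1) * (b * (b - 1)) / y"
    unfolding 1 using assms(1) by simp
  also have "\<dots> = (y - b - 1) * (b * (b - 1)) / y" by (simp add: b)
  also have "\<dots> = b * (b - 1) - (b - 1) * b * (b + 1) / y"
    using assms(2) by (simp add: divide_simps) (simp add: algebra_simps)
  finally show ?thesis unfolding b_def by (simp add: algebra_simps)
qed

text \<open>The summands of the recurrence telescope.\<close>

lemma hF_recurrence:
  fixes x t :: real
  assumes "x \<ge> 0" "t > 1"
  shows "(t + 1) / (t + x + 1/2) * hF x (t + 1) + (t + x - 1/2) / t * hF x (t - 1) - 2 * hF x t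
    = - ((1/2 + x) * (1/2 - x)) / (t * (t - 1)) * hF x t"
proof -
  define a where "a = x + 1/2"
  define c where "c k = hterm x t k" for k
  \<comment> \<open>The certificate of the telescoping. \<open>U 0 = 0\<close>, and
    \<open>c_Suc\<close> rewrites \<open>U (Suc k)\<close> as a rational multiple of
    \<open>c k\<close>.\<close>
  define U where "U k = c k * (real k * (2 * a + real k - 1))" for k
  have a: "a > 0" using assms by (simp add: a_def)
  define N where "N k = pochhammer (x - 1/2) k * pochhammer (x + 1/2) k * pochhammer (x + 3/2) k" for k
  define D where "D k = fact k * pochhammer (2 * x + 1) k" for k
  have D: "D k > 0" for k unfolding D_def using assms by (intro mult_pos_pos pochhammer_pos) auto
  have ht: "hterm x s k = N k / (D k * pochhammer (a + s) k)" for s k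
    unfolding hterm_def N_def D_def a_def by (simp only: add_ac)
  have shift_up: "hterm x (t + 1) k = c k * (t + a) / (t + a + real k)" for k
  proof -
    have q: "pochhammer (a + (t + 1)) k > 0" "a + t + real k > 0" "a + t > 0"
      using a assms by (auto intro: pochhammer_pos)
    have "pochhammer (a + t) k * (a + t + real k) = (a + t) * pochhammer (a + t + 1) k"
      by (metis pochhammer_Suc pochhammer_rec)
    then have p: "pochhammer (a + t) k = (a + t) * pochhammer (a + (t + 1)) k / (a + t + real k)"
      using q by (simp add: eq_divide_eq add.assoc)
    show ?thesis unfolding c_def ht p using q D[of k] by (simp add: add.commute[of t a])
  qed
  have shift_down: "hterm x (t - 1) k = c k * (t + a + real k - 1) / (t + a - 1)" for k
  proof -
    have q: "pochhammer (a + t) k > 0" "a + t + real k - 1 > 0" "a + t - 1 > 0"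
      using a assms by (auto intro: pochhammer_pos)
    have e: "a + (t - 1) = a + t - 1" by simp
    have "pochhammer (a + t - 1) k * (a + t + real k - 1) = (a + t - 1) * pochhammer (a + t) k"
      using pochhammer_Suc[of "a + t - 1" k] pochhammer_rec[of "a + t - 1" k] by (simp add: algebra_simps)
    then have p: "pochhammer (a + t - 1) k = (a + t - 1) * pochhammer (a + t) k / (a + t + real k - 1)"
      using q by (simp add: eq_divide_eq)
    show ?thesis unfolding c_def ht e p using q D[of k] by (simp add: add.commute[of t a])
  qed
  have c_Suc: "c (Suc k) * ((real k + 1) * (2 * a + real k)) = c k * ((a + real k - 1) * (a + real k) * (a + real k + 1) / (a + t + real k))" for k
  proof -
    have N: "N (Suc k) = N k * ((a + real k - 1) * (a + real k) * (a + real k + 1))"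
    proof -
      have e: "x - 1/2 + real k = a + real k - 1" "x + 1/2 + real k = a + real k" "x + 3/2 + real k = a + real k + 1"
        by (simp_all add: a_def)
      show ?thesis unfolding N_def pochhammer_Suc e by (simp only: mult_ac)
    qed
    have D': "D (Suc k) = D k * ((real k + 1) * (2 * a + real k))"
      unfolding D_def pochhammer_Suc fact_Suc a_def by (simp add: algebra_simps)
    have "pochhammer (a + t) k > 0" "2 * a + real k > 0" "a + t + real k > 0" "real k + 1 > 0"
      using a assms by (auto intro: pochhammer_pos)
    then show ?thesis
      unfolding c_def ht N D' pochhammer_Suc using D[of k] by simp
  qed
  have factor: "t * (t - 1) * (e * P - 2 * e + e * Q) + a * (1 - a) * e = e * (t * (t - 1) * (P - 2 + Q) + a * (1 - a))"
    for e P Q :: real by (simp add: algebra_simps)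
  have tele: "t * (t - 1) * ((t + 1) / (t + a) * hterm x (t + 1) k - 2 * c k + (t + a - 1) / t * hterm x (t - 1) k)
      + a * (1 - a) * c k = U k - U (Suc k)" for k
  proof -
    define y where "y = t + a + real k"
    have y: "y > 0" "t + a > 0" "t + a - 1 > 0" using a assms by (auto simp: y_def)
    have "real (Suc k) * (2 * a + real (Suc k) - 1) = (real k + 1) * (2 * a + real k)" by simp
    then have U_Suc: "U (Suc k) = c k * ((a + real k - 1) * (a + real k) * (a + real k + 1) / y)"
      unfolding U_def using c_Suc[of k] by (simp only: y_def add.commute[of t a])
    have eqs: "(t + 1) / (t + a) * hterm x (t + 1) k = c k * ((t + 1) / y)"
      "(t + a - 1) / t * hterm x (t - 1) k = c k * ((y - 1) / t)"
      unfolding shift_up shift_down using y by (simp_all add: y_def)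
    have "t * (t - 1) * ((t + 1) / (t + a) * hterm x (t + 1) k - 2 * c k + (t + a - 1) / t * hterm x (t - 1) k)
      + a * (1 - a) * c k = c k * (t * (t - 1) * ((t + 1) / y - 2 + (y - 1) / t) + a * (1 - a))"
      unfolding eqs by (rule factor)
    also have "t * (t - 1) * ((t + 1) / y - 2 + (y - 1) / t) + a * (1 - a)
        = real k * (2 * a + real k - 1) - (a + real k - 1) * (a + real k) * (a + real k + 1) / y"
      using hF_recurrence_algebra[of t y a "real k"] y assms by (simp add: y_def)
    also have "c k * \<dots> = U k - U (Suc k)"
      unfolding U_Suc by (simp only: U_def right_diff_distrib)
    finally show ?thesis .
  qed
  have sums: "hterm x (t + 1) sums hF x (t + 1)" "c sums hF x t" "hterm x (t - 1) sums hF x (t - 1)"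
    unfolding c_def using assms by (auto intro!: hterm_sums)
  define R where "R = t * (t - 1) * ((t + 1) / (t + a) * hF x (t + 1) - 2 * hF x t + (t + a - 1) / t * hF x (t - 1)) + a * (1 - a) * hF x t"
  have "(\<lambda>k. U k - U (Suc k)) sums R"
    unfolding tele[symmetric] R_def by (intro sums_add sums_mult sums_diff sums)
  then have "(\<lambda>n. \<Sum>k<n. U k - U (Suc k)) \<longlonglongrightarrow> R" by (simp add: sums_def)
  then have "(\<lambda>n. U 0 - U n) \<longlonglongrightarrow> R" by (simp only: sum_lessThan_telescope')
  then have "(\<lambda>n. - U n) \<longlonglongrightarrow> R" by (simp add: U_def)
  then have "(\<lambda>n. \<bar>- U n\<bar>) \<longlonglongrightarrow> \<bar>R\<bar>" by (rule tendsto_rabs)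
  \<comment> \<open>The boundary term at infinity: \<open>U n / (n + 1)\<close> grows by one factor
    n against \<open>c n\<close>, and so does the term of the series at t - 1, by
    \<open>shift_down\<close>. That series converges absolutely because t > 1.\<close>
  moreover have "summable (\<lambda>n. \<bar>- U n\<bar> / (real n + 1))"
  proof -
    have "summable (\<lambda>k. \<bar>hterm x (t - 1) (Suc k)\<bar>)"
      unfolding hterm_Suc abs_mult using assms hg_pos[of x "t - 1"]
      by (intro summable_mult) (simp add: abs_of_pos summable_hg)
    then have "summable (\<lambda>k. \<bar>hterm x (t - 1) k\<bar>)" by (subst (asm) summable_Suc_iff)
    then have "summable (\<lambda>k. 2 * (t + a) * \<bar>hterm x (t - 1) k\<bar>)" by (rule summable_mult)
    then show ?thesis
    proof (rule summable_comparison_test'[where N = 0])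
      fix n
      have "\<bar>real n * (2 * a + real n - 1)\<bar> \<le> 2 * (t + a + real n - 1) * (real n + 1)"
      proof (cases "n = 0")
        case False
        then have "0 \<le> 2 * a + real n - 1" "2 * a + real n - 1 \<le> 2 * (t + a + real n - 1)" using a assms by auto
        then have "real n * (2 * a + real n - 1) \<le> (real n + 1) * (2 * (t + a + real n - 1))"
          by (intro mult_mono) auto
        then show ?thesis using \<open>0 \<le> 2 * a + real n - 1\<close> by (simp add: abs_mult mult_ac)
      qed (use a assms in auto)
      then have "\<bar>- U n\<bar> \<le> \<bar>c n\<bar> * (2 * (t + a + real n - 1) * (real n + 1))"
        unfolding U_def abs_minus_cancel abs_mult[of "c n"] by (intro mult_left_mono) auto
      then have "\<bar>- U n\<bar> / (real n + 1) \<le> \<bar>c n\<bar> * (2 * (t + a + real n - 1))"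
        by (simp add: divide_simps mult_ac)
      also have "\<dots> \<le> 2 * (t + a) * \<bar>hterm x (t - 1) n\<bar>"
      proof -
        have p: "t + a - 1 > 0" "t + a + real n - 1 > 0" using a assms by auto
        have e: "(t + a + real n - 1) * \<bar>c n\<bar> = (t + a - 1) * \<bar>hterm x (t - 1) n\<bar>"
          unfolding shift_down abs_mult abs_divide using p by simp
        have "(t + a - 1) * \<bar>hterm x (t - 1) n\<bar> \<le> (t + a) * \<bar>hterm x (t - 1) n\<bar>"
          by (intro mult_right_mono) auto
        moreover have "\<bar>c n\<bar> * (2 * (t + a + real n - 1)) = 2 * ((t + a + real n - 1) * \<bar>c n\<bar>)"
          "2 * (t + a) * \<bar>hterm x (t - 1) n\<bar> = 2 * ((t + a) * \<bar>hterm x (t - 1) n\<bar>)"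
          by (simp_all only: mult_ac)
        ultimately show ?thesis using e by linarith
      qed
      finally show "norm (\<bar>- U n\<bar> / (real n + 1)) \<le> 2 * (t + a) * \<bar>hterm x (t - 1) n\<bar>" by simp
    qed
  qed
  ultimately have "\<bar>R\<bar> = 0" by (rule limit_zero_if_summable_over_n) auto
  then have R: "R = 0" by simp
  have t: "t * (t - 1) > 0" using assms by simp
  define X where "X = (t + 1) / (t + a) * hF x (t + 1) - 2 * hF x t + (t + a - 1) / t * hF x (t - 1)"
  have "t * (t - 1) * X = - (a * (1 - a)) * hF x t" using R unfolding R_def X_def by simp
  then have "X = - (a * (1 - a)) * hF x t / (t * (t - 1))"
    using t by (metis nonzero_mult_div_cancel_left less_irrefl)
  then have X: "X = - (a * (1 - a)) / (t * (t - 1)) * hF x t" by simp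
  have "a * (1 - a) = (1/2 + x) * (1/2 - x)" "t + x + 1/2 = t + a" "t + x - 1/2 = t + a - 1"
    by (simp_all add: a_def algebra_simps)
  then show ?thesis using X unfolding X_def by (simp only:)
qed

section \<open>Solutions of the eigenvalue recurrence\<close>

text \<open>The quotient \<Gamma>(t + 1) / \<Gamma>(t + x + 1/2) at t = \<nu> + m, normalised to 1
  at m = 0. Its order of growth is m^(1/2 - x).\<close>

definition wt :: "real \<Rightarrow> real \<Rightarrow> nat \<Rightarrow> real" where
  "wt x \<nu> m = pochhammer (\<nu> + 1) m / pochhammer (\<nu> + x + 1/2) m"

text \<open>Named after the Jost solution of scattering theory: it is singled out by its behaviour
  at infinity and not by initial values. Its value at m = 0 decides about the eigenvalue.\<close>

definition jost :: "real \<Rightarrow> real \<Rightarrow> nat \<Rightarrow> real" where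
  "jost x \<nu> m = wt x \<nu> m * hF x (\<nu> + real m)"

text \<open>The discrete Euler equation with \<open>s m\<close> placed at \<nu> + m. It is written
  as a law for increments, so that concavity where \<open>s\<close> is nonnegative and \<kappa> > 0
  can be read off directly.\<close>

definition solves_rec :: "real \<Rightarrow> real \<Rightarrow> (nat \<Rightarrow> real) \<Rightarrow> bool" where
  "solves_rec \<kappa> \<nu> s \<longleftrightarrow>
     (\<forall>m. s (Suc (Suc m)) - s (Suc m) = s (Suc m) - s m - \<kappa> * s (Suc m) / ((\<nu> + real m) * (\<nu> + real m + 1)))"

lemma solves_recD:
  "solves_rec \<kappa> \<nu> s \<Longrightarrow>
    s (Suc (Suc m)) - s (Suc m) = s (Suc m) - s m - \<kappa> * s (Suc m) / ((\<nu> + real m) * (\<nu> + real m + 1))"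
  by (simp add: solves_rec_def)

lemma wt_pos: "x \<ge> 0 \<Longrightarrow> \<nu> > 0 \<Longrightarrow> wt x \<nu> m > 0"
  unfolding wt_def by (intro divide_pos_pos pochhammer_pos) auto

lemma wt_0 [simp]: "wt x \<nu> 0 = 1"
  by (simp add: wt_def)

lemma wt_Suc: "wt x \<nu> (Suc m) = wt x \<nu> m * ((\<nu> + real m + 1) / (\<nu> + real m + x + 1/2))"
  by (simp add: wt_def pochhammer_Suc algebra_simps)

lemma jost_0 [simp]: "jost x \<nu> 0 = hF x \<nu>"
  by (simp add: jost_def)

lemma jost_solves_rec:
  assumes "x \<ge> 0" "\<nu> > 0"
  shows "solves_rec ((1/2 + x) * (1/2 - x)) \<nu> (jost x \<nu>)"
  unfolding solves_rec_def
proof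
  fix m
  define t W where "t = \<nu> + real m + 1" and "W = wt x \<nu> (Suc m)"
  have t: "t > 1" using assms by (simp add: t_def)
  have W2: "wt x \<nu> (Suc (Suc m)) = W * ((t + 1) / (t + x + 1/2))"
    unfolding wt_Suc[of x \<nu> "Suc m"] W_def t_def by (simp add: algebra_simps)
  have "W = wt x \<nu> m * (t / (t + x - 1/2))"
    unfolding W_def wt_Suc t_def by (simp add: algebra_simps)
  then have W0: "wt x \<nu> m = W * ((t + x - 1/2) / t)" using t assms by simp
  have e: "\<nu> + real m = t - 1" "\<nu> + real (Suc m) = t" "\<nu> + real (Suc (Suc m)) = t + 1"
    by (simp_all add: t_def)
  have e': "\<nu> + real m + 1 = t" by (simp add: t_def)
  have "jost x \<nu> (Suc (Suc m)) + jost x \<nu> m - 2 * jost x \<nu> (Suc m)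
      = W * ((t + 1) / (t + x + 1/2) * hF x (t + 1) + (t + x - 1/2) / t * hF x (t - 1) - 2 * hF x t)"
    unfolding jost_def W2 W0 W_def[symmetric] e by (simp only: distrib_left right_diff_distrib mult_ac)
  also have "\<dots> = W * (- ((1/2 + x) * (1/2 - x)) / (t * (t - 1)) * hF x t)"
    unfolding hF_recurrence[OF assms(1) t] ..
  also have "\<dots> = - ((1/2 + x) * (1/2 - x) * jost x \<nu> (Suc m) / ((\<nu> + real m) * (\<nu> + real m + 1)))"
    unfolding jost_def W_def[symmetric] e' unfolding e by (simp add: mult_ac)
  finally show "jost x \<nu> (Suc (Suc m)) - jost x \<nu> (Suc m) = jost x \<nu> (Suc m) - jost x \<nu> m
      - (1/2 + x) * (1/2 - x) * jost x \<nu> (Suc m) / ((\<nu> + real m) * (\<nu> + real m + 1))" by linarith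
qed

lemma divide_le_divide_cross: "0 < p \<Longrightarrow> 0 < q \<Longrightarrow> a * q \<le> b * p \<Longrightarrow> a / p \<le> b / q" for a b p q :: real
  by (simp add: divide_simps mult.commute)

text \<open>Induction on a ratio of linear functions replaces Gamma asymptotics. With the shift 1/4
  the one-step inequality compares two cubics that agree except in the constant term.\<close>

lemma wt_sq_le:
  assumes "x \<ge> 0" "\<nu> > 0"
  shows "(wt x \<nu> m)\<^sup>2 \<le> (\<nu> + real m + 1/4) / (\<nu> + 1/4)"
proof (induction m)
  case (Suc m)
  define y where "y = \<nu> + real m"
  have y: "y > 0" using assms by (simp add: y_def)
  have "((y + 1) / (y + x + 1/2))\<^sup>2 \<le> ((y + 1) / (y + 1/2))\<^sup>2"
    using y assms by (intro power_mono frac_le) auto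
  also have "\<dots> \<le> (y + 5/4) / (y + 1/4)"
  proof -
    have "(y + 1)\<^sup>2 * (y + 1/4) \<le> (y + 5/4) * (y + 1/2)\<^sup>2"
      using y by (simp add: power2_eq_square algebra_simps)
    then show ?thesis unfolding power_divide using y by (intro divide_le_divide_cross) auto
  qed
  finally have "(wt x \<nu> m)\<^sup>2 * ((y + 1) / (y + x + 1/2))\<^sup>2 \<le> (y + 1/4) / (\<nu> + 1/4) * ((y + 5/4) / (y + 1/4))"
    using Suc y assms by (intro mult_mono) (auto simp: y_def)
  also have "\<dots> = (y + 5/4) / (\<nu> + 1/4)" using y by simp
  finally show ?case
    unfolding wt_Suc power_mult_distrib y_def[symmetric] by (simp add: y_def algebra_simps)
qed (use assms in simp)

text \<open>The matching lower bound of order m at x = 0. With the shift 1/3 the two cubics of the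
  one-step inequality differ only in the linear term.\<close>

lemma wt_0_sq_ge:
  assumes "\<nu> > 0"
  shows "(wt 0 \<nu> m)\<^sup>2 \<ge> (\<nu> + real m + 1/3) / (\<nu> + 1/3)"
proof (induction m)
  case (Suc m)
  define y where "y = \<nu> + real m"
  have y: "y > 0" using assms by (simp add: y_def)
  have "(y + 1/3) / (\<nu> + 1/3) * ((y + 4/3) / (y + 1/3)) \<le> (wt 0 \<nu> m)\<^sup>2 * ((y + 1) / (y + 1/2))\<^sup>2"
  proof (rule mult_mono)
    have "(y + 4/3) * (y + 1/2)\<^sup>2 \<le> (y + 1)\<^sup>2 * (y + 1/3)"
      using y by (simp add: power2_eq_square algebra_simps)
    then show "(y + 4/3) / (y + 1/3) \<le> ((y + 1) / (y + 1/2))\<^sup>2"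
      unfolding power_divide using y by (intro divide_le_divide_cross) auto
  qed (use Suc y assms in \<open>auto simp: y_def\<close>)
  moreover have "(y + 1/3) / (\<nu> + 1/3) * ((y + 4/3) / (y + 1/3)) = (y + 4/3) / (\<nu> + 1/3)" using y by simp
  ultimately show ?case
    unfolding wt_Suc power_mult_distrib y_def[symmetric] by (simp add: y_def algebra_simps)
qed (use assms in simp)

text \<open>The terms are of order m^(-1 - 2 x), so x > 0 is exactly what separates eigenvalues
  above 4 from the threshold.\<close>

lemma summable_wt_sq:
  assumes "x > 0" "\<nu> > 0"
  shows "summable (\<lambda>m. (wt x \<nu> m / (real m + 1))\<^sup>2)" (is "summable ?f")
proof (rule raabes_test_convergence)
  have W: "wt x \<nu> m > 0" for m using assms by (intro wt_pos) auto
  then show "\<forall>\<^sub>F m in sequentially. 0 < ?f m" by (intro always_eventually allI) (simp add: less_imp_neq[symmetric])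
  have ratio: "?f m / ?f (Suc m) = ((\<nu> + real m + x + 1/2) * (real m + 2) / ((\<nu> + real m + 1) * (real m + 1)))\<^sup>2" for m
  proof -
    have "\<nu> + real m + x + 1/2 > 0" "\<nu> + real m + 1 > 0" using assms by auto
    then show ?thesis unfolding wt_Suc power_divide[symmetric] using W[of m] by (simp add: add_ac)
  qed
  have "(\<lambda>m. real m * (?f m / ?f (Suc m) - 1)) \<longlonglongrightarrow> 1 + 2 * x"
    unfolding ratio by real_asymp
  then have "(\<lambda>k. ereal (real k * (?f k / ?f (Suc k) - 1))) \<longlonglongrightarrow> ereal (1 + 2 * x)"
    by (rule tendsto_ereal)
  then have "liminf (\<lambda>k. ereal (real k * (?f k / ?f (Suc k) - 1))) = ereal (1 + 2 * x)"
    by (intro lim_imp_Liminf) auto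
  then show "1 < liminf (\<lambda>k. ereal (real k * (?f k / ?f (Suc k) - 1)))"
    using assms by (simp add: one_ereal_def)
qed

text \<open>The discrete Wronskian: both sequences satisfy s(m+2) = (2 - q) s(m+1) - s(m) with the
  same q, so the determinant is preserved.\<close>

lemma casoratian_const:
  assumes "solves_rec \<kappa> \<nu> s" "solves_rec \<kappa> \<nu> r"
  shows "s (Suc m) * r m - s m * r (Suc m) = s 1 * r 0 - s 0 * r 1"
proof (induction m)
  case (Suc m)
  define q where "q = \<kappa> / ((\<nu> + real m) * (\<nu> + real m + 1))"
  have "s (Suc (Suc m)) = 2 * s (Suc m) - s m - q * s (Suc m)"
    "r (Suc (Suc m)) = 2 * r (Suc m) - r m - q * r (Suc m)"
    using solves_recD[OF assms(1), of m] solves_recD[OF assms(2), of m] by (simp_all add: q_def)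

  then have "s (Suc (Suc m)) * r (Suc m) - s (Suc m) * r (Suc (Suc m)) = s (Suc m) * r m - s m * r (Suc m)"
    by algebra
  then show ?case using Suc by simp
qed simp

text \<open>A negative increment would persist by concavity and drive the sequence below zero.
  Increments being nonincreasing, the current one is at most the average slope since M. This
  converts size bounds on the Jost solution into bounds on its increments.\<close>

lemma concave_pos_increments:
  fixes r :: "nat \<Rightarrow> real"
  assumes pos: "\<And>m. m \<ge> M \<Longrightarrow> r m \<ge> 0"
    and conc: "\<And>m. m \<ge> M \<Longrightarrow> r (Suc (Suc m)) - r (Suc m) \<le> r (Suc m) - r m"
    and m: "m \<ge> M"
  shows "r (Suc m) - r m \<ge> 0" "(real m - real M) * (r (Suc m) - r m) \<le> r m"
proof -
  define d where "d m = r (Suc m) - r m" for m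
  have anti: "d n \<le> d m" if "M \<le> m" "m \<le> n" for m n
    using that(2)
  proof (induction n rule: dec_induct)
    case (step n)
    then show ?case using conc[of n] that(1) by (simp add: d_def)
  qed simp
  show "r (Suc m) - r m \<ge> 0"
  proof (rule ccontr)
    assume "\<not> r (Suc m) - r m \<ge> 0"
    then have neg: "d m < 0" by (simp add: d_def)
    have "r (m + k) \<le> r m + real k * d m" for k
    proof (induction k)
      case (Suc k)
      have "r (m + Suc k) = r (m + k) + d (m + k)" by (simp add: d_def)
      also have "\<dots> \<le> r m + real k * d m + d m" using Suc anti[of m "m + k"] m by (intro add_mono) auto
      finally show ?case by (simp add: algebra_simps)
    qed simp
    moreover obtain k :: nat where "real k > r m / (- d m)" using reals_Archimedean2 by blast
    then have "r m + real k * d m < 0" using neg by (simp add: field_simps)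
    ultimately have "r (m + k) < 0" by (meson le_less_trans)
    then show False using pos[of "m + k"] m by simp
  qed
  have "r n \<ge> (real n - real M) * d m" if "M \<le> n" "n \<le> m" for n
    using that
  proof (induction n rule: dec_induct)
    case base
    then show ?case using pos[of M] by simp
  next
    case (step n)
    have "(real (Suc n) - real M) * d m = (real n - real M) * d m + d m" by (simp add: algebra_simps)
    also have "\<dots> \<le> r n + d n" using step anti[of n m] by (intro add_mono) auto
    finally show ?case by (simp add: d_def)
  qed
  from this[of m] show "(real m - real M) * (r (Suc m) - r m) \<le> r m" using m by (simp add: d_def)
qed

section \<open>Energy estimate for eigenvalues below 4\<close>

lemma solves_rec_consecutive_zeros:
  assumes "solves_rec \<kappa> \<nu> s" "s m = 0" "s (Suc m) = 0"
  shows "s 0 = 0 \<and> s 1 = 0"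
  using assms(2,3)
proof (induction m)
  case (Suc m)
  have "s m = 0" using solves_recD[OF assms(1), of m] Suc.prems by simp
  then show ?case using Suc by simp
qed simp

text \<open>The change of the energy in one step, with T the old node, d the old increment, h the
  new value and h - d the old value. The second term on the right is nonnegative, so the loss is at
  most \<kappa> d^2 / T.\<close>

lemma energy_identity:
  fixes T d \<kappa> h :: real
  assumes "T > 0"
  shows "(T + 1) * (d - \<kappa> * h / (T * (T + 1)))\<^sup>2 - h * (d - \<kappa> * h / (T * (T + 1))) + \<kappa> * h\<^sup>2 / (T + 1)
      - (T * d\<^sup>2 - (h - d) * d + \<kappa> * (h - d)\<^sup>2 / T)
    = - (\<kappa> / T * d\<^sup>2) + \<kappa>\<^sup>2 * h\<^sup>2 / (T\<^sup>2 * (T + 1))"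
proof -
  define u v where "u = 1 / T" and "v = 1 / (T + 1)"
  have uv: "T * u = 1" "(T + 1) * v = 1" using assms by (simp_all add: u_def v_def)
  have e: "\<kappa> * h / (T * (T + 1)) = \<kappa> * h * u * v" "\<kappa> * h\<^sup>2 / (T + 1) = \<kappa> * h\<^sup>2 * v"
    "\<kappa> * (h - d)\<^sup>2 / T = \<kappa> * (h - d)\<^sup>2 * u" "\<kappa> / T * d\<^sup>2 = \<kappa> * u * d\<^sup>2"
    "\<kappa>\<^sup>2 * h\<^sup>2 / (T\<^sup>2 * (T + 1)) = \<kappa>\<^sup>2 * h\<^sup>2 * u\<^sup>2 * v"
    by (simp_all add: u_def v_def power2_eq_square)
  show ?thesis unfolding e using uv by algebra
qed

text \<open>The energy is a discretisation of the first integral \<open>t s'\<^sup>2 - s s' + \<kappa> s\<^sup>2 / t\<close>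
  of the Euler equation \<open>s'' = - \<kappa> s / t\<^sup>2\<close>; it is positive definite exactly for \<open>\<kappa> > 1/4\<close>.\<close>

lemma no_square_summable_solution:
  assumes rec: "solves_rec \<kappa> \<nu> s" and \<nu>: "\<nu> > 0" and \<kappa>: "\<kappa> > 1/4" and nz: "s 1 \<noteq> 0"
    and sd: "summable (\<lambda>m. (s (Suc m) - s m)\<^sup>2)" and ss: "summable (\<lambda>m. (s m / (real m + \<nu>))\<^sup>2)"
  shows False
proof -
  define t where "t m = \<nu> + real m" for m
  define d where "d m = s (Suc m) - s m" for m
  define E where "E m = t m * (d m)\<^sup>2 - s m * d m + \<kappa> * (s m)\<^sup>2 / t m" for m
  \<comment> \<open>Completing the square writes the energy as \<delta> t d^2 plus \<kappa>/t times
    a square; \<delta> > 0 is the condition \<kappa> > 1/4.\<close>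
  define \<delta> where "\<delta> = 1 - 1 / (4 * \<kappa>)"
  have \<delta>: "\<delta> > 0" using \<kappa> by (simp add: \<delta>_def field_simps)
  have t: "t m > 0" for m using \<nu> by (simp add: t_def)
  have E_ge: "E m \<ge> \<delta> * (t m * (d m)\<^sup>2)" for m
  proof -
    have "E m - \<delta> * (t m * (d m)\<^sup>2) = \<kappa> / t m * (s m - t m * d m / (2 * \<kappa>))\<^sup>2"
      unfolding E_def \<delta>_def using t[of m] \<kappa> by (simp add: field_simps power2_eq_square)
    also have "\<dots> \<ge> 0" using t[of m] \<kappa> by (intro mult_nonneg_nonneg) auto
    finally show ?thesis by simp
  qed
  have E_nonneg: "E m \<ge> 0" for m
    using E_ge[of m] \<delta> t[of m] by (meson mult_nonneg_nonneg less_imp_le order_trans zero_le_power2)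
  have E_pos: "E m > 0" for m
  proof (rule ccontr)
    assume "\<not> E m > 0"
    then have E0: "E m = 0" using E_nonneg[of m] by simp
    then have "\<delta> * (t m * (d m)\<^sup>2) \<le> 0" using E_ge[of m] by simp
    then have "d m = 0" using \<delta> t[of m] by (simp add: mult_le_0_iff) 
    then have "s m = 0" using E0 t[of m] \<kappa> by (simp add: E_def)
    then show False using solves_rec_consecutive_zeros[OF rec, of m] \<open>d m = 0\<close> nz by (simp add: d_def)
  qed
  have E_Suc: "E (Suc m) \<ge> E m - \<kappa> / t m * (d m)\<^sup>2" for m
  proof -
    have a: "t (Suc m) = t m + 1" by (simp add: t_def)
    have b: "d (Suc m) = d m - \<kappa> * s (Suc m) / (t m * (t m + 1))"
      unfolding d_def t_def using solves_recD[OF rec, of m] by simp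
    have c: "s m = s (Suc m) - d m" by (simp add: d_def)
    have "E (Suc m) - E m = - (\<kappa> / t m * (d m)\<^sup>2) + \<kappa>\<^sup>2 * (s (Suc m))\<^sup>2 / ((t m)\<^sup>2 * (t m + 1))"
      unfolding E_def a b unfolding c using energy_identity[OF t[of m], of "d m" \<kappa> "s (Suc m)"] by simp
    moreover have "\<kappa>\<^sup>2 * (s (Suc m))\<^sup>2 / ((t m)\<^sup>2 * (t m + 1)) \<ge> 0"
      using t[of m] by (intro divide_nonneg_nonneg mult_nonneg_nonneg) auto
    ultimately show ?thesis by linarith
  qed
  define C where "C = \<kappa> / \<delta>"
  have C: "C > 0" using \<kappa> \<delta> by (simp add: C_def)
  have E_step: "E (Suc m) \<ge> (1 - C / (t m)\<^sup>2) * E m" for m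
  proof -
    have "\<kappa> / t m * (d m)\<^sup>2 = C / (t m)\<^sup>2 * (\<delta> * (t m * (d m)\<^sup>2))"
      using t[of m] \<delta> by (simp add: C_def power2_eq_square)
    also have "\<dots> \<le> C / (t m)\<^sup>2 * E m" using C by (intro mult_left_mono E_ge) auto
    finally show ?thesis using E_Suc[of m] by (simp add: left_diff_distrib)
  qed
  obtain M :: nat where M: "real M > 2 * C + 2" using reals_Archimedean2 by blast
  \<comment> \<open>A comparison sequence decreasing to 1 with
    \<open>w (Suc m) \<le> (1 - C / (t m)^2) * w m\<close> beyond M. Hence the energy cannot fall
    below a positive multiple of it, although it may decrease.\<close>
  define w where "w m = 1 + 2 * C / t m" for m
  have w: "w m \<ge> 1" for m using C t[of m] by (simp add: w_def)
  have E_lower: "E m \<ge> E M / w M * w m" if "m \<ge> M" for m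
    using that
  proof (induction m rule: dec_induct)
    case (step m)
    have tm: "t m > 2 * C + 2" using M step \<nu> by (simp add: t_def)
    have "(1 - C / (t m)\<^sup>2) * w m - w (Suc m) = C * ((t m)\<^sup>2 - t m - 2 * C * t m - 2 * C) / ((t m) ^ 3 * (t m + 1))"
    proof -
      have a: "t (Suc m) = t m + 1" by (simp add: t_def)
      show ?thesis unfolding w_def a using t[of m]
        by (simp add: divide_simps) (simp add: algebra_simps power2_eq_square power3_eq_cube)
    qed
    moreover have "(t m)\<^sup>2 - t m - 2 * C * t m - 2 * C \<ge> 0"
    proof -
      have "(t m)\<^sup>2 - t m - 2 * C * t m - 2 * C = t m * (t m - 2 * C - 2) + (t m - 2 * C)"
        by (simp add: power2_eq_square algebra_simps)
      moreover have "t m * (t m - 2 * C - 2) \<ge> 0" using tm t[of m] by (intro mult_nonneg_nonneg) auto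
      ultimately show ?thesis using tm C by linarith
    qed
    ultimately have ww: "w (Suc m) \<le> (1 - C / (t m)\<^sup>2) * w m"
      using C t[of m] by (smt (verit) divide_nonneg_pos mult_nonneg_nonneg mult_pos_pos zero_less_power)
    have "C / (t m)\<^sup>2 \<le> 1"
    proof -
      have "C * 1 \<le> t m * t m" using tm C by (intro mult_mono) auto
      then show ?thesis using t[of m] by (simp add: power2_eq_square)
    qed
    then have c0: "0 \<le> 1 - C / (t m)\<^sup>2" by simp
    have "E M / w M * w (Suc m) \<le> E M / w M * ((1 - C / (t m)\<^sup>2) * w m)"
      using ww E_nonneg[of M] w[of M] by (intro mult_left_mono) auto
    also have "\<dots> = (1 - C / (t m)\<^sup>2) * (E M / w M * w m)" by simp
    also have "\<dots> \<le> (1 - C / (t m)\<^sup>2) * E m" using step c0 by (intro mult_left_mono) auto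
    also have "\<dots> \<le> E (Suc m)" by (rule E_step)
    finally show ?case .
  qed (use w[of M] in auto)
  have lower: "E m \<ge> E M / w M" if "m \<ge> M" for m
  proof -
    have "E M / w M * 1 \<le> E M / w M * w m" using w[of m] w[of M] E_nonneg[of M] by (intro mult_left_mono) auto
    then show ?thesis using E_lower[OF that] by simp
  qed
  have s1: "summable (\<lambda>m. (s m / t m)\<^sup>2)" using ss by (simp add: t_def add.commute)
  have s2: "summable (\<lambda>m. (d m)\<^sup>2)" using sd by (simp add: d_def)
  \<comment> \<open>Square-summability of d and of s / t makes the energy summable against 1/t,
    which a positive lower bound forbids.\<close>
  have "summable (\<lambda>m. (d m)\<^sup>2 + \<bar>s m / t m * d m\<bar> + \<kappa> * (s m / t m)\<^sup>2)"
    by (intro summable_add summable_mult s1 s2 summable_product_of_squares)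
  then have "summable (\<lambda>m. E m / t m)"
  proof (rule summable_comparison_test'[where N = 0])
    fix m
    have "E m / t m = (d m)\<^sup>2 - s m / t m * d m + \<kappa> * (s m / t m)\<^sup>2"
      unfolding E_def using t[of m] by (simp add: field_simps power2_eq_square)
    moreover have "E m / t m \<ge> 0" using E_nonneg[of m] t[of m] by simp
    then have "norm (E m / t m) = E m / t m" by (simp only: real_norm_def abs_of_nonneg)
    moreover have "- (s m / t m * d m) \<le> \<bar>s m / t m * d m\<bar>" by (rule abs_ge_minus_self)
    ultimately show "norm (E m / t m) \<le> (d m)\<^sup>2 + \<bar>s m / t m * d m\<bar> + \<kappa> * (s m / t m)\<^sup>2"
      by linarith
  qed
  then have "summable (\<lambda>m. (\<nu> + 1) * (w M / E M) * (E m / t m))" by (rule summable_mult)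
  then have "summable (\<lambda>m. 1 / (real m + 1))"
  proof (rule summable_comparison_test'[where N = M])
    fix m assume "m \<ge> M"
    then have "E M / w M \<le> E m" by (rule lower)
    then have "1 \<le> w M / E M * E m" using E_pos[of M] w[of M] by (simp add: field_simps)
    moreover have "1 / (real m + 1) \<le> (\<nu> + 1) / t m"
      using \<nu> by (simp add: t_def divide_simps) (simp add: algebra_simps)
    ultimately have "1 * (1 / (real m + 1)) \<le> (w M / E M * E m) * ((\<nu> + 1) / t m)"
      by (intro mult_mono) auto
    then show "norm (1 / (real m + 1)) \<le> (\<nu> + 1) * (w M / E M) * (E m / t m)" by (simp add: mult_ac)
  qed
  then show False using limit_zero_if_summable_over_n[of "\<lambda>_. 1" 1] by simp
qed

section \<open>Eigenvalues\<close>

lemma inner_scaleC_ell2: "inner (scaleC_ell2 a f) (scaleC_ell2 b f) = Re (a * cnj b) * (norm f)\<^sup>2"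
proof -
  have "inner (a * w) (b * w) = Re (a * cnj b) * (cmod w)\<^sup>2" for w
    unfolding cmod_power2 by (simp add: inner_complex_def algebra_simps power2_eq_square)
  then show ?thesis
    by (simp add: inner_ell2_def norm_ell2_sq scaleC_ell2.rep_eq suminf_mult summable_ell2)
qed

lemma hilbert_L_scaleC:
  assumes "\<nu> > 0"
  shows "hilbert_L \<nu> (scaleC_ell2 c f) = scaleC_ell2 c (hilbert_L \<nu> f)"
  by (rule ell2_eqI)
     (simp only: ell2_nth_hilbert_L[OF assms] scaleC_ell2.rep_eq mult.left_commute[of _ c] suminf_mult[OF summable_hilbert_L_row[OF assms]])

lemma scaleC_ell2_scaleC: "scaleC_ell2 a (scaleC_ell2 b f) = scaleC_ell2 (a * b) f"
  by (rule ell2_eqI) (simp add: scaleC_ell2.rep_eq)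

lemma scaleC_ell2_1: "scaleC_ell2 1 f = f"
  by (rule ell2_eqI) (simp add: scaleC_ell2.rep_eq)

text \<open>The available inner product is the real part of the complex one, so Im z is extracted by
  testing symmetry with \<i> f. Zero is excluded because a vanishing image has vanishing row
  differences, hence all partial sums of f vanish.\<close>

lemma eigenvalue_pos_real:
  assumes \<nu>: "\<nu> > 0" and f: "f \<noteq> 0" and eig: "hilbert_L \<nu> f = scaleC_ell2 z f"
  shows "z = complex_of_real (Re z)" "Re z > 0"
proof -
  have nf: "(norm f)\<^sup>2 > 0" using f by simp
  have "inner (hilbert_L \<nu> f) (scaleC_ell2 \<i> f) = inner f (hilbert_L \<nu> (scaleC_ell2 \<i> f))"
    by (rule hilbert_L_symmetric[OF \<nu>])
  then have "inner (scaleC_ell2 z f) (scaleC_ell2 \<i> f) = inner (scaleC_ell2 1 f) (scaleC_ell2 (\<i> * z) f)"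
    by (simp only: hilbert_L_scaleC[OF \<nu>] eig scaleC_ell2_scaleC scaleC_ell2_1)
  then have "Im z * (norm f)\<^sup>2 = - Im z * (norm f)\<^sup>2"
    unfolding inner_scaleC_ell2 by simp
  then have "Im z = 0" using nf by simp
  then show z: "z = complex_of_real (Re z)" by (simp add: complex_eq_iff)
  have "0 \<le> inner (scaleC_ell2 z f) (scaleC_ell2 1 f)"
    using hilbert_L_nonneg[OF \<nu>, of f] by (simp only: eig scaleC_ell2_1)
  then have "Re z \<ge> 0" unfolding inner_scaleC_ell2 using nf by (simp add: zero_le_mult_iff)
  moreover have "z \<noteq> 0"
  proof
    assume "z = 0"
    then have "hilbert_L \<nu> f = 0"
      unfolding eig by (intro ell2_eqI) (simp add: scaleC_ell2.rep_eq zero_ell2.rep_eq)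
    then have "psum f (Suc m) / complex_of_real ((real m + \<nu>) * (real m + 1 + \<nu>)) = 0" for m
      using hilbert_L_nth_diff[OF \<nu>, of f m] by (simp add: zero_ell2.rep_eq)
    then have "psum f (Suc m) = 0" for m
      using \<nu> by (simp only: divide_eq_0_iff of_real_eq_0_iff) (simp add: add_nonneg_eq_0_iff)
    then have "psum f m = 0" for m by (cases m) auto
    then have "ell2_nth f m = 0" for m using psum_Suc[of f m] by simp
    then have "f = 0" by (intro ell2_eqI) (simp add: zero_ell2.rep_eq)
    then show False using f by simp
  qed
  ultimately show "Re z > 0" using z by (metis less_eq_real_def of_real_0)
qed

text \<open>If the first entry vanished, the recurrence would propagate zeros through the whole
  vector. Dividing by that entry and taking real parts gives a real solution with the standard
  initial values; the last bound is the Hardy inequality \<open>summable_psum_sq\<close>.\<close>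

lemma eigenvector_recurrence:
  assumes \<nu>: "\<nu> > 0" and l: "l > 0" and f: "f \<noteq> 0" and eig: "hilbert_L \<nu> f = scaleC_ell2 (complex_of_real l) f"
  obtains s where "solves_rec (1 / l) \<nu> s" "s 0 = 0" "s 1 = 1"
    "summable (\<lambda>m. (s (Suc m) - s m)\<^sup>2)" "summable (\<lambda>m. (s m / (real m + \<nu>))\<^sup>2)"
proof
  have diff: "ell2_nth f (Suc m) = ell2_nth f m - psum f (Suc m) * complex_of_real (1 / l / ((\<nu> + real m) * (\<nu> + real m + 1)))" for m
  proof -
    have "l * ell2_nth f m - l * ell2_nth f (Suc m) = psum f (Suc m) / complex_of_real ((real m + \<nu>) * (real m + 1 + \<nu>))"
      using hilbert_L_nth_diff[OF \<nu>, of f m] by (simp only: eig scaleC_ell2.rep_eq)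
    also have "\<dots> = l * (psum f (Suc m) * complex_of_real (1 / l / ((\<nu> + real m) * (\<nu> + real m + 1))))"
      using l by (simp add: add_ac)
    finally have "l * ell2_nth f (Suc m) = l * (ell2_nth f m - psum f (Suc m) * complex_of_real (1 / l / ((\<nu> + real m) * (\<nu> + real m + 1))))"
      by algebra
    then show ?thesis using l by (metis mult_left_cancel of_real_eq_0_iff less_irrefl)
  qed
  define f0 where "f0 = ell2_nth f 0"
  have f0: "f0 \<noteq> 0"
  proof
    assume f0: "f0 = 0"
    have "ell2_nth f m = 0 \<and> psum f m = 0" for m
    proof (induction m)
      case (Suc m)
      then have "psum f (Suc m) = 0" by (simp add: psum_Suc)
      then show ?case using Suc diff[of m] by simp
    qed (use f0 in \<open>simp add: f0_def\<close>)
    then have "f = 0" by (intro ell2_eqI) (simp add: zero_ell2.rep_eq)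
    then show False using f by simp
  qed
  define s where "s m = Re (psum f m / f0)" for m
  have sd: "s (Suc m) - s m = Re (ell2_nth f m / f0)" for m
    by (simp add: s_def psum_Suc add_divide_distrib)
  show "solves_rec (1 / l) \<nu> s"
    unfolding solves_rec_def
  proof
    fix m
    have "ell2_nth f (Suc m) / f0 = ell2_nth f m / f0 - complex_of_real (1 / l / ((\<nu> + real m) * (\<nu> + real m + 1))) * (psum f (Suc m) / f0)"
      unfolding diff by (simp add: diff_divide_distrib)
    then have "Re (ell2_nth f (Suc m) / f0) = Re (ell2_nth f m / f0) - (1 / l / ((\<nu> + real m) * (\<nu> + real m + 1))) * s (Suc m)"
      unfolding s_def by (simp only: minus_complex.simps times_complex.simps Re_complex_of_real Im_complex_of_real mult_zero_left diff_0_right)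
    then show "s (Suc (Suc m)) - s (Suc m) = s (Suc m) - s m - 1 / l * s (Suc m) / ((\<nu> + real m) * (\<nu> + real m + 1))"
      unfolding sd by simp
  qed
  show "s 0 = 0" by (simp add: s_def)
  show "s 1 = 1" using f0 by (simp add: s_def psum_Suc f0_def)
  show "summable (\<lambda>m. (s (Suc m) - s m)\<^sup>2)"
  proof (rule summable_comparison_test'[OF summable_mult[OF summable_ell2[of f], of "1 / (cmod f0)\<^sup>2"], where N = 0])
    fix m
    have "\<bar>Re (ell2_nth f m / f0)\<bar>\<^sup>2 \<le> (cmod (ell2_nth f m / f0))\<^sup>2"
      by (intro power_mono abs_Re_le_cmod) auto
    then show "norm ((s (Suc m) - s m)\<^sup>2) \<le> 1 / (cmod f0)\<^sup>2 * (cmod (ell2_nth f m))\<^sup>2"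
      unfolding sd by (simp add: norm_divide power_divide)
  qed
  have "summable (\<lambda>m. (s (Suc m) / (real (Suc m) + \<nu>))\<^sup>2)"
  proof (rule summable_comparison_test'[OF summable_mult[OF summable_psum_sq[OF \<nu>, of f], of "1 / (cmod f0)\<^sup>2"], where N = 0])
    fix m
    have "\<bar>s (Suc m)\<bar> \<le> cmod (psum f (Suc m) / f0)" unfolding s_def by (rule abs_Re_le_cmod)
    then have "\<bar>s (Suc m)\<bar> / (real (Suc m) + \<nu>) \<le> cmod (psum f (Suc m) / f0) / (real m + \<nu>)"
      using \<nu> by (intro frac_le) auto
    then have "(\<bar>s (Suc m)\<bar> / (real (Suc m) + \<nu>))\<^sup>2 \<le> (cmod (psum f (Suc m) / f0) / (real m + \<nu>))\<^sup>2"
      using \<nu> by (intro power_mono) auto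
    also have "\<dots> = 1 / (cmod f0)\<^sup>2 * (cmod (psum f (Suc m)) / (real m + \<nu>))\<^sup>2"
      unfolding norm_divide power_divide by simp
    finally show "norm ((s (Suc m) / (real (Suc m) + \<nu>))\<^sup>2) \<le> 1 / (cmod f0)\<^sup>2 * (cmod (psum f (Suc m)) / (real m + \<nu>))\<^sup>2"
      by (simp only: power_divide power2_abs real_norm_def abs_divide abs_power2)
  qed
  then show "summable (\<lambda>m. (s m / (real m + \<nu>))\<^sup>2)"
    by (subst (asm) summable_Suc_iff)
qed

lemma hF_eventually_pos:
  assumes "0 \<le> x" "x \<le> 1/2" "\<nu> > 0"
  obtains M where "\<And>m. m \<ge> M \<Longrightarrow> hF x (\<nu> + real m) > 0"
proof -
  have "eventually (\<lambda>t. hF x t > 0) at_top"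
    using hF_tendsto_1[OF assms(1,2)] by (rule order_tendstoD) simp
  then obtain t0 where t0: "\<And>t. t \<ge> t0 \<Longrightarrow> hF x t > 0" by (auto simp: eventually_at_top_linorder)
  obtain M :: nat where "real M > t0" using reals_Archimedean2 by blast
  then show ?thesis using assms(3) by (intro that[of M] t0) auto
qed

lemma jost_concave:
  assumes "0 \<le> x" "x < 1/2" "\<nu> > 0" "hF x (\<nu> + real (Suc m)) \<ge> 0"
  shows "jost x \<nu> (Suc (Suc m)) - jost x \<nu> (Suc m) \<le> jost x \<nu> (Suc m) - jost x \<nu> m"
proof -
  have "jost x \<nu> (Suc m) \<ge> 0"
    unfolding jost_def using assms wt_pos[OF assms(1,3)] by (intro mult_nonneg_nonneg) (auto intro: less_imp_le)
  then have "(1/2 + x) * (1/2 - x) * jost x \<nu> (Suc m) / ((\<nu> + real m) * (\<nu> + real m + 1)) \<ge> 0"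
    using assms by (intro divide_nonneg_nonneg mult_nonneg_nonneg) auto
  then show ?thesis using solves_recD[OF jost_solves_rec[OF assms(1,3)], of m] by linarith
qed

lemma abs_jost_le:
  assumes "0 \<le> x" "x \<le> 1/2" "\<nu> > 0" "hF x (\<nu> + real m) \<ge> 0"
  shows "\<bar>jost x \<nu> m\<bar> \<le> wt x \<nu> m"
proof -
  have "\<bar>jost x \<nu> m\<bar> = wt x \<nu> m * hF x (\<nu> + real m)"
    unfolding jost_def using assms wt_pos[OF assms(1,3), of m] by (simp add: abs_mult)
  also have "\<dots> \<le> wt x \<nu> m * 1"
    using assms wt_pos[OF assms(1,3), of m] by (intro mult_left_mono hF_le_1) auto
  finally show ?thesis by simp
qed

text \<open>The Casoratian with the Jost solution is constant and, divided by \<open>\<surd>n\<close>, square-summable, hence zero.\<close>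

lemma hF_zero_if_square_summable:
  assumes x: "0 \<le> x" "x < 1/2" and \<nu>: "\<nu> > 0"
    and rec: "solves_rec ((1/2 + x) * (1/2 - x)) \<nu> s" and s0: "s 0 = 0" "s 1 = 1"
    and sd: "summable (\<lambda>m. (s (Suc m) - s m)\<^sup>2)" and ss: "summable (\<lambda>m. (s m / (real m + \<nu>))\<^sup>2)"
  shows "hF x \<nu> = 0"
proof -
  define r where "r = jost x \<nu>"
  \<comment> \<open>Because s starts with 0 and 1, the constant Casoratian equals the value of the
    Jost solution at 0, that is, the number claimed to vanish.\<close>
  define W where "W = hF x \<nu>"
  have W: "W = s (Suc m) * r m - s m * r (Suc m)" for m
    using casoratian_const[OF rec jost_solves_rec[OF x(1) \<nu>], of m] s0 by (simp add: W_def r_def)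
  obtain M where M: "\<And>m. m \<ge> M \<Longrightarrow> hF x (\<nu> + real m) > 0"
    using hF_eventually_pos[of x \<nu>] x \<nu> by auto
  have rpos: "r m \<ge> 0" if "m \<ge> M" for m
    unfolding r_def jost_def using M[OF that] wt_pos[OF x(1) \<nu>, of m] by simp
  have conc: "r (Suc (Suc m)) - r (Suc m) \<le> r (Suc m) - r m" if "m \<ge> M" for m
    unfolding r_def using M[of "Suc m"] that by (intro jost_concave x \<nu>) auto
  note inc = concave_pos_increments[of M r, OF rpos conc]
  define C where "C = (\<nu> + 5/4) / (\<nu> + 1/4)"
  have C: "C > 0" using \<nu> by (simp add: C_def)
  have rsq: "(r m)\<^sup>2 \<le> C * (real m + 1)" if "m \<ge> M" for m
  proof -
    have "(r m)\<^sup>2 \<le> (wt x \<nu> m)\<^sup>2"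
      using abs_jost_le[of x \<nu> m] x \<nu> M[OF that] wt_pos[OF x(1) \<nu>, of m]
      by (intro power2_le_iff_abs_le[THEN iffD2]) (auto simp: r_def)
    also have "\<dots> \<le> (\<nu> + real m + 1/4) / (\<nu> + 1/4)" by (rule wt_sq_le[OF x(1) \<nu>])
    also have "\<dots> \<le> ((\<nu> + 5/4) * (real m + 1)) / (\<nu> + 1/4)"
    proof (intro divide_right_mono)
      have "\<nu> * real m \<ge> 0" using \<nu> by simp
      then show "\<nu> + real m + 1/4 \<le> (\<nu> + 5/4) * (real m + 1)" by (simp add: distrib_left distrib_right)
    qed (use \<nu> in simp)
    finally show ?thesis by (simp add: C_def)
  qed
  \<comment> \<open>Beyond N one has (m + \<nu>)/4 \<le> m - M, so the concavity bound on the
    increments reads e \<le> 4 r / (m + \<nu>).\<close>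
  obtain N :: nat where N: "real N > 2 * real M + \<nu> + 1" using reals_Archimedean2 by blast
  have "summable (\<lambda>m. 2 * C * (s (Suc m) - s m)\<^sup>2 + 32 * C * (s m / (real m + \<nu>))\<^sup>2)"
    by (intro summable_add summable_mult sd ss)
  then have "summable (\<lambda>m. W\<^sup>2 / (real m + 1))"
  proof (rule summable_comparison_test'[where N = N])
    fix m assume "m \<ge> N"
    then have m: "real m > 2 * real M + \<nu> + 1" using N by (simp add: le_trans order_less_le_trans)
    then have "real M \<le> real m" using \<nu> by linarith
    then have mM: "m \<ge> M" by simp
    define d e where "d = s (Suc m) - s m" and "e = r (Suc m) - r m"
    have e0: "e \<ge> 0" and eM: "(real m - real M) * e \<le> r m" using inc[OF _ _ mM] by (auto simp: e_def)
    have "(real m + \<nu>) / 4 * e \<le> (real m - real M) * e"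
      using m \<nu> e0 by (intro mult_right_mono) auto
    then have "e \<le> 4 * r m / (real m + \<nu>)" using eM \<nu> by (simp add: field_simps)
    then have "e\<^sup>2 \<le> (4 * r m / (real m + \<nu>))\<^sup>2" using e0 by (intro power_mono)
    then have e2: "(s m)\<^sup>2 * e\<^sup>2 \<le> 16 * (r m)\<^sup>2 * (s m / (real m + \<nu>))\<^sup>2"
      using mult_left_mono[of "e\<^sup>2" "(4 * r m / (real m + \<nu>))\<^sup>2" "(s m)\<^sup>2"]
      by (simp add: power_divide power_mult_distrib mult_ac)
    have W': "W = d * r m - s m * e" unfolding W[of m] d_def e_def by (simp add: algebra_simps)
    have "W\<^sup>2 \<le> 2 * (d * r m)\<^sup>2 + 2 * (s m * e)\<^sup>2"
      unfolding W' using zero_le_power2[of "d * r m + s m * e"] by (simp add: power2_eq_square algebra_simps)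
    also have "\<dots> \<le> 2 * d\<^sup>2 * (r m)\<^sup>2 + 32 * (r m)\<^sup>2 * (s m / (real m + \<nu>))\<^sup>2"
      using e2 unfolding power_mult_distrib by linarith
    also have "\<dots> = (2 * d\<^sup>2 + 32 * (s m / (real m + \<nu>))\<^sup>2) * (r m)\<^sup>2" by (simp add: algebra_simps)
    also have "\<dots> \<le> (2 * d\<^sup>2 + 32 * (s m / (real m + \<nu>))\<^sup>2) * (C * (real m + 1))"
      by (intro mult_left_mono rsq mM) auto
    also have "\<dots> = (2 * C * d\<^sup>2 + 32 * C * (s m / (real m + \<nu>))\<^sup>2) * (real m + 1)" by (simp add: algebra_simps)
    finally have "W\<^sup>2 / (real m + 1) \<le> 2 * C * d\<^sup>2 + 32 * C * (s m / (real m + \<nu>))\<^sup>2"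
      by (simp add: pos_divide_le_eq)
    then show "norm (W\<^sup>2 / (real m + 1)) \<le> 2 * C * (s (Suc m) - s m)\<^sup>2 + 32 * C * (s m / (real m + \<nu>))\<^sup>2"
      by (simp add: d_def)
  qed
  then have "W\<^sup>2 = 0" by (intro limit_zero_if_summable_over_n[of "\<lambda>_. W\<^sup>2"]) auto
  then show ?thesis by (simp add: W_def)
qed

text \<open>The vanishing Casoratian makes s proportional to the Jost solution at x = 0. Its
  hypergeometric factor vanishes at \<nu> and increases, hence is bounded below from \<nu> + 1 on;
  so s grows at least like the square root of m, against the square-summability of s/m.\<close>

lemma no_eigenvalue_4:
  assumes \<nu>: "\<nu> > 0"
    and rec: "solves_rec (1/4) \<nu> s" and s0: "s 0 = 0" "s 1 = 1"
    and sd: "summable (\<lambda>m. (s (Suc m) - s m)\<^sup>2)" and ss: "summable (\<lambda>m. (s m / (real m + \<nu>))\<^sup>2)"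
  shows False
proof -
  have rec': "solves_rec ((1/2 + 0) * (1/2 - 0)) \<nu> s" using rec by simp
  have z: "hF 0 \<nu> = 0" by (rule hF_zero_if_square_summable[OF _ _ \<nu> rec' s0 sd ss]) auto
  define r where "r = jost 0 \<nu>"
  have W: "s (Suc m) * r m - s m * r (Suc m) = 0" for m
    using casoratian_const[OF rec' jost_solves_rec[OF _ \<nu>], of m] s0 z by (simp add: r_def)
  define h where "h = hF 0 (\<nu> + 1)"
  have h: "h > 0" unfolding h_def using hF_less[of 0 \<nu> "\<nu> + 1"] \<nu> z by simp
  have r_ge: "r (Suc m) \<ge> h * wt 0 \<nu> (Suc m)" for m
  proof -
    have "hF 0 (\<nu> + real (Suc m)) \<ge> h"
      unfolding h_def using hF_less[of 0 "\<nu> + 1" "\<nu> + real (Suc m)"] \<nu> by (cases "m = 0") auto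
    then show ?thesis unfolding r_def jost_def using wt_pos[OF _ \<nu>, of 0 "Suc m"] by (simp add: mult.commute)
  qed
  have r_pos: "r (Suc m) > 0" for m
    using r_ge[of m] h wt_pos[OF _ \<nu>, of 0 "Suc m"] by (meson less_le_trans mult_pos_pos order_refl)
  have s_eq: "s (Suc m) = r (Suc m) / r 1" for m
  proof (induction m)
    case (Suc m)
    have "s (Suc (Suc m)) * r (Suc m) = s (Suc m) * r (Suc (Suc m))" using W[of "Suc m"] by simp
    then have "s (Suc (Suc m)) = s (Suc m) * r (Suc (Suc m)) / r (Suc m)"
      using r_pos[of m] by (simp add: eq_divide_eq)
    then show ?case unfolding Suc using r_pos[of m] by simp
  qed (use s0 r_pos[of 0] in simp)
  have "summable (\<lambda>m. (s (Suc m) / (real (Suc m) + \<nu>))\<^sup>2)" using ss by (subst summable_Suc_iff)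
  then have "summable (\<lambda>m. (\<nu> + 1/3) * (\<nu> + 1) * (r 1 / h)\<^sup>2 * (s (Suc m) / (real (Suc m) + \<nu>))\<^sup>2)" by (rule summable_mult)
  then have "summable (\<lambda>m. 1 / (real m + 1))"
  proof (rule summable_comparison_test'[where N = 0])
    fix m
    define y where "y = \<nu> + real (Suc m)"
    have y: "y > 0" using \<nu> by (simp add: y_def)
    have "y \<le> (\<nu> + 1/3) * (wt 0 \<nu> (Suc m))\<^sup>2"
      using wt_0_sq_ge[OF \<nu>, of "Suc m"] \<nu> by (simp add: y_def field_simps)
    also have "(wt 0 \<nu> (Suc m))\<^sup>2 \<le> (r (Suc m) / h)\<^sup>2"
      using r_ge[of m] h wt_pos[OF _ \<nu>, of 0 "Suc m"] by (intro power_mono) (auto simp: field_simps)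
    also have "\<dots> = (r 1 / h)\<^sup>2 * (s (Suc m))\<^sup>2"
      unfolding s_eq using r_pos[of 0] by (simp add: power_divide)
    finally have "y \<le> (\<nu> + 1/3) * ((r 1 / h)\<^sup>2 * (s (Suc m))\<^sup>2)" using \<nu> by simp
    then have "y / y\<^sup>2 \<le> (\<nu> + 1/3) * ((r 1 / h)\<^sup>2 * (s (Suc m))\<^sup>2) / y\<^sup>2" by (intro divide_right_mono) auto
    then have a: "1 / y \<le> (\<nu> + 1/3) * (r 1 / h)\<^sup>2 * (s (Suc m) / y)\<^sup>2"
      using y by (simp add: power2_eq_square)
    have "1 / (real m + 1) \<le> (\<nu> + 1) * (1 / y)"
      using \<nu> unfolding y_def by (simp add: divide_simps) (simp add: algebra_simps)
    also have "\<dots> \<le> (\<nu> + 1) * ((\<nu> + 1/3) * (r 1 / h)\<^sup>2 * (s (Suc m) / y)\<^sup>2)"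
      using a \<nu> by (intro mult_left_mono) auto
    finally show "norm (1 / (real m + 1)) \<le> (\<nu> + 1/3) * (\<nu> + 1) * (r 1 / h)\<^sup>2 * (s (Suc m) / (real (Suc m) + \<nu>))\<^sup>2"
      by (simp add: y_def mult_ac add_ac)
  qed
  then show False using limit_zero_if_summable_over_n[of "\<lambda>_. 1" 1] by simp
qed

lemma eigenvalue_imp_hF_zero:
  assumes \<nu>: "\<nu> > 0" and "z \<in> point_spectrum (hilbert_L \<nu>)"
  obtains x where "0 < x" "x < 1/2" "hF x \<nu> = 0" "z = complex_of_real (4 / (1 - 4 * x\<^sup>2))"
proof -
  obtain f where f: "f \<noteq> 0" "hilbert_L \<nu> f = scaleC_ell2 z f"
    using assms(2) by (auto simp: point_spectrum_def)
  define l where "l = Re z"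
  have z: "z = complex_of_real l" and l: "l > 0" using eigenvalue_pos_real[OF \<nu> f] by (simp_all add: l_def)
  obtain s where s: "solves_rec (1 / l) \<nu> s" "s 0 = 0" "s 1 = 1"
    "summable (\<lambda>m. (s (Suc m) - s m)\<^sup>2)" "summable (\<lambda>m. (s m / (real m + \<nu>))\<^sup>2)"
    using eigenvector_recurrence[OF \<nu> l f(1) f(2)[unfolded z]] by blast
  have "\<not> 1 / l > 1/4" using no_square_summable_solution[OF s(1) \<nu> _ _ s(4,5)] s(3) by auto
  moreover have "1 / l \<noteq> 1/4" using no_eigenvalue_4[OF \<nu> _ s(2,3,4,5)] s(1) by auto
  ultimately have l4: "1 / l < 1/4" by linarith
  define x where "x = sqrt (1/4 - 1 / l)"
  have x2: "x\<^sup>2 = 1/4 - 1 / l" using l4 by (simp add: x_def)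
  have x0: "x > 0" using l4 by (simp add: x_def)
  have "x\<^sup>2 < (1/2)\<^sup>2" using x2 l by (simp add: power_divide)
  then have xh: "x < 1/2" by (rule power_less_imp_less_base) simp
  have e: "1 / l = (1/2 + x) * (1/2 - x)" using x2 by (simp add: algebra_simps power2_eq_square)
  have zero: "hF x \<nu> = 0" using s(1)[unfolded e] x0 xh by (intro hF_zero_if_square_summable[OF _ _ \<nu> _ s(2-5)]) auto
  have "4 / (1 - 4 * x\<^sup>2) = l" unfolding x2 using l by (simp add: field_simps)
  then show ?thesis using that[OF x0 xh zero] z by simp
qed

section \<open>Positive eigenvectors and the norm\<close>

text \<open>The same vector serves twice: as Schur weight it bounds the norm from above by l, as
  test vector from below.\<close>

lemma positive_eigenvector_onorm:
  assumes \<nu>: "\<nu> > 0" and v: "\<And>n. v n > 0" "summable (\<lambda>n. (v n)\<^sup>2)"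
    and eig: "\<And>m. (\<lambda>n. 1 / (real (max m n) + \<nu>) * v n) sums (l * v m)"
  shows "onorm (hilbert_L \<nu>) = l" "complex_of_real l \<in> point_spectrum (hilbert_L \<nu>)"
proof -
  have L: "hilbert_L \<nu> (real_ell2 v) = scaleC_ell2 (complex_of_real l) (real_ell2 v)"
    using sums_unique[OF eig, symmetric]
    by (intro ell2_eqI) (simp only: hilbert_L_real_nth(2)[OF \<nu> v(2)] scaleC_ell2.rep_eq ell2_nth_real_ell2[OF v(2)] of_real_mult)
  have nz: "real_ell2 v \<noteq> 0"
    using v(1)[of 0] ell2_nth_real_ell2[OF v(2), of 0] by (auto simp: zero_ell2.rep_eq)
  show "complex_of_real l \<in> point_spectrum (hilbert_L \<nu>)"
    unfolding point_spectrum_def using L nz by blast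
  have row: "(\<Sum>n<N. 1 / (real (max m n) + \<nu>) * v n) \<le> l * v m" for m N
    unfolding sums_unique[OF eig] using \<nu> v(1)
    by (intro sum_le_suminf sums_summable[OF eig]) (auto intro!: divide_nonneg_nonneg less_imp_le)
  have le: "onorm (hilbert_L \<nu>) \<le> l" by (rule hilbert_L_onorm_le[OF \<nu> v(1) row])
  have "0 \<le> l * v 0" using row[of 0 0] by simp
  then have l: "l \<ge> 0" using v(1)[of 0] by (simp add: zero_le_mult_iff)
  have "(norm (hilbert_L \<nu> (real_ell2 v)))\<^sup>2 = l\<^sup>2 * (norm (real_ell2 v))\<^sup>2"
    unfolding L using inner_scaleC_ell2[of "complex_of_real l" "real_ell2 v" "complex_of_real l"]
    by (simp add: dot_square_norm power2_eq_square)
  then have "norm (hilbert_L \<nu> (real_ell2 v)) = l * norm (real_ell2 v)"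
    using l by (simp add: power_mult_distrib[symmetric])
  then have "l * norm (real_ell2 v) \<le> onorm (hilbert_L \<nu>) * norm (real_ell2 v)"
    using norm_hilbert_L_le_onorm[OF \<nu>, of "real_ell2 v"] by simp
  then have "l \<le> onorm (hilbert_L \<nu>)" using nz by simp
  with le show "onorm (hilbert_L \<nu>) = l" by simp
qed

text \<open>The eigenvector consists of the increments of the Jost solution. The hypothesis makes
  that solution start at 0, so it is exactly the sequence of partial sums of its increments.\<close>

lemma hF_zero_imp_eigenvector:
  assumes x: "0 < x" "x < 1/2" and \<nu>: "\<nu> > 0" and zero: "hF x \<nu> = 0"
  obtains v where "\<And>n. v n > 0" "summable (\<lambda>n. (v n)\<^sup>2)"
    "\<And>m. (\<lambda>n. 1 / (real (max m n) + \<nu>) * v n) sums (4 / (1 - 4 * x\<^sup>2) * v m)"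
proof -
  define r where "r = jost x \<nu>"
  define v where "v m = r (Suc m) - r m" for m
  define l where "l = 4 / (1 - 4 * x\<^sup>2)"
  have "x\<^sup>2 < (1/2)\<^sup>2" using x by (intro power_strict_mono) auto
  then have l: "l > 0" by (simp add: l_def power_divide)
  have \<kappa>: "(1/2 + x) * (1/2 - x) = 1 / l" by (simp add: l_def algebra_simps power2_eq_square)
  have hpos: "hF x (\<nu> + real (Suc m)) > 0" for m
    using hF_less[of x \<nu> "\<nu> + real (Suc m)"] x \<nu> zero by simp
  have r0: "r 0 = 0" using zero by (simp add: r_def)
  have rS: "r (Suc m) > 0" for m
    unfolding r_def jost_def using hpos[of m] wt_pos[of x \<nu> "Suc m"] x \<nu> by simp
  have rn: "r m \<ge> 0" for m using rS r0 by (cases m) (auto intro: less_imp_le)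
  have conc: "r (Suc (Suc m)) - r (Suc m) \<le> r (Suc m) - r m" for m
    unfolding r_def using hpos[of m] x \<nu> by (intro jost_concave) auto
  have v0: "v m \<ge> 0" and vle: "real m * v m \<le> r m" for m
    using concave_pos_increments[of 0 r m] rn conc by (auto simp: v_def)
  have wt_le: "r m \<le> wt x \<nu> m" for m
  proof -
    have "hF x (\<nu> + real m) \<ge> 0" using zero hpos by (cases m) (auto intro: less_imp_le)
    then show ?thesis using abs_jost_le[of x \<nu> m] x \<nu> by (auto simp: r_def)
  qed
  \<comment> \<open>Concavity gives m v(m) \<le> r(m) \<le> wt(m), and the weights divided by m are
    square-summable since x > 0.\<close>
  have sv: "summable (\<lambda>m. (v m)\<^sup>2)"
  proof (rule summable_comparison_test'[where N = 1])
    show "summable (\<lambda>m. 4 * (wt x \<nu> m / (real m + 1))\<^sup>2)"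
      using x \<nu> by (intro summable_mult summable_wt_sq)
    fix m :: nat assume "m \<ge> 1"
    then have "(real m + 1) / 2 * v m \<le> real m * v m" using v0[of m] by (intro mult_right_mono) auto
    also have "\<dots> \<le> wt x \<nu> m" using vle[of m] wt_le[of m] by simp
    finally have "v m \<le> 2 * wt x \<nu> m / (real m + 1)" by (simp add: field_simps)
    then have "(v m)\<^sup>2 \<le> (2 * wt x \<nu> m / (real m + 1))\<^sup>2" using v0[of m] by (intro power_mono)
    then show "norm ((v m)\<^sup>2) \<le> 4 * (wt x \<nu> m / (real m + 1))\<^sup>2" by (simp add: power_divide power_mult_distrib)
  qed
  define f where "f = real_ell2 v"
  have fn: "ell2_nth f m = complex_of_real (v m)" for m unfolding f_def by (rule ell2_nth_real_ell2[OF sv])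
  have ps: "psum f m = complex_of_real (r m)" for m
    by (induction m) (simp_all add: psum_Suc r0 fn v_def)
  define u where "u m = (\<Sum>n. 1 / (real (max m n) + \<nu>) * v n)" for m
  have un: "ell2_nth (hilbert_L \<nu> f) m = complex_of_real (u m)" for m
    unfolding f_def u_def by (rule hilbert_L_real_nth(2)[OF \<nu> sv])
  have "u m - u (Suc m) = r (Suc m) / ((real m + \<nu>) * (real m + 1 + \<nu>))" for m
    using hilbert_L_nth_diff[OF \<nu>, of f m] unfolding un ps by (metis of_real_diff of_real_divide of_real_eq_iff)
  moreover have "l * v m - l * v (Suc m) = r (Suc m) / ((real m + \<nu>) * (real m + 1 + \<nu>))" for m
  proof -
    define D where "D = (\<nu> + real m) * (\<nu> + real m + 1)"
    have D: "(real m + \<nu>) * (real m + 1 + \<nu>) = D" by (simp only: D_def add_ac)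
    have "r (Suc (Suc m)) - r (Suc m) = r (Suc m) - r m - 1 / l * r (Suc m) / D"
      using solves_recD[OF jost_solves_rec[OF less_imp_le[OF x(1)] \<nu>], of m] unfolding \<kappa> D_def r_def .
    then have "v (Suc m) = v m - 1 / l * r (Suc m) / D" unfolding v_def .
    then have "l * v (Suc m) = l * v m - l * (1 / l * r (Suc m) / D)" by (simp only: right_diff_distrib)
    moreover have "l * (1 / l * r (Suc m) / D) = r (Suc m) / D" using l by simp
    ultimately show ?thesis unfolding D by linarith
  qed
  then have step: "u (Suc m) - l * v (Suc m) = u m - l * v m" for m
  proof -
    note e1 = \<open>\<And>m. u m - u (Suc m) = r (Suc m) / ((real m + \<nu>) * (real m + 1 + \<nu>))\<close>[of m]
    note e2 = \<open>\<And>m. l * v m - l * v (Suc m) = r (Suc m) / ((real m + \<nu>) * (real m + 1 + \<nu>))\<close>[of m]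
    show ?thesis using e1 e2 by linarith
  qed
  \<comment> \<open>The recurrence yields the eigenvalue equation only up to a constant; the
    constant is 0 because both sequences tend to 0.\<close>
  have const: "u m - l * v m = u 0 - l * v 0" for m
  proof (induction m)
    case (Suc m)
    then show ?case unfolding step .
  qed simp
  have "u \<longlonglongrightarrow> 0"
    using tendsto_Re[OF ell2_nth_tendsto_0[of "hilbert_L \<nu> f"]] by (simp add: un)
  moreover have "v \<longlonglongrightarrow> 0"
    using tendsto_Re[OF ell2_nth_tendsto_0[of f]] by (simp add: fn)
  ultimately have "(\<lambda>m. u m - l * v m) \<longlonglongrightarrow> 0 - l * 0"
    by (intro tendsto_diff tendsto_mult tendsto_const)
  moreover have "(\<lambda>m. u m - l * v m) = (\<lambda>m. u 0 - l * v 0)" by (rule ext) (rule const)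
  ultimately have "(\<lambda>m::nat. u 0 - l * v 0) \<longlonglongrightarrow> 0 - l * 0" by (simp only:)
  then have "u 0 - l * v 0 = 0" unfolding LIMSEQ_const_iff by simp
  then have ul: "u m = l * v m" for m using const[of m] by linarith
  have sums: "(\<lambda>n. 1 / (real (max m n) + \<nu>) * v n) sums (l * v m)" for m
    unfolding ul[symmetric] u_def by (rule summable_sums[OF hilbert_L_real_nth(1)[OF \<nu> sv]])
  \<comment> \<open>Concavity gave only v \<ge> 0. Strict positivity follows from the eigenvalue
    equation, since v(0) > 0 and all kernel entries are positive.\<close>
  have "v m > 0" for m
  proof -
    have "0 < 1 / (real (max m 0) + \<nu>) * v 0" using rS[of 0] r0 \<nu> by (simp add: v_def)
    also have "\<dots> = (\<Sum>n<1. 1 / (real (max m n) + \<nu>) * v n)" by simp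
    also have "\<dots> \<le> u m" unfolding u_def using \<nu> v0
      by (intro sum_le_suminf sums_summable[OF sums]) auto
    finally show ?thesis unfolding ul using l by (simp add: zero_less_mult_iff)
  qed
  then show ?thesis using sv sums that[of v] by (simp add: l_def)
qed

lemma eigenvalue_inj:
  fixes x y :: real
  assumes "0 < x" "x < 1/2" "0 < y" "y < 1/2" "4 / (1 - 4 * x\<^sup>2) = 4 / (1 - 4 * y\<^sup>2)"
  shows "x = y"
proof -
  have "x\<^sup>2 < (1/2)\<^sup>2" "y\<^sup>2 < (1/2)\<^sup>2" using assms by (auto intro!: power_strict_mono)
  then have "1 - 4 * x\<^sup>2 > 0" "1 - 4 * y\<^sup>2 > 0" by (auto simp: power_divide)
  then have "x\<^sup>2 = y\<^sup>2" using assms(5) by (simp add: frac_eq_eq)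
  then show ?thesis using assms by (simp add: power2_eq_iff_nonneg)
qed

lemma onorm_eq_if_hF_zero:
  fixes x \<nu> :: real
  assumes "0 < x" "x < 1/2" "\<nu> > 0" "hF x \<nu> = 0"
  shows "onorm (hilbert_L \<nu>) = 4 / (1 - 4 * x\<^sup>2)"
    and "complex_of_real (4 / (1 - 4 * x\<^sup>2)) \<in> point_spectrum (hilbert_L \<nu>)"
proof -
  obtain v where "\<And>n. v n > 0" "summable (\<lambda>n. (v n)\<^sup>2)"
    "\<And>m. (\<lambda>n. 1 / (real (max m n) + \<nu>) * v n) sums (4 / (1 - 4 * x\<^sup>2) * v m)"
    using hF_zero_imp_eigenvector[OF assms] by blast
  from positive_eigenvector_onorm[OF assms(3) this]
  show "onorm (hilbert_L \<nu>) = 4 / (1 - 4 * x\<^sup>2)"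
    "complex_of_real (4 / (1 - 4 * x\<^sup>2)) \<in> point_spectrum (hilbert_L \<nu>)" by auto
qed

text \<open>Both zeros produce the same operator norm, and the eigenvalue formula is injective on
  (0, 1/2).\<close>

lemma hF_zero_unique:
  fixes x y \<nu> :: real
  assumes "0 < x" "x < 1/2" "0 < y" "y < 1/2" "\<nu> > 0" "hF x \<nu> = 0" "hF y \<nu> = 0"
  shows "x = y"
  using onorm_eq_if_hF_zero(1)[of x \<nu>] onorm_eq_if_hF_zero(1)[of y \<nu>] assms
    eigenvalue_inj[of x y] by simp

section \<open>The roots \<open>nu0\<close> and \<open>x0\<close>, and absence of zeros from
  \<open>nu0\<close> on\<close>

lemma hF_zero_between:
  fixes x \<nu> :: real
  assumes "0 \<le> x" "x < 1/2" "\<nu> > 0" "hF x \<nu> < 0"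
  shows "\<exists>y. x < y \<and> y < 1/2 \<and> hF y \<nu> = 0"
proof -
  have c: "continuous_on {x..1/2} (\<lambda>y. hF y \<nu>)"
    by (rule continuous_on_hF[OF continuous_on_id continuous_on_const]) (use assms in auto)
  have h: "hF (1/2) \<nu> = 1" by (rule hF_half)
  have "\<exists>y. x \<le> y \<and> y \<le> 1/2 \<and> hF y \<nu> = 0"
    by (rule IVT'[of "\<lambda>y. hF y \<nu>", OF _ _ _ c]) (use assms h in linarith)+
  then obtain y where y: "x \<le> y" "y \<le> 1/2" "hF y \<nu> = 0" by blast
  have "y \<noteq> x" using y(3) assms(4) by (metis less_irrefl)
  moreover have "y \<noteq> 1/2" using y(3) h by (metis zero_neq_one)
  ultimately show ?thesis using y by (intro exI[of _ y] conjI) linarith+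
qed

lemma nu0_unique: "\<exists>!\<nu>. \<nu> > 0 \<and> hF 0 \<nu> = (0::real)"
proof -
  obtain a where a: "a > 0" "a < 1" "hF 0 a < (0::real)" using hF_0_neg[of 1] by auto
  obtain M where M: "\<And>m. m \<ge> M \<Longrightarrow> hF 0 (a + real m) > 0"
    using hF_eventually_pos[of 0 a] a by auto
  define b where "b = a + real M"
  have b: "hF 0 b > 0" "a \<le> b" using M[of M] by (auto simp: b_def)
  have "continuous_on {a..b} (hF (0::real))"
    using a by (intro continuous_on_hF continuous_intros) auto
  then obtain t where t: "a \<le> t" "t \<le> b" "hF 0 t = 0"
    using IVT'[of "hF 0" a 0 b] a b by auto
  show ?thesis
  proof (rule ex1I[of _ t])
    fix s assume "s > 0 \<and> hF 0 s = (0::real)"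
    then show "s = t" using t a hF_less[of 0 s t] hF_less[of 0 t s] by (cases s t rule: linorder_cases) auto
  qed (use t a in auto)
qed

lemma nu0: "nu0 > 0" "hF 0 nu0 = (0::real)"
proof -
  have "hyp3F2_at_1 (-1/2) (1/2) (3/2) 1 (\<nu> + 1/2) = hF 0 \<nu>" if "\<nu> > 0" for \<nu>
    using hyp3F2_eq_hF[of 0 \<nu>] that by simp
  then have "nu0 = (THE \<nu>. \<nu> > 0 \<and> hF 0 \<nu> = 0)" unfolding nu0_def by (metis (no_types, lifting))
  then show "nu0 > 0" "hF 0 nu0 = (0::real)" using theI'[OF nu0_unique] by auto
qed

text \<open>A zero at x > 0 forces negative values at all smaller x and smaller t, and in the limit
  x = 0 this contradicts positivity of the value at x = 0 beyond \<open>nu0\<close>. The borderline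
  \<nu> = \<open>nu0\<close> is handled by moving slightly beyond it.\<close>

lemma hF_zero_imp_less_nu0:
  fixes x \<nu> :: real
  assumes x: "0 < x" "x < 1/2" and \<nu>: "\<nu> > 0" and zero: "hF x \<nu> = 0"
  shows "\<nu> < nu0"
proof -
  \<comment> \<open>Decreasing t makes the value at z negative, which creates a zero to the right of
    z. A nonnegative value at y would create a second one in [y, z], against uniqueness.\<close>
  have neg: "hF y t < 0" if z: "0 < z" "z < 1/2" "hF z s = 0" and t: "0 < t" "t < s" and y: "0 < y" "y \<le> z" for y z s t :: real
  proof (rule ccontr)
    assume "\<not> hF y t < 0"
    moreover have zt: "hF z t < 0" using hF_less[of z t s] z t by simp
    ultimately have "\<exists>w. y \<le> w \<and> w \<le> z \<and> hF w t = 0"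
      using y z t by (intro IVT2'[of "\<lambda>w. hF w t"] continuous_on_hF continuous_intros) auto
    then obtain w where w: "y \<le> w" "w \<le> z" "hF w t = 0" by blast
    obtain w' where w': "z < w'" "w' < 1/2" "hF w' t = 0" using hF_zero_between[of z t] z t zt by auto
    show False using hF_zero_unique[of w w' t] w w' y t z by auto
  qed
  \<comment> \<open>Uniqueness of zeros is known only for x > 0, so x = 0 is reached by continuity
    and strictness is lost.\<close>
  have neg0: "hF 0 t \<le> 0" if z: "0 < z" "z < 1/2" "hF z s = 0" and t: "0 < t" "t < s" for z s t :: real
  proof (rule ccontr)
    assume "\<not> hF 0 t \<le> 0"
    moreover have "continuous_on {0..z} (\<lambda>w. hF w t)"
      using t by (intro continuous_on_hF continuous_intros) auto
    then have "((\<lambda>w. hF w t) \<longlongrightarrow> hF 0 t) (at_right 0)"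
      using z(1) by (auto dest: continuous_on_Icc_at_rightD)
    ultimately have "eventually (\<lambda>w. hF w t > 0) (at_right 0)" by (intro order_tendstoD) auto
    moreover have "eventually (\<lambda>w. 0 < w \<and> w < z) (at_right 0)"
      using z by (intro eventually_at_rightI[of 0 z]) auto
    ultimately have "eventually (\<lambda>w. hF w t > 0 \<and> 0 < w \<and> w < z) (at_right 0)" by (rule eventually_conj)
    then obtain w where "hF w t > 0" "0 < w" "w < z"
      using eventually_happens[of _ "at_right (0::real)"] by (auto simp: trivial_limit_at_right_real)
    then show False using neg[OF z t, of w] by auto
  qed
  \<comment> \<open>The midpoint of \<open>nu0\<close> and s leaves room on both sides: there the
    value at x = 0 is positive by monotonicity and nonpositive by \<open>neg0\<close>.\<close>
  have le: "s \<le> nu0" if z: "0 < z" "z < 1/2" "s > 0" "hF z s = 0" for z s :: real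
  proof (rule ccontr)
    assume "\<not> s \<le> nu0"
    then have "nu0 < (nu0 + s) / 2" "(nu0 + s) / 2 < s" by auto
    then show False using neg0[OF z(1,2,4), of "(nu0 + s) / 2"] hF_less[of 0 nu0 "(nu0 + s) / 2"] nu0 by auto
  qed
  \<comment> \<open>At y = x / 2 the value at \<nu> is nonpositive by a limit from the left and
    nonzero by uniqueness. Being negative, it stays so for some t > \<open>nu0\<close>, where it
    creates a zero that \<open>le\<close> forbids.\<close>
  have "\<nu> \<noteq> nu0"
  proof
    assume e: "\<nu> = nu0"
    define y where "y = x / 2"
    have y: "0 < y" "y < x" using x by (auto simp: y_def)
    have ct: "continuous_on {\<nu>/2..2*\<nu>} (hF y)" using \<nu> y by (intro continuous_on_hF continuous_intros) auto
    have "hF y \<nu> \<le> 0"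
    proof (rule tendsto_upperbound)
      show "(hF y \<longlongrightarrow> hF y \<nu>) (at_left \<nu>)"
        using continuous_on_interior[OF ct, of \<nu>] \<nu> by (simp add: isCont_def filterlim_at_split)
      show "\<forall>\<^sub>F t in at_left \<nu>. hF y t \<le> 0"
        using neg[OF x zero] y \<nu> by (intro eventually_at_leftI[of 0 \<nu>]) (auto intro: less_imp_le)
    qed (simp add: trivial_limit_at_left_real)
    moreover have "hF y \<nu> \<noteq> 0" using hF_zero_unique[of y x \<nu>] x y \<nu> zero by auto
    ultimately have "hF y \<nu> < 0" by simp
    moreover have "(hF y \<longlongrightarrow> hF y \<nu>) (at_right \<nu>)"
      using continuous_on_interior[OF ct, of \<nu>] \<nu> by (simp add: isCont_def filterlim_at_split)
    ultimately have "eventually (\<lambda>t. hF y t < 0) (at_right \<nu>)" by (intro order_tendstoD) auto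
    moreover have "eventually (\<lambda>t. \<nu> < t) (at_right \<nu>)" by (rule eventually_at_right_less)
    ultimately have "eventually (\<lambda>t. hF y t < 0 \<and> \<nu> < t) (at_right \<nu>)" by (rule eventually_conj)
    then obtain t where t: "hF y t < 0" "\<nu> < t"
      using eventually_happens[of _ "at_right \<nu>"] by (auto simp: trivial_limit_at_right_real)
    then obtain w where "y < w" "w < 1/2" "hF w t = 0" using hF_zero_between[of y t] y x \<nu> by auto
    then show False using le[of w t] t y e \<nu> by auto
  qed
  then show ?thesis using le[OF x \<nu> zero] by simp
qed

lemma x0_unique:
  assumes "0 < \<nu>" "\<nu> < nu0"
  shows "\<exists>!x. 0 < x \<and> x < 1/2 \<and> hF x \<nu> = 0"
proof -
  have "hF 0 \<nu> < 0" using hF_less[of 0 \<nu> nu0] nu0 assms by simp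
  then obtain x where "0 < x" "x < 1/2" "hF x \<nu> = 0" using hF_zero_between[of 0 \<nu>] assms by auto
  then show ?thesis using hF_zero_unique[of _ _ \<nu>] assms by (intro ex1I[of _ x]) auto
qed

lemma x0:
  assumes "0 < \<nu>" "\<nu> < nu0"
  shows "0 < x0 \<nu>" "x0 \<nu> < 1/2" "hF (x0 \<nu>) \<nu> = 0"
proof -
  have "hyp3F2_at_1 (x - 1/2) (x + 1/2) (x + 3/2) (2 * x + 1) (x + \<nu> + 1/2) = hF x \<nu>" if "0 < x" for x
    using hyp3F2_eq_hF[of x \<nu>] that assms by simp
  then have "x0 \<nu> = (THE x. 0 < x \<and> x < 1/2 \<and> hF x \<nu> = 0)"
    unfolding x0_def greaterThanLessThan_iff by (metis (no_types, lifting))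
  then show "0 < x0 \<nu>" "x0 \<nu> < 1/2" "hF (x0 \<nu>) \<nu> = 0" using theI'[OF x0_unique[OF assms]] by auto
qed

lemma x0_eqI:
  assumes "0 < \<nu>" "\<nu> < nu0" "0 < x" "x < 1/2" "hF x \<nu> = 0"
  shows "x0 \<nu> = x"
  using x0_unique[OF assms(1,2)] x0[OF assms(1,2)] assms by blast

lemma onorm_x0:
  assumes "0 < \<nu>" "\<nu> < nu0"
  shows "onorm (hilbert_L \<nu>) = 4 / (1 - 4 * (x0 \<nu>)\<^sup>2)"
  using onorm_eq_if_hF_zero(1)[OF x0(1,2)[OF assms] assms(1) x0(3)[OF assms]] .

lemma point_spectrum_small:
  assumes "0 < \<nu>" "\<nu> < nu0"
  shows "point_spectrum (hilbert_L \<nu>) = {complex_of_real (onorm (hilbert_L \<nu>))}"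
proof -
  have "complex_of_real (onorm (hilbert_L \<nu>)) \<in> point_spectrum (hilbert_L \<nu>)"
    unfolding onorm_x0[OF assms] using onorm_eq_if_hF_zero(2)[OF x0(1,2)[OF assms] assms(1) x0(3)[OF assms]] .
  moreover have "z = complex_of_real (onorm (hilbert_L \<nu>))" if "z \<in> point_spectrum (hilbert_L \<nu>)" for z
    using eigenvalue_imp_hF_zero[OF assms(1) that] onorm_eq_if_hF_zero(1) assms(1) by metis
  ultimately show ?thesis by blast
qed

lemma point_spectrum_large:
  assumes "0 < \<nu>" "nu0 \<le> \<nu>"
  shows "point_spectrum (hilbert_L \<nu>) = {}"
proof (rule ccontr)
  assume "point_spectrum (hilbert_L \<nu>) \<noteq> {}"
  then obtain z where "z \<in> point_spectrum (hilbert_L \<nu>)" by blast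
  then obtain x where "0 < x" "x < 1/2" "hF x \<nu> = 0" using eigenvalue_imp_hF_zero[OF assms(1)] by metis
  then show False using hF_zero_imp_less_nu0[of x \<nu>] assms by simp
qed

lemma eigenvalue_formula_mono:
  fixes x y :: real
  assumes "0 \<le> x" "x < y" "y < 1/2"
  shows "4 / (1 - 4 * x\<^sup>2) < 4 / (1 - 4 * y\<^sup>2)"
proof -
  have "x\<^sup>2 < y\<^sup>2" "y\<^sup>2 < (1/2)\<^sup>2" using assms by (auto intro!: power_strict_mono)
  then show ?thesis by (intro divide_strict_left_mono mult_pos_pos) (auto simp: power_divide)
qed

lemma onorm_gt_4:
  assumes "0 < \<nu>" "\<nu> < nu0"
  shows "onorm (hilbert_L \<nu>) > 4"
  using eigenvalue_formula_mono[of 0 "x0 \<nu>"] x0[OF assms] onorm_x0[OF assms] by simp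

lemma x0_strict_antimono:
  assumes "0 < s" "s < t" "t < nu0"
  shows "x0 t < x0 s"
proof -
  have t: "0 < x0 t" "x0 t < 1/2" "hF (x0 t) t = 0" using x0[of t] assms by auto
  then have "hF (x0 t) s < 0" using hF_less[of "x0 t" s t] assms by simp
  then obtain y where y: "x0 t < y" "y < 1/2" "hF y s = 0" using hF_zero_between[of "x0 t" s] t assms by auto
  then have "x0 s = y" using x0_eqI[of s y] assms t by simp
  then show ?thesis using y by simp
qed

lemma onorm_strict_antimono: "strict_antimono_on {0<..<nu0} (\<lambda>\<nu>. onorm (hilbert_L \<nu>))"
proof (rule monotone_onI)
  fix s t assume "s \<in> {0<..<nu0}" "t \<in> {0<..<nu0}" "s < t"
  then show "onorm (hilbert_L t) < onorm (hilbert_L s)"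
    using x0_strict_antimono[of s t] eigenvalue_formula_mono[of "x0 t" "x0 s"] x0[of s] x0[of t]
      onorm_x0[of s] onorm_x0[of t] by auto
qed

section \<open>Analyticity of the norm\<close>

text \<open>Newton iteration with frozen derivative is a uniformly convergent sequence of holomorphic functions.\<close>

lemma holomorphic_implicit_function:
  fixes F :: "complex \<Rightarrow> complex \<Rightarrow> complex"
  assumes r: "r > 0"
    and cont: "continuous_on (cball a r \<times> cball b r) (\<lambda>(z, w). F z w)"
    and hol: "\<And>A g h. open A \<Longrightarrow> g holomorphic_on A \<Longrightarrow> h holomorphic_on A \<Longrightarrow>
       g ` A \<subseteq> cball a r \<Longrightarrow> h ` A \<subseteq> cball b r \<Longrightarrow> (\<lambda>u. F (g u) (h u)) holomorphic_on A"
    and zero: "F a b = 0" and nz: "deriv (\<lambda>z. F z b) a \<noteq> 0"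
  obtains s \<rho> X where "s > 0" "\<rho> > 0" "X holomorphic_on ball b s"
    "\<forall>w\<in>ball b s. \<forall>z\<in>cball a \<rho>. F z w = 0 \<longleftrightarrow> z = X w"
proof -
  define c where "c = deriv (\<lambda>z. F z b) a"
  have c: "cmod c > 0" using nz by (simp add: c_def)
  have holz: "(\<lambda>z. F z w) holomorphic_on ball a r" if "w \<in> cball b r" for w
    using that by (intro hol) (auto intro!: holomorphic_intros)
  have b: "b \<in> cball b r" using r by simp
  have "isCont (deriv (\<lambda>z. F z b)) a"
    using holomorphic_deriv[OF holz[OF b] open_ball] r
    by (intro continuous_on_interior[OF holomorphic_on_imp_continuous_on[of _ "ball a r"]]) auto
  then obtain d where d: "d > 0" "\<And>z. dist z a < d \<Longrightarrow> dist (deriv (\<lambda>z. F z b) z) c < cmod c / 4"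
    using c unfolding continuous_at_eps_delta c_def[symmetric] by (metis divide_pos_pos zero_less_numeral)
  \<comment> \<open>At most r / 4, so that a disc of radius \<rho> about any point of
    \<open>cball a \<rho>\<close> still lies in \<open>ball a r\<close>; this is the disc of the
    Cauchy estimate below.\<close>
  define \<rho> where "\<rho> = min (d / 2) (r / 4)"
  have \<rho>: "\<rho> > 0" "\<rho> < d" "\<rho> \<le> r / 4" using d r by (auto simp: \<rho>_def)
  have "uniformly_continuous_on (cball a r \<times> cball b r) (\<lambda>(z, w). F z w)"
    using cont by (intro compact_uniformly_continuous compact_Times) auto
  \<comment> \<open>The tolerance \<open>cmod c * \<rho> / 4\<close> is used twice: through the
    Cauchy estimate it moves the derivative by at most |c|/4, and it makes the first iteration step
    at most \<rho>/4.\<close>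
  then obtain s0 where s0: "s0 > 0"
    "\<And>p q. p \<in> cball a r \<times> cball b r \<Longrightarrow> q \<in> cball a r \<times> cball b r \<Longrightarrow> dist q p < s0 \<Longrightarrow>
      dist (case q of (z, w) \<Rightarrow> F z w) (case p of (z, w) \<Rightarrow> F z w) < cmod c * \<rho> / 4"
    unfolding uniformly_continuous_on_def using c \<rho> by (metis divide_pos_pos mult_pos_pos zero_less_numeral)
  define s where "s = min s0 r"
  have s: "s > 0" "s \<le> r" using s0 r by (auto simp: s_def)
  have close: "cmod (F z w - F z b) \<le> cmod c * \<rho> / 4" if "z \<in> cball a r" "w \<in> ball b s" for z w
  proof -
    have "dist (z, w) (z, b) < s0" using that by (simp add: dist_Pair_Pair s_def dist_commute)
    then have "dist (F z w) (F z b) < cmod c * \<rho> / 4"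
      using s0(2)[of "(z, b)" "(z, w)"] that s r by (auto simp: dist_commute)
    then show ?thesis by (simp add: dist_norm)
  qed
  define \<phi> where "\<phi> w z = z - F z w / c" for w z
  have der: "cmod (deriv (\<lambda>z. F z w) z - c) \<le> cmod c / 2" if w: "w \<in> ball b s" and z: "z \<in> cball a \<rho>" for w z
  proof -
    have w': "w \<in> cball b r" using w s by auto
    have sub: "cball z \<rho> \<subseteq> ball a r"
    proof
      fix y assume "y \<in> cball z \<rho>"
      then have "dist a y \<le> \<rho> + \<rho>" using z dist_triangle[of a y z] by auto
      then show "y \<in> ball a r" using \<rho> r by auto
    qed
    have h: "(\<lambda>y. F y w - F y b) holomorphic_on ball a r"
      by (intro holomorphic_on_diff holz w' b)
    have "cmod ((deriv ^^ 1) (\<lambda>y. F y w - F y b) z) \<le> fact 1 * (cmod c * \<rho> / 4) / \<rho> ^ 1"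
    proof (rule Cauchy_inequality)
      show "(\<lambda>y. F y w - F y b) holomorphic_on ball z \<rho>"
        using sub by (intro holomorphic_on_subset[OF h]) auto
      show "continuous_on (cball z \<rho>) (\<lambda>y. F y w - F y b)"
        by (rule continuous_on_subset[OF holomorphic_on_imp_continuous_on[OF h] sub])
      fix y assume "cmod (z - y) = \<rho>"
      then have "y \<in> cball z \<rho>" by (simp add: dist_norm)
      then show "cmod (F y w - F y b) \<le> cmod c * \<rho> / 4" using sub by (intro close w) auto
    qed (use \<rho> in simp)
    moreover have "deriv (\<lambda>y. F y w - F y b) z = deriv (\<lambda>y. F y w) z - deriv (\<lambda>y. F y b) z"
    proof (rule deriv_diff)
      have "z \<in> ball a r" using subsetD[OF sub] \<rho> by simp
      then show "(\<lambda>y. F y w) field_differentiable at z" "(\<lambda>y. F y b) field_differentiable at z"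
        using holz[OF w'] holz[OF b] by (auto simp: holomorphic_on_open field_differentiable_def)
    qed
    ultimately have "cmod (deriv (\<lambda>y. F y w) z - deriv (\<lambda>y. F y b) z) \<le> cmod c / 4" using \<rho> by simp
    moreover have "cmod (deriv (\<lambda>z. F z b) z - c) < cmod c / 4"
      using d(2)[of z] z \<rho> by (simp add: dist_norm norm_minus_commute)
    ultimately show ?thesis
      using norm_triangle_ineq[of "deriv (\<lambda>y. F y w) z - deriv (\<lambda>y. F y b) z" "deriv (\<lambda>z. F z b) z - c"] by simp
  qed
  have contr: "cmod (\<phi> w z - \<phi> w y) \<le> 1/2 * cmod (z - y)"
    if w: "w \<in> ball b s" and z: "z \<in> cball a \<rho>" and y: "y \<in> cball a \<rho>" for w y z
  proof (rule field_differentiable_bound[OF convex_cball _ _ z y])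
    fix x assume x: "x \<in> cball a \<rho>"
    have w': "w \<in> cball b r" using w s by auto
    have "x \<in> ball a r" using x \<rho> r by auto
    then have "((\<lambda>z. F z w) has_field_derivative deriv (\<lambda>z. F z w) x) (at x)"
      using holomorphic_derivI[OF holz[OF w'] open_ball] by auto
    then have "(\<phi> w has_field_derivative 1 - deriv (\<lambda>z. F z w) x / c) (at x within cball a \<rho>)"
      unfolding \<phi>_def using c by (auto intro!: derivative_eq_intros intro: has_field_derivative_at_within)
    then show "(\<phi> w has_field_derivative 1 - deriv (\<lambda>z. F z w) x / c) (at x within cball a \<rho>)" .
    have "1 - deriv (\<lambda>z. F z w) x / c = - ((deriv (\<lambda>z. F z w) x - c) / c)" using c by (simp add: field_simps)
    then show "cmod (1 - deriv (\<lambda>z. F z w) x / c) \<le> 1/2"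
      using der[OF w x] c by (simp add: norm_divide field_simps norm_minus_commute)
  qed
  have a: "a \<in> cball a \<rho>" using \<rho> by simp
  have start: "cmod (\<phi> w a - a) \<le> \<rho> / 4" if "w \<in> ball b s" for w
  proof -
    have "cmod (\<phi> w a - a) = cmod (F a w - F a b) / cmod c" by (simp add: \<phi>_def zero norm_divide)
    also have "\<dots> \<le> (cmod c * \<rho> / 4) / cmod c" using that r by (intro divide_right_mono close) auto
    finally show ?thesis using c by simp
  qed
  have self: "\<phi> w z \<in> cball a \<rho>" if "w \<in> ball b s" "z \<in> cball a \<rho>" for w z
  proof -
    have "cmod (\<phi> w z - a) \<le> cmod (\<phi> w z - \<phi> w a) + cmod (\<phi> w a - a)"
      using norm_triangle_ineq[of "\<phi> w z - \<phi> w a" "\<phi> w a - a"] by simp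
    also have "\<dots> \<le> 1/2 * cmod (z - a) + \<rho> / 4" using that by (intro add_mono contr start a)
    also have "\<dots> \<le> 1/2 * \<rho> + \<rho> / 4" using that by (simp add: dist_norm norm_minus_commute)
    finally show ?thesis using \<rho> by (simp add: dist_norm norm_minus_commute)
  qed
  define Y where "Y n w = (\<phi> w ^^ n) a" for n w
  have Y: "Y 0 w = a" "Y (Suc n) w = \<phi> w (Y n w)" for n w by (simp_all add: Y_def)
  have Yin: "Y n w \<in> cball a \<rho>" if "w \<in> ball b s" for n w
    by (induction n) (use that self a in \<open>auto simp: Y simp del: mem_cball\<close>)
  have Yhol: "Y n holomorphic_on ball b s" for n
  proof (induction n)
    case (Suc n)
    have "(\<lambda>w. F (Y n w) w) holomorphic_on ball b s"
    proof (rule hol)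
      show "Y n ` ball b s \<subseteq> cball a r" using Yin[of _ n] \<rho> r by force
      show "(\<lambda>w. w) ` ball b s \<subseteq> cball b r" using s by auto
    qed (use Suc in \<open>auto intro!: holomorphic_intros\<close>)
    then show ?case unfolding Y[abs_def] \<phi>_def using c by (intro holomorphic_intros Suc) auto
  qed (simp add: Y[abs_def])
  have Ystep: "cmod (Y (Suc n) w - Y n w) \<le> \<rho> * (1/2) ^ n" if "w \<in> ball b s" for n w
  proof (induction n)
    case 0
    then show ?case using start[OF that] \<rho> by (simp add: Y)
  next
    case (Suc n)
    have "cmod (Y (Suc (Suc n)) w - Y (Suc n) w) \<le> 1/2 * cmod (Y (Suc n) w - Y n w)"
      unfolding Y(2)[of "Suc n"] Y(2)[of n w] by (intro contr that self Yin)
    then show ?case using Suc by simp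
  qed
  have u: "uniform_limit (ball b s) (\<lambda>n w. \<Sum>i<n. Y (Suc i) w - Y i w) (\<lambda>w. \<Sum>i. Y (Suc i) w - Y i w) sequentially"
    using Ystep by (intro Weierstrass_m_test[where M = "\<lambda>n. \<rho> * (1/2) ^ n"] summable_mult summable_geometric) auto
  define X where "X w = (\<Sum>i. Y (Suc i) w - Y i w) + a" for w
  have tele: "(\<Sum>i<n. Y (Suc i) w - Y i w) = Y n w - a" for n w
    using sum_lessThan_telescope[of "\<lambda>i. Y i w" n] by (simp only: Y(1))
  have uX: "uniform_limit (ball b s) Y X sequentially"
  proof -
    have "uniform_limit (ball b s) (\<lambda>n w. (Y n w - a) + a) X sequentially"
      unfolding X_def[abs_def] by (intro uniform_limit_add u[unfolded tele] uniform_limit_const)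
    then show ?thesis by simp
  qed
  have Xhol: "X holomorphic_on ball b s"
  proof (rule holomorphic_uniform_sequence[OF open_ball Yhol])
    fix x assume "x \<in> ball b s"
    then obtain d where "d > 0" "cball x d \<subseteq> ball b s" using open_contains_cball by blast
    then show "\<exists>d>0. cball x d \<subseteq> ball b s \<and> uniform_limit (cball x d) Y X sequentially"
      using uniform_limit_on_subset[OF uX] by blast
  qed
  have lim: "(\<lambda>n. Y n w) \<longlonglongrightarrow> X w" if "w \<in> ball b s" for w
    using tendsto_uniform_limitI[OF uX that] .
  have Xin: "X w \<in> cball a \<rho>" if "w \<in> ball b s" for w
    using Lim_in_closed_set[OF closed_cball _ _ lim[OF that]] Yin[OF that] by auto
  have fixp: "\<phi> w (X w) = X w" if w: "w \<in> ball b s" for w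
  proof -
    have "(\<lambda>n. Y n w - X w) \<longlonglongrightarrow> 0" using lim[OF w] by (simp add: LIM_zero)
    then have "(\<lambda>n. 1/2 * cmod (Y n w - X w)) \<longlonglongrightarrow> 0" by (intro tendsto_mult_right_zero tendsto_norm_zero)
    then have "(\<lambda>n. \<phi> w (Y n w) - \<phi> w (X w)) \<longlonglongrightarrow> 0"
      by (rule Lim_null_comparison[rotated]) (use contr[OF w Yin[OF w] Xin[OF w]] in auto)
    then have "(\<lambda>n. Y (Suc n) w) \<longlonglongrightarrow> \<phi> w (X w)" by (simp add: Y LIM_zero_iff)
    then show ?thesis using LIMSEQ_unique LIMSEQ_Suc[OF lim[OF w]] by blast
  qed
  have iff: "F z w = 0 \<longleftrightarrow> z = X w" if w: "w \<in> ball b s" and z: "z \<in> cball a \<rho>" for w z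
  proof -
    have "F z w = 0 \<longleftrightarrow> \<phi> w z = z" using c by (auto simp: \<phi>_def)
    also have "\<dots> \<longleftrightarrow> z = X w"
    proof
      assume "\<phi> w z = z"
      then have "cmod (z - X w) \<le> 1/2 * cmod (z - X w)" using contr[OF w z Xin[OF w]] fixp[OF w] by simp
      then show "z = X w" by simp
    qed (use fixp[OF w] in simp)
    finally show ?thesis .
  qed
  show ?thesis by (rule that[OF s(1) \<rho>(1) Xhol]) (use iff in blast)
qed

text \<open>Holomorphy in two variables is expressed as closure under substitution of holomorphic
  functions of one variable, which is the form the implicit function argument consumes.\<close>

lemma hF_locally_holomorphic:
  fixes x t :: real
  assumes "x \<ge> 0" "t > 0"
  obtains \<eta> where "\<eta> > 0"
    "continuous_on (cball (complex_of_real x) \<eta> \<times> cball (complex_of_real t) \<eta>) (\<lambda>(z, w). hF z w)"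
    "\<forall>A g h. open A \<longrightarrow> g holomorphic_on A \<longrightarrow> h holomorphic_on A \<longrightarrow>
       g ` A \<subseteq> cball (complex_of_real x) \<eta> \<longrightarrow> h ` A \<subseteq> cball (complex_of_real t) \<eta> \<longrightarrow> (\<lambda>u. hF (g u) (h u)) holomorphic_on A"
proof -
  obtain \<eta> M where \<eta>: "\<eta> > 0" and M: "summable M"
    and dom: "\<And>(z::complex) s k. norm (z - of_real x) \<le> \<eta> \<Longrightarrow> norm (s - of_real t) \<le> \<eta> \<Longrightarrow> norm (hg z s k) \<le> M k"
    and nz: "\<And>(z::complex) s k. norm (z - of_real x) \<le> \<eta> \<Longrightarrow> norm (s - of_real t) \<le> \<eta> \<Longrightarrow>
       pochhammer (2 * z + 1) k \<noteq> 0 \<and> pochhammer (z + s + 1/2) k \<noteq> 0"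
    using hg_locally_dominated[OF assms, where 'a = complex] by metis
  show ?thesis
  proof (rule that[OF \<eta>], goal_cases)
    case 1
    show "continuous_on (cball (complex_of_real x) \<eta> \<times> cball (complex_of_real t) \<eta>) (\<lambda>(z, w). hF z w)"
      by (rule continuous_on_hF_box[OF M dom nz])
  next
    case 2
    show ?case
    proof (intro allI impI)
      fix A g h assume A: "open A" "g holomorphic_on A" "h holomorphic_on A"
         "g ` A \<subseteq> cball (complex_of_real x) \<eta>" "h ` A \<subseteq> cball (complex_of_real t) \<eta>"
      have in': "norm (g u - of_real x) \<le> \<eta>" "norm (h u - of_real t) \<le> \<eta>" if "u \<in> A" for u
        using A(4,5) that by (auto simp: dist_norm norm_minus_commute image_subset_iff)
      have "(\<lambda>u. \<Sum>k. hg (g u) (h u) k) holomorphic_on A"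
      proof (rule holomorphic_uniform_sequence[OF A(1)])
        have "(\<lambda>u. hg (g u) (h u) k) holomorphic_on A" for k
          unfolding hg_def
        proof (intro holomorphic_on_divide holomorphic_on_mult holomorphic_pochhammer holomorphic_on_const holomorphic_on_add A)
          fix u assume "u \<in> A"
          then show "fact (Suc k) * pochhammer (2 * g u + 1) (Suc k) * pochhammer (g u + h u + 1/2) (Suc k) \<noteq> 0"
            using nz[OF in', of u u "Suc k"] by (simp del: fact_Suc)
        qed simp_all
        then show "(\<lambda>u. \<Sum>k<n. hg (g u) (h u) k) holomorphic_on A" for n
          by (intro holomorphic_on_sum)
        have u: "uniform_limit A (\<lambda>n u. \<Sum>k<n. hg (g u) (h u) k) (\<lambda>u. \<Sum>k. hg (g u) (h u) k) sequentially"
          using in' dom by (intro Weierstrass_m_test[OF _ M]) auto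
        fix u assume "u \<in> A"
        then obtain d where "d > 0" "cball u d \<subseteq> A" using open_contains_cball A(1) by blast
        then show "\<exists>d>0. cball u d \<subseteq> A \<and> uniform_limit (cball u d) (\<lambda>n u. \<Sum>k<n. hg (g u) (h u) k) (\<lambda>u. \<Sum>k. hg (g u) (h u) k) sequentially"
          using uniform_limit_on_subset[OF u] by blast
      qed
      then show "(\<lambda>u. hF (g u) (h u)) holomorphic_on A"
        unfolding hF_def by (intro holomorphic_intros A)
    qed
  qed
qed

section \<open>Lipschitz dependence and simplicity of the zero\<close>

text \<open>The eigenvector at t is used as Schur weight for the operator at s; the kernels compare
  by (k + t)/(k + s) \<le> t/s.\<close>

lemma onorm_hilbert_L_compare:
  assumes "0 < s" "s < t" "t < nu0"
  shows "onorm (hilbert_L s) \<le> t / s * onorm (hilbert_L t)"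
proof -
  have t: "0 < t" using assms by simp
  obtain v where v: "\<And>n. v n > 0" "summable (\<lambda>n. (v n)\<^sup>2)"
    "\<And>m. (\<lambda>n. 1 / (real (max m n) + t) * v n) sums (onorm (hilbert_L t) * v m)"
    using hF_zero_imp_eigenvector[OF x0(1,2)[OF t assms(3)] t x0(3)[OF t assms(3)]]
    unfolding onorm_x0[OF t assms(3), symmetric] by blast
  show ?thesis
  proof (rule hilbert_L_onorm_le[OF assms(1) v(1)])
    fix m N
    have k: "1 / (real k + s) \<le> t / s * (1 / (real k + t))" for k
    proof -
      have "s * real k \<le> t * real k" using assms by (intro mult_right_mono) auto
      then have "s * (real k + t) \<le> t * (real k + s)" by (simp add: algebra_simps)
      then show ?thesis using assms by (simp add: divide_simps mult_ac)
    qed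
    have "(\<Sum>n<N. 1 / (real (max m n) + s) * v n) \<le> (\<Sum>n<N. t / s * (1 / (real (max m n) + t) * v n))"
    proof (rule sum_mono)
      fix n
      show "1 / (real (max m n) + s) * v n \<le> t / s * (1 / (real (max m n) + t) * v n)"
        using mult_right_mono[OF k[of "max m n"] less_imp_le[OF v(1)[of n]]] by (simp only: mult.assoc)
    qed
    also have "\<dots> = t / s * (\<Sum>n<N. 1 / (real (max m n) + t) * v n)" by (rule sum_distrib_left[symmetric])
    also have "\<dots> \<le> t / s * (onorm (hilbert_L t) * v m)"
      unfolding sums_unique[OF v(3)] using assms v(1)
      by (intro mult_left_mono sum_le_suminf sums_summable[OF v(3)]) (auto intro!: divide_nonneg_nonneg less_imp_le)
    finally show "(\<Sum>n<N. 1 / (real (max m n) + s) * v n) \<le> t / s * onorm (hilbert_L t) * v m" by (simp only: mult.assoc)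
  qed
qed

text \<open>Inserting the norm formula into the comparison of norms gives 4 s (p^2 - q^2) \<le> t -
  s, and p + q \<ge> q is divided out. The constant degenerates as \<open>x0\<close> tends to 0, so
  only local bounds follow.\<close>

lemma x0_lipschitz:
  assumes "0 < s" "s < t" "t < nu0"
  shows "x0 s - x0 t \<le> (t - s) / (4 * s * x0 t)"
proof -
  have t: "0 < t" and s: "s < nu0" using assms by auto
  define p q where "p = x0 s" and "q = x0 t"
  have pq: "0 < q" "q < p" "p < 1/2" using x0[OF t assms(3)] x0[OF assms(1) s] x0_strict_antimono[OF assms] by (auto simp: p_def q_def)
  have "p\<^sup>2 < (1/2)\<^sup>2" "q\<^sup>2 < (1/2)\<^sup>2" using pq by (auto intro!: power_strict_mono)
  then have P: "1 - 4 * p\<^sup>2 > 0" "1 - 4 * q\<^sup>2 > 0" by (auto simp: power_divide)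
  have "4 / (1 - 4 * p\<^sup>2) \<le> t / s * (4 / (1 - 4 * q\<^sup>2))"
    using onorm_hilbert_L_compare[OF assms] unfolding onorm_x0[OF t assms(3)] onorm_x0[OF assms(1) s] p_def q_def .
  then have "s * (1 - 4 * q\<^sup>2) \<le> t * (1 - 4 * p\<^sup>2)" using P assms by (simp add: field_simps)
  then have "4 * s * (p\<^sup>2 - q\<^sup>2) \<le> (t - s) * (1 - 4 * p\<^sup>2)" by (simp add: algebra_simps)
  also have "\<dots> \<le> (t - s) * 1" using assms by (intro mult_left_mono) auto
  finally have "4 * s * ((p - q) * (p + q)) \<le> t - s" by (simp add: algebra_simps power2_eq_square)
  moreover have "4 * s * ((p - q) * q) \<le> 4 * s * ((p - q) * (p + q))"
    using assms pq by (intro mult_left_mono) auto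
  ultimately have "(p - q) * (4 * s * q) \<le> t - s" by (simp add: mult_ac)
  then show ?thesis using assms pq unfolding p_def[symmetric] q_def[symmetric] by (simp add: pos_le_divide_eq)
qed

lemma x0_local_lipschitz:
  assumes "0 < t" "t < nu0"
  obtains \<delta> K where "\<delta> > 0" "K > 0" "\<delta> < t" "t + \<delta> < nu0" "\<And>s. \<bar>s - t\<bar> < \<delta> \<Longrightarrow> \<bar>x0 s - x0 t\<bar> \<le> K * \<bar>s - t\<bar>"
proof -
  define \<delta> where "\<delta> = min (t / 2) ((nu0 - t) / 2)"
  have "\<delta> \<le> (nu0 - t) / 2" unfolding \<delta>_def by (rule min.cobounded2)
  then have \<delta>: "\<delta> > 0" "\<delta> \<le> t / 2" "t + \<delta> < nu0" using assms by (auto simp: \<delta>_def)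
  define q where "q = x0 (t + \<delta>)"
  have q: "q > 0" unfolding q_def using \<delta> assms by (intro x0) auto
  have lip: "\<bar>x0 r - x0 s\<bar> \<le> 1 / (2 * t * q) * \<bar>r - s\<bar>" if "t / 2 \<le> r" "r < s" "s < t + \<delta>" for r s
  proof -
    have qs: "q < x0 s" unfolding q_def using that \<delta> assms by (intro x0_strict_antimono) auto
    have "x0 r - x0 s \<le> (s - r) / (4 * r * x0 s)" using that \<delta> assms by (intro x0_lipschitz) auto
    also have "\<dots> \<le> (s - r) / (4 * (t / 2) * q)"
      using that assms q qs by (intro divide_left_mono mult_mono mult_pos_pos) auto
    finally show ?thesis using x0_strict_antimono[of r s] that \<delta> assms by (simp add: abs_if)
  qed
  show ?thesis
  proof (rule that[of \<delta> "1 / (2 * t * q)"])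
    fix s assume s: "\<bar>s - t\<bar> < \<delta>"
    show "\<bar>x0 s - x0 t\<bar> \<le> 1 / (2 * t * q) * \<bar>s - t\<bar>"
      using lip[of s t] lip[of t s] s \<delta> by (cases s t rule: linorder_cases) (auto simp: abs_minus_commute)
  qed (use \<delta> q assms in auto)
qed

text \<open>The zeros z(n) belonging to s(n) < \<nu> tend to \<open>x0 \<nu>\<close> from above.
  Monotonicity in t bounds the value at z(n) and \<nu> below by a multiple of \<nu> - s(n), the
  Lipschitz bound does the converse for z(n) - \<open>x0 \<nu>\<close>, so the difference quotients
  stay away from 0.\<close>

lemma hF_deriv_nonzero:
  assumes \<nu>: "0 < \<nu>" "\<nu> < nu0"
    and der: "((\<lambda>z. hF z (complex_of_real \<nu>)) has_field_derivative D) (at (complex_of_real (x0 \<nu>)))"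
  shows "D \<noteq> 0"
proof
  assume "D = 0"
  obtain \<delta> K where \<delta>: "\<delta> > 0" "K > 0" "\<delta> < \<nu>" "\<nu> + \<delta> < nu0" "\<And>s. \<bar>s - \<nu>\<bar> < \<delta> \<Longrightarrow> \<bar>x0 s - x0 \<nu>\<bar> \<le> K * \<bar>s - \<nu>\<bar>"
    using x0_local_lipschitz[OF \<nu>] by metis
  define s where "s n = \<nu> - \<delta> / (real n + 2)" for n
  have s: "s n < \<nu>" "\<nu> - \<delta> / 2 \<le> s n" for n
  proof -
    have "\<delta> / (real n + 2) \<le> \<delta> / 2" using \<delta> by (intro divide_left_mono) auto
    then show "s n < \<nu>" "\<nu> - \<delta> / 2 \<le> s n" using \<delta> by (simp_all add: s_def)
  qed
  have s': "0 < s n" "s n < nu0" "\<bar>s n - \<nu>\<bar> < \<delta>" for n using s[of n] \<delta> \<nu> by auto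
  define z where "z n = x0 (s n)" for n
  have s_lim: "s \<longlonglongrightarrow> \<nu>" unfolding s_def by real_asymp
  have z_lim: "z \<longlonglongrightarrow> x0 \<nu>"
  proof -
    have lim: "(\<lambda>n. K * \<bar>s n - \<nu>\<bar>) \<longlonglongrightarrow> 0"
      by (rule tendsto_mult_right_zero[OF tendsto_rabs_zero[OF LIM_zero[OF s_lim]]])
    have "norm (z n - x0 \<nu>) \<le> K * \<bar>s n - \<nu>\<bar>" for n
      unfolding z_def real_norm_def by (rule \<delta>(5)[OF s'(3)])
    then have "(\<lambda>n. z n - x0 \<nu>) \<longlonglongrightarrow> 0"
      by (intro Lim_null_comparison[OF _ lim] always_eventually allI)
    then show ?thesis by (rule LIM_zero_cancel)
  qed
  have z_gt: "x0 \<nu> < z n" for n unfolding z_def using s s' \<nu> by (intro x0_strict_antimono) auto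
  \<comment> \<open>A uniform bound below 1/2 for the zeros z(n), which keeps the factor 1/2 - x in
    \<open>hF_diff_ge\<close> away from 0.\<close>
  define q where "q = x0 (\<nu> - \<delta> / 2)"
  have q: "q < 1/2" unfolding q_def using \<delta> \<nu> by (intro x0) auto
  have z_le: "z n \<le> q" for n
  proof (cases "s n = \<nu> - \<delta> / 2")
    case False
    then show ?thesis unfolding z_def q_def using s[of n] s'[of n] \<delta> by (intro less_imp_le x0_strict_antimono) auto
  qed (simp add: z_def q_def)
  have zb: "0 < z n" "z n < 1/2" "hF (z n) (s n) = 0" for n unfolding z_def using x0[OF s'(1,2)] by auto
  \<comment> \<open>The second factor bounds the difference of the first series terms: the numerator
    is at least 3 (\<nu> - t), and both denominators are at most 2 \<nu> + 2 because 2 x <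
    1.\<close>
  define c where "c = (1/2 - q) * (3 / (2 * \<nu> + 2)\<^sup>2)"
  have c: "c > 0" using q \<nu> by (simp add: c_def)
  have lower: "hF (z n) \<nu> \<ge> c * (\<nu> - s n)" for n
  proof -
    define x t where "x = z n" and "t = s n"
    have x: "0 < x" "x < 1/2" "x \<le> q" and t: "0 < t" "t < \<nu>" using zb[of n] z_le[of n] s[of n] s'[of n] by (auto simp: x_def t_def)
    have "hg x t 0 - hg x \<nu> 0 = (x + 3/2) * (2 * (\<nu> - t)) / ((2 * x + 2 * t + 1) * (2 * x + 2 * \<nu> + 1))"
      unfolding hg_0[OF less_imp_le[OF x(1)]] using x t by (simp add: divide_simps) (simp add: algebra_simps)
    also have "\<dots> \<ge> 3 * (\<nu> - t) / ((2 * \<nu> + 2) * (2 * \<nu> + 2))"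
    proof (rule frac_le)
      have "0 \<le> x * (2 * (\<nu> - t))" using x t by simp
      then show "3 * (\<nu> - t) \<le> (x + 3/2) * (2 * (\<nu> - t))" by (simp add: algebra_simps)
      show "(2 * x + 2 * t + 1) * (2 * x + 2 * \<nu> + 1) \<le> (2 * \<nu> + 2) * (2 * \<nu> + 2)"
        using x t by (intro mult_mono) auto
    qed (use x t in auto)
    finally have "hg x t 0 - hg x \<nu> 0 \<ge> 3 * (\<nu> - t) / ((2 * \<nu> + 2) * (2 * \<nu> + 2))" .
    moreover have "3 * (\<nu> - t) / ((2 * \<nu> + 2) * (2 * \<nu> + 2)) = 3 / (2 * \<nu> + 2)\<^sup>2 * (\<nu> - t)"
      by (simp only: power2_eq_square times_divide_eq_left)
    ultimately have d: "hg x t 0 - hg x \<nu> 0 \<ge> 3 / (2 * \<nu> + 2)\<^sup>2 * (\<nu> - t)" by (simp only:)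
    have "c * (\<nu> - t) = (1/2 - q) * (3 / (2 * \<nu> + 2)\<^sup>2 * (\<nu> - t))" by (simp only: c_def mult.assoc)
    also have "\<dots> \<le> (1/2 - x) * (hg x t 0 - hg x \<nu> 0)"
      using x q d t by (intro mult_mono) auto
    also have "\<dots> \<le> hF x \<nu> - hF x t" using x t by (intro hF_diff_ge) auto
    finally show ?thesis using zb(3)[of n] by (simp add: x_def t_def)
  qed
  have quot: "c / K \<le> hF (z n) \<nu> / (z n - x0 \<nu>)" for n
  proof -
    have "z n - x0 \<nu> \<le> K * (\<nu> - s n)" using \<delta>(5)[OF s'(3)[of n]] s(1)[of n] by (simp add: z_def)
    then have "c * (z n - x0 \<nu>) \<le> c * (K * (\<nu> - s n))" using c by (intro mult_left_mono) auto
    also have "\<dots> = K * (c * (\<nu> - s n))" by simp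
    also have "\<dots> \<le> K * hF (z n) \<nu>" using \<delta>(2) by (intro mult_left_mono lower) auto
    finally show ?thesis using z_gt[of n] \<delta>(2) by (simp add: divide_simps mult_ac)
  qed
  have "((\<lambda>y. (hF y (complex_of_real \<nu>) - hF (complex_of_real (x0 \<nu>)) (complex_of_real \<nu>)) / (y - complex_of_real (x0 \<nu>))) \<longlongrightarrow> D)
      (at (complex_of_real (x0 \<nu>)))"
    using der by (simp add: has_field_derivative_iff)
  moreover have "filterlim (\<lambda>n. complex_of_real (z n)) (at (complex_of_real (x0 \<nu>))) sequentially"
    unfolding filterlim_at using z_gt z_lim by (auto intro!: tendsto_of_real always_eventually simp: less_imp_neq[symmetric])
  ultimately have "(\<lambda>n. (hF (complex_of_real (z n)) (complex_of_real \<nu>) - hF (complex_of_real (x0 \<nu>)) (complex_of_real \<nu>))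
      / (complex_of_real (z n) - complex_of_real (x0 \<nu>))) \<longlonglongrightarrow> D"
    by (rule filterlim_compose)
  moreover have "(hF (complex_of_real (z n)) (complex_of_real \<nu>) - hF (complex_of_real (x0 \<nu>)) (complex_of_real \<nu>))
      / (complex_of_real (z n) - complex_of_real (x0 \<nu>)) = complex_of_real (hF (z n) \<nu> / (z n - x0 \<nu>))" for n
  proof -
    have e1: "hF (complex_of_real (z n)) (complex_of_real \<nu>) = complex_of_real (hF (z n) \<nu>)"
      by (rule hF_of_real[OF less_imp_le[OF zb(1)] \<nu>(1)])
    have e2: "hF (complex_of_real (x0 \<nu>)) (complex_of_real \<nu>) = 0"
      unfolding hF_of_real[OF less_imp_le[OF x0(1)[OF \<nu>]] \<nu>(1)] x0(3)[OF \<nu>] by simp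
    show ?thesis unfolding e1 e2 by simp
  qed
  ultimately have "(\<lambda>n. complex_of_real (hF (z n) \<nu> / (z n - x0 \<nu>))) \<longlonglongrightarrow> complex_of_real 0"
    by (simp only: \<open>D = 0\<close> of_real_0)
  then have "(\<lambda>n. hF (z n) \<nu> / (z n - x0 \<nu>)) \<longlonglongrightarrow> 0" by (simp only: tendsto_of_real_iff)
  then have "c / K \<le> 0" using quot by (intro LIMSEQ_le_const) auto
  then show False using c \<delta>(2) by (simp add: divide_le_0_iff)
qed

text \<open>On the real axis the real part of a complex power series is the series of the real parts
  of its coefficients. This brings the holomorphic implicit function back to the real norm.\<close>

lemma has_fps_expansion_Re:
  fixes f :: "complex \<Rightarrow> complex"
  assumes "f has_fps_expansion F"
  shows "(\<lambda>h::real. Re (f (of_real h))) has_fps_expansion Abs_fps (\<lambda>n. Re (fps_nth F n))"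
proof (rule has_fps_expansionI)
  have r: "fps_conv_radius F > 0" and ev: "eventually (\<lambda>z. eval_fps F z = f z) (nhds 0)"
    using assms by (auto simp: has_fps_expansion_def)
  have t: "filterlim complex_of_real (nhds 0) (nhds (0::real))"
    using tendsto_of_real[OF filterlim_ident[of "nhds (0::real)"], where 'a = complex] by simp
  have "eventually (\<lambda>z::complex. z \<in> eball 0 (fps_conv_radius F)) (nhds 0)"
    using r by (intro eventually_nhds_in_open) (auto simp: zero_ereal_def)
  then have "eventually (\<lambda>h. complex_of_real h \<in> eball 0 (fps_conv_radius F)) (nhds (0::real))"
    using t by (rule eventually_compose_filterlim)
  moreover have "eventually (\<lambda>h. eval_fps F (complex_of_real h) = f (complex_of_real h)) (nhds (0::real))"
    using ev t by (rule eventually_compose_filterlim)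
  ultimately show "eventually (\<lambda>h::real. (\<lambda>n. fps_nth (Abs_fps (\<lambda>n. Re (fps_nth F n))) n * h ^ n) sums Re (f (of_real h))) (nhds 0)"
  proof eventually_elim
    case (elim h)
    then have "(\<lambda>n. fps_nth F n * complex_of_real h ^ n) sums f (of_real h)"
      using sums_eval_fps[of "complex_of_real h" F] by (simp add: in_eball_iff)
    then have "(\<lambda>n. Re (fps_nth F n * complex_of_real h ^ n)) sums Re (f (of_real h))" by (rule sums_Re)
    moreover have "Re (fps_nth F n * complex_of_real h ^ n) = Re (fps_nth F n) * h ^ n" for n
      unfolding of_real_power[symmetric] by (simp del: of_real_power)
    ultimately show ?case by simp
  qed
qed

lemma onorm_analytic: "real_analytic_on (\<lambda>\<nu>. onorm (hilbert_L \<nu>)) {0<..<nu0}"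
  unfolding real_analytic_on_def
proof
  fix \<nu> assume "\<nu> \<in> {0<..<nu0}"
  then have \<nu>: "0 < \<nu>" "\<nu> < nu0" by auto
  define a where "a = x0 \<nu>"
  have a: "0 < a" "a < 1/2" "hF a \<nu> = 0" using x0[OF \<nu>] by (auto simp: a_def)
  obtain \<eta> where \<eta>: "\<eta> > 0"
    "continuous_on (cball (complex_of_real a) \<eta> \<times> cball (complex_of_real \<nu>) \<eta>) (\<lambda>(z, w). hF z w)"
    "\<forall>A g h. open A \<longrightarrow> g holomorphic_on A \<longrightarrow> h holomorphic_on A \<longrightarrow>
       g ` A \<subseteq> cball (complex_of_real a) \<eta> \<longrightarrow> h ` A \<subseteq> cball (complex_of_real \<nu>) \<eta> \<longrightarrow> (\<lambda>u. hF (g u) (h u)) holomorphic_on A"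
    by (rule hF_locally_holomorphic[OF less_imp_le[OF a(1)] \<nu>(1)])
  note \<eta>3 = \<eta>(3)[rule_format]
  have "(\<lambda>z. hF z (complex_of_real \<nu>)) holomorphic_on ball (complex_of_real a) \<eta>"
    using \<eta>(1) by (intro \<eta>3) (auto intro!: holomorphic_intros)
  then have "((\<lambda>z. hF z (complex_of_real \<nu>)) has_field_derivative deriv (\<lambda>z. hF z (complex_of_real \<nu>)) (complex_of_real a)) (at (complex_of_real a))"
    using \<eta>(1) by (intro holomorphic_derivI[of _ "ball (complex_of_real a) \<eta>"]) auto
  then have D: "deriv (\<lambda>z. hF z (complex_of_real \<nu>)) (complex_of_real a) \<noteq> 0"
    unfolding a_def by (rule hF_deriv_nonzero[OF \<nu>])
  have Z: "hF (complex_of_real a) (complex_of_real \<nu>) = 0"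
    unfolding hF_of_real[OF less_imp_le[OF a(1)] \<nu>(1)] a(3) by simp
  obtain s \<rho> X where X: "s > 0" "\<rho> > 0" "X holomorphic_on ball (complex_of_real \<nu>) s"
    "\<forall>w\<in>ball (complex_of_real \<nu>) s. \<forall>z\<in>cball (complex_of_real a) \<rho>. hF z w = 0 \<longleftrightarrow> z = X w"
    by (rule holomorphic_implicit_function[OF \<eta>(1,2) \<eta>3 Z D])
  obtain \<delta> K where \<delta>: "\<delta> > 0" "K > 0" "\<delta> < \<nu>" "\<nu> + \<delta> < nu0" "\<And>s. \<bar>s - \<nu>\<bar> < \<delta> \<Longrightarrow> \<bar>x0 s - x0 \<nu>\<bar> \<le> K * \<bar>s - \<nu>\<bar>"
    using x0_local_lipschitz[OF \<nu>] by metis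
  \<comment> \<open>The bound \<rho> / K keeps \<open>x0\<close> inside the disc in which X is the
    only zero, so the implicit function is identified with \<open>x0\<close> near \<nu>.\<close>
  define e where "e = min (min \<delta> s) (\<rho> / K)"
  have e: "e > 0" using \<delta> X by (simp add: e_def)
  have Xx0: "X (complex_of_real (\<nu> + h)) = complex_of_real (x0 (\<nu> + h))" if "\<bar>h\<bar> < e" for h
  proof -
    have h: "\<bar>h\<bar> < \<delta>" "\<bar>h\<bar> < s" "\<bar>h\<bar> < \<rho> / K" using that by (auto simp: e_def)
    have nh: "0 < \<nu> + h" "\<nu> + h < nu0" using h \<delta> by auto
    have "\<bar>x0 (\<nu> + h) - a\<bar> \<le> K * \<bar>h\<bar>" using \<delta>(5)[of "\<nu> + h"] h by (simp add: a_def)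
    also have "\<dots> \<le> \<rho>" using h(3) \<delta>(2) by (simp add: field_simps)
    finally have "complex_of_real (x0 (\<nu> + h)) \<in> cball (complex_of_real a) \<rho>"
      by (simp add: dist_norm norm_minus_commute flip: of_real_diff)
    moreover have "complex_of_real (\<nu> + h) \<in> ball (complex_of_real \<nu>) s"
      using h by (simp add: dist_norm)
    moreover have "hF (complex_of_real (x0 (\<nu> + h))) (complex_of_real (\<nu> + h)) = 0"
      using x0[OF nh] nh by (simp only: hF_of_real less_imp_le) simp
    ultimately show ?thesis using X(4) by metis
  qed
  define \<phi> where "\<phi> w = 4 / (1 - 4 * (X w)\<^sup>2)" for w
  have Xa: "X (complex_of_real \<nu>) = complex_of_real a" using Xx0[of 0] e by (simp add: a_def)
  have "a\<^sup>2 < (1/2)\<^sup>2" using a by (intro power_strict_mono) auto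
  then have "1 - 4 * a\<^sup>2 \<noteq> 0" by (simp add: power_divide)
  then have nz: "1 - 4 * (X (complex_of_real \<nu>))\<^sup>2 \<noteq> 0"
  proof -
    have "1 - 4 * (complex_of_real a)\<^sup>2 = complex_of_real (1 - 4 * a\<^sup>2)" by simp
    then show ?thesis unfolding Xa using \<open>1 - 4 * a\<^sup>2 \<noteq> 0\<close> by (simp only: of_real_eq_0_iff) simp
  qed
  have "X analytic_on {complex_of_real \<nu>}"
    using X(1,3) by (intro analytic_on_subset[OF holomorphic_on_imp_analytic_at[of X "ball (complex_of_real \<nu>) s"]]) auto
  then have "\<phi> analytic_on {complex_of_real \<nu>}"
    unfolding \<phi>_def using nz by (intro analytic_intros) auto
  then have "(\<lambda>h. \<phi> (complex_of_real \<nu> + h)) has_fps_expansion fps_expansion \<phi> (complex_of_real \<nu>)"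
    by (rule analytic_at_imp_has_fps_expansion)
  from has_fps_expansion_Re[OF this]
  obtain G where G: "(\<lambda>h::real. Re (\<phi> (complex_of_real \<nu> + of_real h))) has_fps_expansion G" by blast
  have "eventually (\<lambda>h::real. \<bar>h\<bar> < e) (nhds 0)"
    using eventually_nhds_in_open[of "ball 0 e" "0::real"] e by (simp add: dist_real_def)
  then have "eventually (\<lambda>h. Re (\<phi> (complex_of_real \<nu> + of_real h)) = onorm (hilbert_L (\<nu> + h))) (nhds 0)"
  proof eventually_elim
    case (elim h)
    have nh: "0 < \<nu> + h" "\<nu> + h < nu0" using elim \<delta> by (auto simp: e_def)
    have "\<phi> (complex_of_real \<nu> + of_real h) = complex_of_real (4 / (1 - 4 * (x0 (\<nu> + h))\<^sup>2))"
      using Xx0[OF elim] by (simp add: \<phi>_def)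
    then show ?case unfolding onorm_x0[OF nh] by (metis Re_complex_of_real)
  qed
  from has_fps_expansion_cong[OF this refl[of G]] have "(\<lambda>h. onorm (hilbert_L (\<nu> + h))) has_fps_expansion G"
    using G by (simp only:)
  then show "\<exists>F. (\<lambda>h. onorm (hilbert_L (\<nu> + h))) has_fps_expansion F" by blast
qed

section \<open>Lower bounds for the norm\<close>

definition delta0 :: "nat \<Rightarrow> real" where
  "delta0 n = (if n = 0 then 1 else 0)"

lemma summable_delta0: "summable (\<lambda>n. (delta0 n)\<^sup>2)"
  by (rule summable_finite[of "{0}"]) (auto simp: delta0_def)

lemma hilbert_L_delta0:
  assumes "\<nu> > 0"
  shows "hilbert_L \<nu> (real_ell2 delta0) = real_ell2 (\<lambda>n. 1 / (real n + \<nu>))"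
    and "summable (\<lambda>n. (1 / (real n + \<nu>))\<^sup>2)"
proof -
  have v: "ell2_nth (hilbert_L \<nu> (real_ell2 delta0)) m = complex_of_real (1 / (real m + \<nu>))" for m
  proof -
    have "(\<Sum>n. 1 / (real (max m n) + \<nu>) * delta0 n) = (\<Sum>n\<in>{0}. 1 / (real (max m n) + \<nu>) * delta0 n)"
      by (rule suminf_finite) (auto simp: delta0_def)
    then show ?thesis unfolding hilbert_L_real_nth(2)[OF assms summable_delta0] by (simp add: delta0_def)
  qed
  show s: "summable (\<lambda>n. (1 / (real n + \<nu>))\<^sup>2)"
    using summable_ell2[of "hilbert_L \<nu> (real_ell2 delta0)"] unfolding v norm_of_real power2_abs .
  show "hilbert_L \<nu> (real_ell2 delta0) = real_ell2 (\<lambda>n. 1 / (real n + \<nu>))"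
    by (rule ell2_eqI) (simp only: v ell2_nth_real_ell2[OF s])
qed

lemma inner_real_ell2:
  assumes "summable (\<lambda>n. (v n)\<^sup>2)" "summable (\<lambda>n. (w n)\<^sup>2)"
  shows "inner (real_ell2 v) (real_ell2 w) = (\<Sum>n. v n * w n)"
  unfolding inner_ell2_def ell2_nth_real_ell2[OF assms(1)] ell2_nth_real_ell2[OF assms(2)]
  by (simp add: inner_complex_def)

text \<open>For the first basis vector e, the image has squared norm \<psi>'(\<nu>) and the form has
  the value 1/\<nu>. The inequality \<open>norm_hilbert_L_sq_le\<close> combines both; the norm of
  the image alone would give only a square root.\<close>

lemma onorm_ge_trigamma:
  assumes "\<nu> > 0"
  shows "onorm (hilbert_L \<nu>) \<ge> \<nu> * deriv Digamma \<nu>"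
proof -
  have "\<nu> \<notin> \<int>\<^sub>\<le>\<^sub>0" using assms by (auto elim!: nonpos_Ints_cases)
  then have d: "deriv Digamma \<nu> = Polygamma 1 \<nu>"
    by (intro DERIV_imp_deriv) (auto intro!: derivative_eq_intros)
  have "(\<lambda>k. inverse ((\<nu> + real k) ^ Suc 1)) sums Polygamma 1 \<nu>"
    using Polygamma_LIMSEQ[of \<nu> 1] assms by simp
  then have "(\<lambda>n. (1 / (real n + \<nu>))\<^sup>2) sums Polygamma 1 \<nu>"
    by (simp add: power_divide inverse_eq_divide add.commute power2_eq_square)
  then have P: "(norm (hilbert_L \<nu> (real_ell2 delta0)))\<^sup>2 = Polygamma 1 \<nu>"
    unfolding hilbert_L_delta0(1)[OF assms] norm_real_ell2_sq[OF hilbert_L_delta0(2)[OF assms]] by (rule sums_unique[symmetric])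
  have "inner (hilbert_L \<nu> (real_ell2 delta0)) (real_ell2 delta0) = (\<Sum>n. 1 / (real n + \<nu>) * delta0 n)"
    unfolding hilbert_L_delta0(1)[OF assms] by (rule inner_real_ell2[OF hilbert_L_delta0(2)[OF assms] summable_delta0])
  also have "\<dots> = (\<Sum>n\<in>{0}. 1 / (real n + \<nu>) * delta0 n)"
    by (rule suminf_finite) (auto simp: delta0_def)
  also have "\<dots> = 1 / \<nu>" by (simp add: delta0_def)
  finally have I: "inner (hilbert_L \<nu> (real_ell2 delta0)) (real_ell2 delta0) = 1 / \<nu>" .
  have "Polygamma 1 \<nu> \<le> onorm (hilbert_L \<nu>) * (1 / \<nu>)"
    using norm_hilbert_L_sq_le[OF assms, of "real_ell2 delta0"] unfolding P I .
  then show ?thesis unfolding d using assms by (simp add: field_simps)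
qed

lemma psum_real_ell2:
  assumes "summable (\<lambda>n. (v n)\<^sup>2)"
  shows "psum (real_ell2 v) m = complex_of_real (\<Sum>n<m. v n)"
  unfolding psum_def ell2_nth_real_ell2[OF assms] by simp

text \<open>Test vectors \<open>\<surd>(n+1) - \<surd>n\<close>, whose partial sums telescope.\<close>

lemma onorm_ge_4:
  assumes \<nu>: "\<nu> > 0"
  shows "onorm (hilbert_L \<nu>) \<ge> 4"
proof (rule ccontr)
  define L where "L = onorm (hilbert_L \<nu>)"
  assume "\<not> onorm (hilbert_L \<nu>) \<ge> 4"
  then have L4: "L < 4" by (simp add: L_def)
  have L0: "L \<ge> 0" unfolding L_def by (rule onorm_hilbert_L_nonneg[OF \<nu>])
  \<comment> \<open>Chosen so that (k + \<nu>) (k + 1 + \<nu>) \<le> (k + 1) (k + c), which reduces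
    the form to a shifted harmonic sum.\<close>
  define c where "c = 1 + 2 * \<nu> + \<nu>\<^sup>2"
  have c: "c \<ge> 1" using \<nu> by (simp add: c_def)
  define H where "H N = (\<Sum>k<N. 1 / (real k + 1))" for N :: nat
  have step: "sqrt (real n + 1) - sqrt (real n) \<le> 1" "n > 0 \<Longrightarrow> (sqrt (real n + 1) - sqrt (real n))\<^sup>2 \<le> 1/4 * (1 / real n)" for n
  proof -
    define a b where "a = sqrt (real n + 1)" and "b = sqrt (real n)"
    have ab: "b \<ge> 0" "a > b" "a \<ge> 1" "a\<^sup>2 = b\<^sup>2 + 1" "b\<^sup>2 = real n" by (simp_all add: a_def b_def)
    have prod: "(a - b) * (a + b) = 1" using ab by (simp add: power2_eq_square algebra_simps)
    then have "(a - b) * 1 \<le> 1" using mult_left_mono[of 1 "a + b" "a - b"] ab by simp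
    then show "sqrt (real n + 1) - sqrt (real n) \<le> 1" by (simp add: a_def b_def)
    assume "n > 0"
    then have b: "b > 0" by (simp add: b_def)
    have "(a - b) * (2 * b) \<le> (a - b) * (a + b)" using ab by (intro mult_left_mono) auto
    then have "a - b \<le> 1 / (2 * b)" using b unfolding prod by (simp add: pos_le_divide_eq)
    then have "(a - b)\<^sup>2 \<le> (1 / (2 * b))\<^sup>2" using ab by (intro power_mono) auto
    also have "\<dots> = 1/4 * (1 / real n)" using ab(5) by (simp add: power_divide power_mult_distrib)
    finally show "(sqrt (real n + 1) - sqrt (real n))\<^sup>2 \<le> 1/4 * (1 / real n)" by (simp add: a_def b_def)
  qed
  have key: "(\<Sum>k<N. 1 / (real k + c)) \<le> L * (1 + H N / 4)" for N
  proof -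
    \<comment> \<open>Truncation at N makes the vector square-summable; the terms of the form from
      index N on are nonnegative and are dropped.\<close>
    define v where "v n = (if n < N then sqrt (real n + 1) - sqrt (real n) else 0)" for n
    have sv: "summable (\<lambda>n. (v n)\<^sup>2)" by (rule summable_finite[of "{..<N}"]) (auto simp: v_def)
    have ps: "(\<Sum>n<m. v n) = sqrt (real m)" if "m \<le> N" for m
      using that by (induction m) (auto simp: v_def add.commute)
    define f where "f = real_ell2 v"
    have pf: "inner (psum f (Suc k)) (psum f (Suc k)) = real k + 1" if "k < N" for k
    proof -
      have "psum f (Suc k) = complex_of_real (sqrt (real (Suc k)))"
        unfolding f_def psum_real_ell2[OF sv] using ps[of "Suc k"] that by simp
      then show ?thesis by (simp add: dot_square_norm)
    qed
    have "(\<Sum>k<N. 1 / (real k + c)) \<le> (\<Sum>k<N. inner (psum f (Suc k)) (psum f (Suc k)) / ((real k + \<nu>) * (real k + 1 + \<nu>)))"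
    proof (rule sum_mono)
      fix k assume "k \<in> {..<N}"
      have "(real k + \<nu>) * (real k + 1 + \<nu>) \<le> (real k + 1) * (real k + c)"
        using \<nu> by (simp add: c_def power2_eq_square algebra_simps)
      moreover have "(real k + \<nu>) * (real k + 1 + \<nu>) > 0" "real k + c > 0" using \<nu> c by auto
      ultimately have "1 / (real k + c) \<le> (real k + 1) / ((real k + \<nu>) * (real k + 1 + \<nu>))"
        by (intro divide_le_divide_cross) auto
      then show "1 / (real k + c) \<le> inner (psum f (Suc k)) (psum f (Suc k)) / ((real k + \<nu>) * (real k + 1 + \<nu>))"
        using pf[of k] \<open>k \<in> {..<N}\<close> by simp
    qed
    also have "\<dots> \<le> inner (hilbert_L \<nu> f) f"
      unfolding inner_hilbert_L[OF \<nu>] using \<nu> by (intro sum_le_suminf summable_psum_form) auto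
    also have "\<dots> \<le> L * (norm f)\<^sup>2" unfolding L_def by (rule hilbert_L_form_le[OF \<nu>])
    also have "(norm f)\<^sup>2 \<le> 1 + H N / 4"
    proof -
      have "(norm f)\<^sup>2 = (\<Sum>n<N. (v n)\<^sup>2)"
        unfolding f_def norm_real_ell2_sq[OF sv] by (rule suminf_finite) (auto simp: v_def)
      also have "\<dots> \<le> 1 + H N / 4"
      proof (cases N)
        case (Suc M)
        have "(\<Sum>n<Suc M. (v n)\<^sup>2) = (v 0)\<^sup>2 + (\<Sum>n<M. (v (Suc n))\<^sup>2)" by (rule sum.lessThan_Suc_shift)
        also have "\<dots> \<le> 1 + (\<Sum>n<M. 1/4 * (1 / (real n + 1)))"
        proof (intro add_mono sum_mono)
          show "(v 0)\<^sup>2 \<le> 1" by (simp add: v_def)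
          fix n show "(v (Suc n))\<^sup>2 \<le> 1/4 * (1 / (real n + 1))"
            using step(2)[of "Suc n"] by (simp add: v_def add.commute)
        qed
        also have "(\<Sum>n<M. 1/4 * (1 / (real n + 1))) = H M / 4"
          unfolding H_def sum_divide_distrib by (intro sum.cong) (simp_all add: mult.commute)
        also have "H M / 4 \<le> H N / 4" by (simp add: H_def Suc)
        finally show ?thesis by (simp add: Suc)
      qed (simp add: H_def)
      finally show ?thesis .
    qed
    finally show ?thesis using L0 by (simp add: mult_left_mono)
  qed
  define C where "C = (\<Sum>k. (c - 1) * (1 / (real k + 1))\<^sup>2)"
  have s1: "summable (\<lambda>k. (c - 1) * (1 / (real k + 1))\<^sup>2)"
    by (intro summable_mult hilbert_L_delta0(2)) simp
  have low: "H N - C \<le> (\<Sum>k<N. 1 / (real k + c))" for N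
  proof -
    have "H N - (\<Sum>k<N. 1 / (real k + c)) = (\<Sum>k<N. 1 / (real k + 1) - 1 / (real k + c))"
      by (simp add: H_def sum_subtractf)
    also have "\<dots> \<le> (\<Sum>k<N. (c - 1) * (1 / (real k + 1))\<^sup>2)"
    proof (rule sum_mono)
      fix k
      have "1 / (real k + 1) - 1 / (real k + c) = (c - 1) / ((real k + 1) * (real k + c))"
        using c by (simp add: divide_simps)
      also have "\<dots> \<le> (c - 1) / ((real k + 1) * (real k + 1))"
        using c by (intro divide_left_mono mult_left_mono mult_pos_pos) auto
      finally show "1 / (real k + 1) - 1 / (real k + c) \<le> (c - 1) * (1 / (real k + 1))\<^sup>2"
        by (simp add: power2_eq_square)
    qed
    also have "\<dots> \<le> C" unfolding C_def using c by (intro sum_le_suminf s1) auto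
    finally show ?thesis by simp
  qed
  \<comment> \<open>The form is at least H(N) - C and the squared norm at most 1 + H(N)/4. Their
    ratio approaches 4, so L < 4 would bound the harmonic numbers.\<close>
  have bd: "H N \<le> (L + C) / (1 - L / 4)" for N
  proof -
    have "H N * (1 - L / 4) \<le> L + C" using key[of N] low[of N] by (simp add: algebra_simps)
    then show ?thesis using L4 by (simp add: pos_le_divide_eq)
  qed
  have "summable (\<lambda>k. 1 / (real k + 1))"
    by (rule summableI_nonneg_bounded[of _ "(L + C) / (1 - L / 4)"]) (use bd in \<open>auto simp: H_def\<close>)
  then show False using limit_zero_if_summable_over_n[of "\<lambda>_. 1" 1] by simp
qed

section \<open>The Euler sum\<close>

lemma harm_Suc_le_ln: "harm (Suc k) \<le> ln (real k + 1) + (1::real)"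
  using decseqD[OF decseq_harm_diff_ln, of 0 k] by (simp add: harm_expand add.commute)

lemma summable_harm_over_sq: "summable (\<lambda>k. harm (Suc k) / (real k + 1)\<^sup>2)"
proof (rule summable_comparison_test'[where N = 0])
  have "(\<lambda>k. (ln (real k + 1) + 1) / (real k + 1)\<^sup>2) \<in> O(\<lambda>k. real k powr (-3/2))"
    by real_asymp
  moreover have "summable (\<lambda>k. norm (real k powr (-3/2)))"
    using summable_real_powr_iff[of "-3/2"] by simp
  ultimately show "summable (\<lambda>k. (ln (real k + 1) + 1) / (real k + 1)\<^sup>2)"
    by (rule summable_comparison_test_bigo[rotated])
  fix k show "norm (harm (Suc k) / (real k + 1)\<^sup>2) \<le> (ln (real k + 1) + 1) / (real k + 1)\<^sup>2"
    using harm_Suc_le_ln[of k] by (simp add: divide_right_mono)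
qed

lemma sums_zeta3: "(\<lambda>k. 1 / (real k + 1) ^ 3) sums zeta3"
proof -
  have "summable (\<lambda>n. inverse (real (Suc n) ^ 3))"
    using summable_Suc_iff[of "\<lambda>n. inverse (real n ^ 3)"] inverse_power_summable[of 3, where 'a = real] by simp
  then have "summable (\<lambda>k. 1 / real (Suc k) ^ 3)" by (simp add: inverse_eq_divide)
  then show ?thesis unfolding zeta3_def by (simp add: summable_sums add.commute)
qed

lemma harm_diff_le: "harm (N + m) - harm N \<le> real m / (real N + 1)"
proof (induction m)
  case (Suc m)
  have "1 / (real N + real m + 1) \<le> 1 / (real N + 1)" by (intro divide_left_mono) auto
  then show ?case using Suc by (simp add: harm_Suc inverse_eq_divide add_divide_distrib add_ac)
qed simp

lemma sum_inverse_product: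
  "(\<Sum>j<N. 1 / ((real j + 1) * (real k + real j + 2))) = (harm N - (harm (N + Suc k) - harm (Suc k))) / (real k + 1)"
proof (induction N)
  case (Suc N)
  have "1 / ((real N + 1) * (real k + real N + 2)) = (1 / (real N + 1) - 1 / (real k + real N + 2)) / (real k + 1)"
    by (simp add: divide_simps)
  moreover have "harm (Suc N) = harm N + 1 / (real N + 1)"
    "harm (Suc N + Suc k) = harm (N + Suc k) + 1 / (real k + real N + 2)"
    by (simp_all add: harm_Suc inverse_eq_divide add_ac)
  ultimately show ?case
    unfolding sum.lessThan_Suc Suc by (simp only: diff_divide_distrib add_divide_distrib)
qed (simp add: harm_expand)

text \<open>Double counting of \<open>\<Sum> 1 / (k j (k + j))\<close>: summing over \<open>j\<close> first gives the value \<open>E\<close> sought,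
  splitting \<open>1 / (k j) = (1 / k + 1 / j) / (k + j)\<close> gives \<open>2 (E - \<zeta>(3))\<close>.\<close>

lemma sum_harm_over_sq: "(\<lambda>k. harm (Suc k) / (real k + 1)\<^sup>2) sums (2 * zeta3)"
proof -
  define e where "e k = harm (Suc k) / (real k + 1)\<^sup>2" for k
  define E where "E = suminf e"
  have e: "e sums E" unfolding E_def e_def using summable_harm_over_sq by (rule summable_sums)
  define D where "D N = (\<Sum>k<N. \<Sum>j<N. 1 / ((real k + 1) * (real j + 1) * (real k + real j + 2)))" for N
  define G where "G n = (\<Sum>i<n. 1 / (real i + 1)\<^sup>2)" for n
  have harm_le: "harm N / (real N + 1) \<le> (ln (real N + 1) + 1) / (real N + 1)" for N
  proof -
    have "harm N \<le> (harm (Suc N) :: real)" by (rule harm_mono) simp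
    then show ?thesis using harm_Suc_le_ln[of N] by (intro divide_right_mono) auto
  qed
  have D1: "D \<longlonglongrightarrow> E"
  proof -
    \<comment> \<open>The error of cutting the inner sum at N; it is at most harm(N)/(N +
      1).\<close>
    define R where "R N = (\<Sum>k<N. (harm (N + Suc k) - harm N) / (real k + 1)\<^sup>2)" for N
    have D: "D N = (\<Sum>k<N. e k) - R N" for N
    proof -
      have "D N = (\<Sum>k<N. (\<Sum>j<N. 1 / ((real j + 1) * (real k + real j + 2))) / (real k + 1))"
        unfolding D_def sum_divide_distrib by (intro sum.cong) (simp_all add: mult_ac)
      also have "\<dots> = (\<Sum>k<N. e k - (harm (N + Suc k) - harm N) / (real k + 1)\<^sup>2)"
        unfolding sum_inverse_product e_def
        by (intro sum.cong) (simp_all add: power2_eq_square diff_divide_distrib add_divide_distrib)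
      finally show ?thesis by (simp add: R_def sum_subtractf)
    qed
    have R0: "R N \<ge> 0" for N
      unfolding R_def by (intro sum_nonneg divide_nonneg_nonneg) (auto intro: harm_mono)
    have R1: "R N \<le> (ln (real N + 1) + 1) / (real N + 1)" for N
    proof -
      have "R N \<le> (\<Sum>k<N. (real (Suc k) / (real N + 1)) / (real k + 1)\<^sup>2)"
        unfolding R_def by (intro sum_mono divide_right_mono harm_diff_le) auto
      also have "\<dots> = (\<Sum>k<N. inverse (real (Suc k)) / (real N + 1))"
        by (intro sum.cong) (simp_all add: power2_eq_square inverse_eq_divide add.commute)
      also have "\<dots> = harm N / (real N + 1)" by (simp add: harm_altdef sum_divide_distrib)
      finally show ?thesis using harm_le[of N] by linarith
    qed
    have "(\<lambda>N. (ln (real N + 1) + 1) / (real N + 1)) \<longlonglongrightarrow> 0" by real_asymp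
    then have "R \<longlonglongrightarrow> 0"
      by (rule tendsto_sandwich[OF _ _ tendsto_const, rotated 2]) (use R0 R1 in auto)
    then have "(\<lambda>N. (\<Sum>k<N. e k) - R N) \<longlonglongrightarrow> E - 0"
      using e unfolding sums_def by (intro tendsto_diff)
    then show ?thesis unfolding D[abs_def, symmetric] by simp
  qed
  have D2: "D \<longlonglongrightarrow> 2 * (E - zeta3)"
  proof -
    define R where "R N = (\<Sum>k<N. (G (N + Suc k) - G N) / (real k + 1))" for N
    have G_add: "(\<Sum>j<N. 1 / (real k + real j + 2)\<^sup>2) = G (N + Suc k) - G (Suc k)" for N k
      by (induction N) (simp_all add: G_def add_ac)
    \<comment> \<open>Interchange of summation: 1/(n+1)^2 is collected from all k < n. The result
      carries harm(n) instead of harm(n+1), and this discrepancy is the zeta(3) to be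
      subtracted.\<close>
    have abel: "(\<Sum>k<N. (G N - G (Suc k)) / (real k + 1)) = (\<Sum>n<N. harm n / (real n + 1)\<^sup>2)" for N
    proof (induction N)
      case (Suc N)
      have "(\<Sum>k<Suc N. (G (Suc N) - G (Suc k)) / (real k + 1)) = (\<Sum>k<N. (G (Suc N) - G (Suc k)) / (real k + 1))"
        by simp
      also have "\<dots> = (\<Sum>k<N. (G N - G (Suc k)) / (real k + 1) + inverse (real (Suc k)) / (real N + 1)\<^sup>2)"
        by (intro sum.cong) (simp_all add: G_def add_divide_distrib diff_divide_distrib inverse_eq_divide mult.commute add.commute)
      also have "\<dots> = (\<Sum>n<N. harm n / (real n + 1)\<^sup>2) + harm N / (real N + 1)\<^sup>2"
        by (simp add: sum.distrib Suc harm_altdef sum_divide_distrib)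
      finally show ?case by simp
    qed simp
    have D: "D N = 2 * ((\<Sum>k<N. e k) - (\<Sum>k<N. 1 / (real k + 1) ^ 3) + R N)" for N
    proof -
      define T where "T k j = 1 / ((real k + 1) * (real k + real j + 2)\<^sup>2)" for k j :: nat
      have split: "1 / ((real k + 1) * (real j + 1) * (real k + real j + 2)) = T k j + T j k" for k j
      proof -
        define a b where "a = real k + 1" and "b = real j + 1"
        have ab: "a > 0" "b > 0" by (auto simp: a_def b_def)
        have "1 / (a * b * (a + b)) = 1 / (a * (a + b)\<^sup>2) + 1 / (b * (a + b)\<^sup>2)"
          using ab by (simp add: divide_simps power2_eq_square)
        moreover have "a + b = real k + real j + 2" "a + b = real j + real k + 2" by (simp_all add: a_def b_def)
        ultimately show ?thesis unfolding T_def a_def b_def by simp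
      qed
      have "D N = (\<Sum>k<N. \<Sum>j<N. T k j) + (\<Sum>k<N. \<Sum>j<N. T j k)"
        unfolding D_def split by (simp add: sum.distrib)
      also have "(\<Sum>k<N. \<Sum>j<N. T j k) = (\<Sum>k<N. \<Sum>j<N. T k j)" by (rule sum.swap)
      also have "(\<Sum>k<N. \<Sum>j<N. T k j) = (\<Sum>k<N. (G (N + Suc k) - G (Suc k)) / (real k + 1))"
        unfolding G_add[symmetric] sum_divide_distrib T_def by (intro sum.cong) (simp_all add: mult.commute)
      also have "\<dots> = (\<Sum>k<N. (G N - G (Suc k)) / (real k + 1)) + R N"
        unfolding R_def sum.distrib[symmetric] by (intro sum.cong) (simp_all add: diff_divide_distrib)
      also have "(\<Sum>k<N. (G N - G (Suc k)) / (real k + 1)) = (\<Sum>k<N. e k) - (\<Sum>k<N. 1 / (real k + 1) ^ 3)"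
        unfolding abel sum_subtractf[symmetric] e_def
        by (intro sum.cong) (simp_all add: harm_Suc add_divide_distrib inverse_eq_divide power2_eq_square power3_eq_cube add.commute)
      finally show ?thesis by simp
    qed
    have G_diff: "0 \<le> G (N + m) - G N \<and> G (N + m) - G N \<le> real m / (real N + 1)\<^sup>2" for N m
    proof (induction m)
      case (Suc m)
      have "1 / (real N + real m + 1)\<^sup>2 \<le> 1 / (real N + 1)\<^sup>2"
        by (intro divide_left_mono power_mono mult_pos_pos) auto
      moreover have "G (N + Suc m) = G (N + m) + 1 / (real N + real m + 1)\<^sup>2" by (simp add: G_def)
      moreover have "real (Suc m) / (real N + 1)\<^sup>2 = real m / (real N + 1)\<^sup>2 + 1 / (real N + 1)\<^sup>2"
        by (simp add: add_divide_distrib)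
      moreover have "1 / (real N + real m + 1)\<^sup>2 \<ge> 0" by simp
      ultimately show ?case using Suc by linarith
    qed simp
    have R0: "R N \<ge> 0" for N
    proof -
      have "(G (N + Suc k) - G N) / (real k + 1) \<ge> 0" for k
        using G_diff[of N "Suc k"] by (intro divide_nonneg_nonneg) auto
      then show ?thesis unfolding R_def by (rule sum_nonneg)
    qed
    have R1: "R N \<le> real N / (real N + 1)\<^sup>2" for N
    proof -
      have "R N \<le> (\<Sum>k<N. (real (Suc k) / (real N + 1)\<^sup>2) / (real k + 1))"
      proof (unfold R_def, rule sum_mono)
        fix k show "(G (N + Suc k) - G N) / (real k + 1) \<le> (real (Suc k) / (real N + 1)\<^sup>2) / (real k + 1)"
          using G_diff[of N "Suc k"] by (intro divide_right_mono) auto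
      qed
      also have "\<dots> = (\<Sum>k<N. 1 / (real N + 1)\<^sup>2)"
        by (intro sum.cong) (simp_all add: add.commute)
      finally show ?thesis by simp
    qed
    have "(\<lambda>N. real N / (real N + 1)\<^sup>2) \<longlonglongrightarrow> 0" by real_asymp
    then have "R \<longlonglongrightarrow> 0"
      by (rule tendsto_sandwich[OF _ _ tendsto_const, rotated 2]) (use R0 R1 in auto)
    then have "(\<lambda>N. 2 * ((\<Sum>k<N. e k) - (\<Sum>k<N. 1 / (real k + 1) ^ 3) + R N)) \<longlonglongrightarrow> 2 * (E - zeta3 + 0)"
      using e sums_zeta3 unfolding sums_def by (intro tendsto_mult tendsto_add tendsto_diff tendsto_const)
    then show ?thesis unfolding D[abs_def, symmetric] by simp
  qed
  have "E = 2 * (E - zeta3)" by (rule LIMSEQ_unique[OF D1 D2])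
  then show ?thesis using e by (simp add: e_def[abs_def])
qed

text \<open>Summation by parts with 1/((k+1)(k+2)) = 1/(k+1) - 1/(k+2). The squared harmonic numbers
  increase by 2 H(k+1)/(k+1) - 1/(k+1)^2, so the sum is twice the Euler sum minus zeta(3), that is 4
  - 1 = 3 times zeta(3).\<close>

lemma sum_harm_sq: "(\<lambda>k. (harm (Suc k))\<^sup>2 / ((real k + 1) * (real k + 2))) sums (3 * zeta3)"
proof -
  have part: "(\<Sum>k<N. (harm (Suc k))\<^sup>2 / ((real k + 1) * (real k + 2)))
      = 2 * (\<Sum>k<N. harm (Suc k) / (real k + 1)\<^sup>2) - (\<Sum>k<N. 1 / (real k + 1) ^ 3) - (harm N)\<^sup>2 / (real N + 1)" for N
  proof (induction N)
    case (Suc N)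
    define h n where "h = (harm (Suc N) :: real)" and "n = real N + 1"
    have n: "n > 0" by (simp add: n_def)
    have hN: "harm N = h - 1 / n" by (simp add: h_def n_def harm_Suc inverse_eq_divide add.commute)
    have r: "real (Suc N) + 1 = n + 1" "real N + 2 = n + 1" "real N + 1 = n" by (simp_all add: n_def)
    have "h\<^sup>2 / (n * (n + 1)) = 2 * (h / n\<^sup>2) - 1 / n ^ 3 - h\<^sup>2 / (n + 1) + (h - 1 / n)\<^sup>2 / n"
      using n by (simp add: divide_simps power2_eq_square power3_eq_cube) (simp add: algebra_simps)
    then show ?case
      unfolding sum.lessThan_Suc Suc h_def[symmetric] hN r by (simp add: algebra_simps)
  qed (simp add: harm_def)
  have "(\<lambda>N. (harm N)\<^sup>2 / (real N + 1)) \<longlonglongrightarrow> (0::real)"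
  proof (rule tendsto_sandwich[OF _ _ tendsto_const])
    show "(\<lambda>N. (ln (real N + 1) + 1)\<^sup>2 / (real N + 1)) \<longlonglongrightarrow> 0" by real_asymp
    have "(harm N :: real)\<^sup>2 / (real N + 1) \<le> (ln (real N + 1) + 1)\<^sup>2 / (real N + 1)" for N
    proof -
      have "harm N \<le> (harm (Suc N) :: real)" by (rule harm_mono) simp
      then show ?thesis using harm_Suc_le_ln[of N] harm_nonneg[of N, where 'a = real]
        by (intro divide_right_mono power_mono) auto
    qed
    then show "\<forall>\<^sub>F N in sequentially. (harm N :: real)\<^sup>2 / (real N + 1) \<le> (ln (real N + 1) + 1)\<^sup>2 / (real N + 1)"
      by (intro always_eventually allI)
  qed (auto intro!: always_eventually)
  then have "(\<lambda>N. \<Sum>k<N. (harm (Suc k))\<^sup>2 / ((real k + 1) * (real k + 2))) \<longlonglongrightarrow> 2 * (2 * zeta3) - zeta3 - (0::real)"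
    unfolding part using sum_harm_over_sq sums_zeta3 unfolding sums_def
    by (intro tendsto_diff tendsto_mult tendsto_const)
  then show ?thesis by (simp add: sums_def)
qed

section \<open>Asymptotics for small \<open>\<nu>\<close>\<close>

text \<open>The first column of the matrix without its top entry 1/\<nu>.\<close>

abbreviation bvec :: "real \<Rightarrow> ell2" where
  "bvec \<nu> \<equiv> real_ell2 (\<lambda>n. 1 / (real n + (1 + \<nu>)))"

text \<open>Splitting off the first component of the eigenvector, as in a Schur complement.\<close>

lemma eigenvector_tail:
  assumes \<nu>: "0 < \<nu>" "\<nu> < nu0"
  obtains W where "onorm (hilbert_L \<nu>) = 1 / \<nu> + inner (bvec \<nu>) W"
    "inner (bvec \<nu>) W \<ge> 0"
    "onorm (hilbert_L \<nu>) *\<^sub>R W = bvec \<nu> + hilbert_L (1 + \<nu>) W"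
proof -
  define l where "l = onorm (hilbert_L \<nu>)"
  obtain v where v: "\<And>n. v n > 0" "summable (\<lambda>n. (v n)\<^sup>2)"
    "\<And>m. (\<lambda>n. 1 / (real (max m n) + \<nu>) * v n) sums (l * v m)"
    using hF_zero_imp_eigenvector[OF x0(1,2)[OF \<nu>] \<nu>(1) x0(3)[OF \<nu>]]
    unfolding l_def onorm_x0[OF \<nu>, symmetric] by blast
  define w where "w n = v (Suc n) / v 0" for n
  have v0: "v 0 > 0" by (rule v(1))
  have sw: "summable (\<lambda>n. (w n)\<^sup>2)"
  proof -
    have "summable (\<lambda>n. (v (Suc n))\<^sup>2)" using v(2) by (subst summable_Suc_iff)
    then have "summable (\<lambda>n. (v (Suc n))\<^sup>2 / (v 0)\<^sup>2)" by (rule summable_divide)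
    then show ?thesis by (simp add: w_def power_divide)
  qed
  have \<mu>: "1 + \<nu> > 0" using \<nu> by simp
  note sb = hilbert_L_delta0(2)[OF \<mu>]
  have row: "(\<lambda>n. 1 / (real (max m (Suc n)) + \<nu>) * w n) sums (l * v m / v 0 - 1 / (real m + \<nu>))" for m
  proof -
    have "(\<lambda>n. 1 / (real (max m n) + \<nu>) * v n / v 0) sums (l * v m / v 0)"
      by (rule sums_divide[OF v(3)])
    then have "(\<lambda>n. 1 / (real (max m (Suc n)) + \<nu>) * v (Suc n) / v 0) sums (l * v m / v 0 - 1 / (real (max m 0) + \<nu>) * v 0 / v 0)"
      by (subst sums_Suc_iff) simp
    then show ?thesis using v0 by (simp add: w_def)
  qed
  have "inner (bvec \<nu>) (real_ell2 w) = (\<Sum>n. 1 / (real n + (1 + \<nu>)) * w n)"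
    by (rule inner_real_ell2[OF sb sw])
  also have "\<dots> = (\<Sum>n. 1 / (real (max 0 (Suc n)) + \<nu>) * w n)" by (simp add: add_ac)
  also have "\<dots> = l - 1 / \<nu>" using sums_unique[OF row[of 0]] v0 by simp
  finally have I: "inner (bvec \<nu>) (real_ell2 w) = l - 1 / \<nu>" .
  have "0 \<le> (\<Sum>n. 1 / (real (max 0 (Suc n)) + \<nu>) * w n)"
    using v(1) \<nu> by (intro suminf_nonneg sums_summable[OF row]) (auto simp: w_def less_imp_le)
  then have I0: "inner (bvec \<nu>) (real_ell2 w) \<ge> 0"
    unfolding I using sums_unique[OF row[of 0]] v0 by simp
  have E: "l *\<^sub>R real_ell2 w = bvec \<nu> + hilbert_L (1 + \<nu>) (real_ell2 w)"
  proof (rule ell2_eqI)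
    fix m
    \<comment> \<open>Deleting the first row and column turns the matrix for \<nu> into the one for
      1 + \<nu>, whose norm stays bounded as \<nu> tends to 0.\<close>
    have e: "real (max (Suc m) (Suc n)) + \<nu> = real (max m n) + (1 + \<nu>)" for n by simp
    have "(\<Sum>n. 1 / (real (max m n) + (1 + \<nu>)) * w n) = l * w m - 1 / (real m + (1 + \<nu>))"
      using sums_unique[OF row[of "Suc m", unfolded e]] by (simp add: w_def add_ac)
    then have "l * w m = 1 / (real m + (1 + \<nu>)) + (\<Sum>n. 1 / (real (max m n) + (1 + \<nu>)) * w n)" by linarith
    then have "complex_of_real (l * w m) = complex_of_real (1 / (real m + (1 + \<nu>)) + (\<Sum>n. 1 / (real (max m n) + (1 + \<nu>)) * w n))"
      by (simp only:)
    then show "ell2_nth (l *\<^sub>R real_ell2 w) m = ell2_nth (bvec \<nu> + hilbert_L (1 + \<nu>) (real_ell2 w)) m"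
      unfolding scaleR_ell2.rep_eq plus_ell2.rep_eq hilbert_L_real_nth(2)[OF \<mu> sw] ell2_nth_real_ell2[OF sw] ell2_nth_real_ell2[OF sb]
      by (simp only: of_real_mult of_real_add)
  qed
  show ?thesis using that[of "real_ell2 w"] I I0 E by (simp add: l_def)
qed

text \<open>The squared norm is the sum of 1/(n + 1 + \<nu>)^2. It is expanded termwise to first
  order in \<nu>, with remainders between 0 and 3 \<nu>^2 / (n + 1)^4.\<close>

lemma norm_bvec_sq:
  assumes "0 < \<nu>"
  shows "(norm (bvec \<nu>))\<^sup>2 \<le> pi\<^sup>2 / 6"
    and "\<bar>(norm (bvec \<nu>))\<^sup>2 - (pi\<^sup>2 / 6 - 2 * \<nu> * zeta3)\<bar> \<le> 3 * \<nu>\<^sup>2 * (\<Sum>n. 1 / (real n + 1) ^ 4)"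
proof -
  have \<mu>: "1 + \<nu> > 0" using assms by simp
  note sb = hilbert_L_delta0(2)[OF \<mu>]
  define A where "A = (norm (bvec \<nu>))\<^sup>2"
  have A: "(\<lambda>n. (1 / (real n + (1 + \<nu>)))\<^sup>2) sums A"
    unfolding A_def norm_real_ell2_sq[OF sb] by (rule summable_sums[OF sb])
  have z2: "(\<lambda>n. 1 / (real n + 1)\<^sup>2) sums (pi\<^sup>2 / 6)" using inverse_squares_sums by (simp add: add.commute)
  have z4: "summable (\<lambda>n. 1 / (real n + 1) ^ 4)"
  proof -
    have "summable (\<lambda>n. inverse (real (Suc n) ^ 4))"
      using summable_Suc_iff[of "\<lambda>n. inverse (real n ^ 4)"] inverse_power_summable[of 4, where 'a = real] by simp
    then show ?thesis by (simp add: inverse_eq_divide add.commute)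
  qed
  show "(norm (bvec \<nu>))\<^sup>2 \<le> pi\<^sup>2 / 6"
    unfolding A_def[symmetric]
  proof (rule sums_le[OF _ A z2])
    fix n show "(1 / (real n + (1 + \<nu>)))\<^sup>2 \<le> 1 / (real n + 1)\<^sup>2"
      using assms unfolding power_divide by (simp add: frac_le)
  qed
  have taylor: "0 \<le> (1 / (x + \<nu>))\<^sup>2 - (1 / x\<^sup>2 - 2 * \<nu> * (1 / x ^ 3))"
    "(1 / (x + \<nu>))\<^sup>2 - (1 / x\<^sup>2 - 2 * \<nu> * (1 / x ^ 3)) \<le> 3 * \<nu>\<^sup>2 * (1 / x ^ 4)" if x: "x > 0" for x
  proof -
    have p: "x + \<nu> > 0" using x assms by simp
    have eq: "(1 / (x + \<nu>))\<^sup>2 - (1 / x\<^sup>2 - 2 * \<nu> * (1 / x ^ 3)) = \<nu>\<^sup>2 * (3 * x + 2 * \<nu>) / (x ^ 3 * (x + \<nu>)\<^sup>2)"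
    proof -
      define u v where "u = 1 / x" and "v = 1 / (x + \<nu>)"
      have uv: "x * u = 1" "(x + \<nu>) * v = 1" using x p by (simp_all add: u_def v_def)
      have "v\<^sup>2 - (u\<^sup>2 - 2 * \<nu> * u ^ 3) = \<nu>\<^sup>2 * (3 * x + 2 * \<nu>) * (u ^ 3 * v\<^sup>2)" using uv by algebra
      then show ?thesis by (simp add: u_def v_def power_divide)
    qed
    show "0 \<le> (1 / (x + \<nu>))\<^sup>2 - (1 / x\<^sup>2 - 2 * \<nu> * (1 / x ^ 3))"
      unfolding eq using x p assms by (intro divide_nonneg_nonneg mult_nonneg_nonneg) auto
    have "\<nu>\<^sup>2 * (3 * x + 2 * \<nu>) / (x ^ 3 * (x + \<nu>)\<^sup>2) \<le> 3 * \<nu>\<^sup>2 / x ^ 4"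
    proof (rule divide_le_divide_cross)
      have "\<nu>\<^sup>2 * x ^ 3 * ((3 * x + 2 * \<nu>) * x) \<le> \<nu>\<^sup>2 * x ^ 3 * (3 * (x + \<nu>)\<^sup>2)"
        using x assms by (intro mult_left_mono) (auto simp: power2_eq_square algebra_simps)
      then show "\<nu>\<^sup>2 * (3 * x + 2 * \<nu>) * x ^ 4 \<le> 3 * \<nu>\<^sup>2 * (x ^ 3 * (x + \<nu>)\<^sup>2)"
        by (simp add: power4_eq_xxxx power3_eq_cube mult_ac)
    qed (use x p in auto)
    then show "(1 / (x + \<nu>))\<^sup>2 - (1 / x\<^sup>2 - 2 * \<nu> * (1 / x ^ 3)) \<le> 3 * \<nu>\<^sup>2 * (1 / x ^ 4)" unfolding eq by simp
  qed
  have s: "(\<lambda>n. (1 / (real n + (1 + \<nu>)))\<^sup>2 - (1 / (real n + 1)\<^sup>2 - 2 * \<nu> * (1 / (real n + 1) ^ 3))) sums (A - (pi\<^sup>2 / 6 - 2 * \<nu> * zeta3))"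
    by (intro sums_diff sums_mult A z2 sums_zeta3)
  have e: "real n + (1 + \<nu>) = (real n + 1) + \<nu>" for n by simp
  have "0 \<le> A - (pi\<^sup>2 / 6 - 2 * \<nu> * zeta3)"
    using taylor(1) unfolding e by (intro sums_le[OF _ sums_zero s[unfolded e]]) auto
  moreover have "A - (pi\<^sup>2 / 6 - 2 * \<nu> * zeta3) \<le> 3 * \<nu>\<^sup>2 * (\<Sum>n. 1 / (real n + 1) ^ 4)"
    using taylor(2) by (intro sums_le[OF _ s[unfolded e] sums_mult[OF summable_sums[OF z4]]]) auto
  ultimately show "\<bar>(norm (bvec \<nu>))\<^sup>2 - (pi\<^sup>2 / 6 - 2 * \<nu> * zeta3)\<bar> \<le> 3 * \<nu>\<^sup>2 * (\<Sum>n. 1 / (real n + 1) ^ 4)"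
    by (simp add: A_def)
qed

text \<open>By the partial-sum formula the form is a series that becomes \<open>sum_harm_sq\<close>
  at \<nu> = 0. Each of its terms lies between 1 - 4 \<nu> times the limiting term and that
  term.\<close>

lemma inner_hilbert_L_bvec:
  assumes \<nu>: "0 < \<nu>" "\<nu> \<le> 1"
  defines "Q \<equiv> inner (hilbert_L (1 + \<nu>) (bvec \<nu>)) (bvec \<nu>)"
  shows "0 \<le> Q" "Q \<le> 3 * zeta3" "3 * zeta3 - Q \<le> 12 * zeta3 * \<nu>"
proof -
  have \<mu>: "1 + \<nu> > 0" using \<nu> by simp
  note sb = hilbert_L_delta0(2)[OF \<mu>]
  define S where "S k = (\<Sum>j<Suc k. 1 / (real j + (1 + \<nu>)))" for k
  define q where "q k = (harm (Suc k))\<^sup>2 / ((real k + 1) * (real k + 2))" for k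
  define p where "p k = (S k)\<^sup>2 / ((real k + (1 + \<nu>)) * (real k + 1 + (1 + \<nu>)))" for k
  have "inner (psum (bvec \<nu>) (Suc k)) (psum (bvec \<nu>) (Suc k)) = (S k)\<^sup>2" for k
    unfolding psum_real_ell2[OF sb] S_def by (simp only: dot_square_norm norm_of_real power2_abs)
  then have Q: "p sums Q"
    using summable_sums[OF summable_psum_form[OF \<mu>, of "bvec \<nu>" "bvec \<nu>"]]
    unfolding Q_def inner_hilbert_L[OF \<mu>] p_def by simp
  have q: "q sums (3 * zeta3)" using sum_harm_sq by (simp add: q_def[abs_def])
  have S_le: "S k \<le> harm (Suc k)" for k
    unfolding S_def harm_altdef using \<nu> by (intro sum_mono) (simp add: inverse_eq_divide frac_le)
  have S_ge: "harm (Suc k) \<le> (1 + \<nu>) * S k" for k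
    unfolding S_def harm_altdef sum_distrib_left
  proof (rule sum_mono)
    fix j
    have "\<nu> * real j \<ge> 0" using \<nu> by simp
    then have "1 * (real j + (1 + \<nu>)) \<le> (1 + \<nu>) * (real j + 1)" by (simp add: algebra_simps)
    then have "1 / (real j + 1) \<le> (1 + \<nu>) / (real j + (1 + \<nu>))" using \<nu> by (intro divide_le_divide_cross) auto
    then show "inverse (real (Suc j)) \<le> (1 + \<nu>) * (1 / (real j + (1 + \<nu>)))"
      by (simp add: inverse_eq_divide add.commute)
  qed
  have S0: "S k \<ge> 0" for k unfolding S_def using \<nu> by (intro sum_nonneg) auto
  have pq: "p k \<le> q k" for k
    unfolding p_def q_def using S_le[of k] S0[of k] \<nu> by (intro frac_le power_mono mult_mono) auto
  have p0: "p k \<ge> 0" for k unfolding p_def using \<nu> by auto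
  have qp: "q k * (1 - 4 * \<nu>) \<le> p k" for k
  proof -
    define d where "d = (real k + 1) * (real k + 2)"
    have d: "d > 0" by (simp add: d_def)
    have "(real k + (1 + \<nu>)) * (real k + 1 + (1 + \<nu>)) \<le> ((1 + \<nu>) * (real k + 1)) * ((1 + \<nu>) * (real k + 2))"
    proof (intro mult_mono)
      have "\<nu> * real k \<ge> 0" using \<nu> by simp
      then show "real k + (1 + \<nu>) \<le> (1 + \<nu>) * (real k + 1)" "real k + 1 + (1 + \<nu>) \<le> (1 + \<nu>) * (real k + 2)"
        using \<nu> by (simp_all add: algebra_simps)
    qed (use \<nu> in auto)
    then have D: "(real k + (1 + \<nu>)) * (real k + 1 + (1 + \<nu>)) \<le> (1 + \<nu>)\<^sup>2 * d"
      by (simp add: d_def power2_eq_square mult_ac)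
    have "(harm (Suc k))\<^sup>2 \<le> ((1 + \<nu>) * S k)\<^sup>2"
      using S_ge[of k] by (intro power_mono harm_nonneg)
    then have h: "(harm (Suc k))\<^sup>2 \<le> (1 + \<nu>)\<^sup>2 * (S k)\<^sup>2" by (simp add: power_mult_distrib)
    \<comment> \<open>Two factors of the squared partial sum and two of the denominator each change
      by at most 1 + \<nu>, which accounts for the fourth power.\<close>
    have "(1 - 4 * \<nu>) * (1 + \<nu>) ^ 4 \<le> 1"
    proof -
      have "(1 - 4 * \<nu>) * (1 + \<nu>) ^ 4 = 1 - \<nu>\<^sup>2 * (10 + 20 * \<nu> + 15 * \<nu>\<^sup>2 + 4 * \<nu> ^ 3)"
        by (simp add: algebra_simps power2_eq_square power3_eq_cube power4_eq_xxxx)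
      moreover have "\<nu>\<^sup>2 * (10 + 20 * \<nu> + 15 * \<nu>\<^sup>2 + 4 * \<nu> ^ 3) \<ge> 0" using \<nu> by (intro mult_nonneg_nonneg add_nonneg_nonneg) auto
      ultimately show ?thesis by linarith
    qed
    then have b: "1 - 4 * \<nu> \<le> 1 / (1 + \<nu>) ^ 4" using \<nu> by (simp add: pos_le_divide_eq)
    have "q k * (1 - 4 * \<nu>) \<le> q k * (1 / (1 + \<nu>) ^ 4)"
      using b unfolding q_def by (intro mult_left_mono) auto
    also have "\<dots> = (harm (Suc k))\<^sup>2 / (d * (1 + \<nu>) ^ 4)" by (simp add: q_def d_def)
    also have "\<dots> \<le> (1 + \<nu>)\<^sup>2 * (S k)\<^sup>2 / (d * (1 + \<nu>) ^ 4)"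
      using h d \<nu> by (intro divide_right_mono) auto
    also have "\<dots> = (S k)\<^sup>2 / ((1 + \<nu>)\<^sup>2 * d)"
    proof -
      define s where "s = (1 + \<nu>)\<^sup>2"
      have s: "s > 0" "(1 + \<nu>) ^ 4 = s * s" using \<nu> by (simp_all add: s_def power4_eq_xxxx power2_eq_square)
      show ?thesis unfolding s(2) s_def[symmetric] using s(1) d by (simp add: mult.commute[of d])
    qed
    also have "\<dots> \<le> p k" unfolding p_def using D d \<nu> by (intro divide_left_mono mult_pos_pos) auto
    finally show ?thesis .
  qed
  show "0 \<le> Q" by (rule sums_le[OF _ sums_zero Q]) (use p0 in auto)
  show "Q \<le> 3 * zeta3" by (rule sums_le[OF _ Q q]) (use pq in auto)
  have "3 * zeta3 * (1 - 4 * \<nu>) \<le> Q" by (rule sums_le[OF _ sums_mult2[OF q] Q]) (use qp in auto)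
  then show "3 * zeta3 - Q \<le> 12 * zeta3 * \<nu>" by (simp add: algebra_simps)
qed

text \<open>With e = 1/l the equation reads w = e A + e^2 Q + e^2 R, and e = \<nu> + O(\<nu>^3). The
  first term contributes a \<nu> - 2 z \<nu>^2, the second 3 z \<nu>^2, and the third is O(\<nu>^3)
  because R is itself O(e).\<close>

lemma asymptotic_arithmetic:
  fixes \<nu> l A Q R a z c w :: real
  assumes \<nu>: "0 < \<nu>" "\<nu> \<le> 1/8" and l: "l = 1 / \<nu> + w" and w: "w \<ge> 0"
    and eq: "l\<^sup>2 * w = l * A + Q + R"
    and R: "\<bar>R\<bar> * (l - 4) \<le> 16 * A"
    and A: "0 \<le> A" "A \<le> a" "\<bar>A - (a - 2 * \<nu> * z)\<bar> \<le> 3 * \<nu>\<^sup>2 * c"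
    and Q: "0 \<le> Q" "Q \<le> 3 * z" "3 * z - Q \<le> 12 * z * \<nu>" and z: "z \<ge> 0" and c: "c \<ge> 0"
  shows "\<bar>w - a * \<nu> - z * \<nu>\<^sup>2\<bar> \<le> (3 * c + (35 * a + 6 * z) * (a + 8 * z) + 12 * z + 32 * a) * \<nu> ^ 3"
proof -
  define e where "e = 1 / l"
  \<comment> \<open>From l \<ge> 8 follows l - 4 \<ge> l/2, which turns the bound on R into |R|
    \<le> 32 a / l.\<close>
  have "1 / \<nu> \<ge> 8" using \<nu> by (simp add: field_simps)
  then have l8: "l \<ge> 8" "l \<ge> 1 / \<nu>" using l w by auto
  have e: "0 < e" "e \<le> \<nu>" "l * e = 1"
  proof -
    show "0 < e" "l * e = 1" using l8 by (auto simp: e_def)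
    have "1 / l \<le> 1 / (1 / \<nu>)" using l8 \<nu> by (intro divide_left_mono) auto
    then show "e \<le> \<nu>" by (simp add: e_def)
  qed
  have a: "a \<ge> 0" using A by simp
  have R': "\<bar>R\<bar> \<le> 32 * a * e"
  proof -
    have "\<bar>R\<bar> * (l / 2) \<le> \<bar>R\<bar> * (l - 4)" using l8 by (intro mult_left_mono) auto
    then have "\<bar>R\<bar> * l \<le> 32 * a" using R A by linarith
    then have "\<bar>R\<bar> * l * e \<le> 32 * a * e" using e by (intro mult_right_mono) auto
    then show ?thesis using e by (simp add: mult.assoc)
  qed
  have w_eq: "w = e * A + e\<^sup>2 * Q + e\<^sup>2 * R"
  proof -
    have "e\<^sup>2 * (l\<^sup>2 * w) = e\<^sup>2 * (l * A + Q + R)" by (simp only: eq)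
    moreover have "e\<^sup>2 * (l\<^sup>2 * w) = w"
    proof -
      have "e\<^sup>2 * (l\<^sup>2 * w) = (l * e)\<^sup>2 * w" by (simp add: power_mult_distrib mult_ac)
      then show ?thesis by (simp add: e)
    qed
    moreover have "e\<^sup>2 * (l * A + Q + R) = (l * e) * (e * A) + e\<^sup>2 * Q + e\<^sup>2 * R"
      by (simp add: algebra_simps power2_eq_square)
    ultimately show ?thesis by (simp add: e)
  qed
  have e2: "e\<^sup>2 \<le> \<nu>\<^sup>2" using e by (intro power_mono) auto
  have nu2: "\<nu>\<^sup>2 \<le> \<nu>" using \<nu> by (simp add: power2_eq_square mult_left_le)
  have eR: "\<bar>e\<^sup>2 * R\<bar> \<le> 32 * a * \<nu> ^ 3"
  proof -
    have "\<bar>e\<^sup>2 * R\<bar> = e\<^sup>2 * \<bar>R\<bar>" by (simp add: abs_mult)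
    also have "\<dots> \<le> \<nu>\<^sup>2 * (32 * a * \<nu>)"
    proof (rule mult_mono[OF e2])
      have "32 * a * e \<le> 32 * a * \<nu>" using e a by (intro mult_left_mono) auto
      then show "\<bar>R\<bar> \<le> 32 * a * \<nu>" using R' by linarith
    qed auto
    finally show ?thesis by (simp add: power2_eq_square power3_eq_cube mult_ac)
  qed
  \<comment> \<open>A crude bound w \<le> K \<nu>, collected from a, 3 z and 32 a. It bootstraps to
    \<nu> - e = \<nu> w e \<le> K \<nu>^3.\<close>
  define K where "K = 33 * a + 3 * z"
  have K: "K \<ge> 0" using a z by (simp add: K_def)
  have w_le: "w \<le> K * \<nu>"
  proof -
    have "e * A \<le> \<nu> * a" using e A \<nu> by (intro mult_mono) auto
    moreover have "e\<^sup>2 * Q \<le> \<nu>\<^sup>2 * (3 * z)" using e2 Q by (intro mult_mono) auto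
    moreover have "\<nu>\<^sup>2 * (3 * z) \<le> \<nu> * (3 * z)" using nu2 z by (intro mult_right_mono) auto
    moreover have "\<nu> ^ 3 \<le> \<nu>" using \<nu> power_decreasing[of 1 3 \<nu>] by simp
    then have "32 * a * \<nu> ^ 3 \<le> 32 * a * \<nu>" using a by (intro mult_left_mono) auto
    moreover have "e\<^sup>2 * R \<le> 32 * a * \<nu> ^ 3" using eR by linarith
    ultimately show ?thesis unfolding w_eq K_def by (simp add: algebra_simps)
  qed
  have d: "0 \<le> \<nu> - e" "\<nu> - e \<le> K * \<nu> ^ 3"
  proof -
    show "0 \<le> \<nu> - e" using e by simp
    have "\<nu> * l = 1 + \<nu> * w" using l \<nu> by (simp add: distrib_left)
    then have "\<nu> * (l * e) = e + \<nu> * w * e" by (simp only: mult.assoc[symmetric]) (simp add: algebra_simps)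
    then have "\<nu> - e = \<nu> * w * e" using e(3) by simp
    also have "\<dots> \<le> \<nu> * (K * \<nu>) * \<nu>" using w_le e \<nu> w K by (intro mult_mono) auto
    finally show "\<nu> - e \<le> K * \<nu> ^ 3" by (simp add: power3_eq_cube mult_ac)
  qed
  have d2: "0 \<le> \<nu>\<^sup>2 - e\<^sup>2" "\<nu>\<^sup>2 - e\<^sup>2 \<le> K * \<nu> ^ 3 * 2"
  proof -
    show "0 \<le> \<nu>\<^sup>2 - e\<^sup>2" using e2 by simp
    have "\<nu>\<^sup>2 - e\<^sup>2 = (\<nu> - e) * (\<nu> + e)" by (simp add: power2_eq_square algebra_simps)
    also have "\<dots> \<le> (K * \<nu> ^ 3) * 2" using d e \<nu> K by (intro mult_mono) auto
    finally show "\<nu>\<^sup>2 - e\<^sup>2 \<le> K * \<nu> ^ 3 * 2" .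
  qed
  \<comment> \<open>The errors, in order: expansion of A, replacing e by \<nu> in front of it,
    expansion of Q, replacing e^2 by \<nu>^2, and the remainder R.\<close>
  define t1 t2 t3 t4 t5 where "t1 = e * (A - (a - 2 * \<nu> * z))" and "t2 = (\<nu> - e) * (a - 2 * \<nu> * z)"
    and "t3 = e\<^sup>2 * (3 * z - Q)" and "t4 = (\<nu>\<^sup>2 - e\<^sup>2) * (3 * z)" and "t5 = e\<^sup>2 * R"
  have split: "w - a * \<nu> - z * \<nu>\<^sup>2 = t1 - t2 - t3 - t4 + t5"
    unfolding w_eq t1_def t2_def t3_def t4_def t5_def by (simp add: algebra_simps power2_eq_square)
  have b1: "\<bar>t1\<bar> \<le> 3 * c * \<nu> ^ 3"
  proof -
    have "\<bar>t1\<bar> = e * \<bar>A - (a - 2 * \<nu> * z)\<bar>" using e by (simp add: t1_def abs_mult)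
    also have "\<dots> \<le> \<nu> * (3 * \<nu>\<^sup>2 * c)" using e A \<nu> by (intro mult_mono) auto
    finally show ?thesis by (simp add: power2_eq_square power3_eq_cube mult_ac)
  qed
  have b2: "\<bar>t2\<bar> \<le> K * \<nu> ^ 3 * (a + 2 * z)"
  proof -
    have "\<nu> * z \<le> z" using \<nu> z by (simp add: mult_left_le_one_le)
    moreover have "\<nu> * z \<ge> 0" using \<nu> z by simp
    ultimately have "\<bar>a - 2 * \<nu> * z\<bar> \<le> a + 2 * z" using a z by (simp add: abs_le_iff)
    then show ?thesis unfolding t2_def abs_mult using d K \<nu> by (intro mult_mono) auto
  qed
  have b3: "\<bar>t3\<bar> \<le> 12 * z * \<nu> ^ 3"
  proof -
    have "\<bar>t3\<bar> = e\<^sup>2 * (3 * z - Q)" using Q by (simp add: t3_def abs_mult)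
    also have "\<dots> \<le> \<nu>\<^sup>2 * (12 * z * \<nu>)" using e2 Q by (intro mult_mono) auto
    finally show ?thesis by (simp add: power2_eq_square power3_eq_cube mult_ac)
  qed
  have b4: "\<bar>t4\<bar> \<le> K * \<nu> ^ 3 * 2 * (3 * z)"
    unfolding t4_def abs_mult using d2 z by (intro mult_mono) auto
  have "\<bar>w - a * \<nu> - z * \<nu>\<^sup>2\<bar> \<le> \<bar>t1\<bar> + \<bar>t2\<bar> + \<bar>t3\<bar> + \<bar>t4\<bar> + \<bar>t5\<bar>" unfolding split by linarith
  also have "\<dots> \<le> 3 * c * \<nu> ^ 3 + K * \<nu> ^ 3 * (a + 2 * z) + 12 * z * \<nu> ^ 3 + K * \<nu> ^ 3 * 2 * (3 * z) + 32 * a * \<nu> ^ 3"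
    using eR by (intro add_mono b1 b2 b3 b4) (simp add: t5_def)
  also have "\<dots> = (3 * c + K * (a + 8 * z) + 12 * z + 32 * a) * \<nu> ^ 3" by (simp add: algebra_simps)
  also have "\<dots> \<le> (3 * c + (35 * a + 6 * z) * (a + 8 * z) + 12 * z + 32 * a) * \<nu> ^ 3"
  proof -
    have "K * (a + 8 * z) \<le> (35 * a + 6 * z) * (a + 8 * z)"
      using a z by (intro mult_right_mono) (auto simp: K_def)
    then show ?thesis using \<nu> by (intro mult_right_mono) auto
  qed
  finally show ?thesis .
qed

text \<open>The tail equation l W = b + L W is paired with b and then with L b, which expands the
  correction l - 1/\<nu> in powers of 1/l with remainder <L b, L W>. Two steps suffice, since 1/l is
  of order \<nu>.\<close>

lemma onorm_asymptotics:
  "(\<lambda>\<nu>. onorm (hilbert_L \<nu>) - (1 / \<nu> + pi\<^sup>2 / 6 * \<nu> + zeta3 * \<nu>\<^sup>2)) \<in> O[at_right 0](\<lambda>\<nu>. \<nu> ^ 3)"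
proof -
  define a c where "a = pi\<^sup>2 / 6" and "c = (\<Sum>n. 1 / (real n + 1) ^ 4)"
  define z where "z = zeta3"
  define C where "C = 3 * c + (35 * a + 6 * z) * (a + 8 * z) + 12 * z + 32 * a"
  have z: "z \<ge> 0" unfolding z_def by (rule sums_le[OF _ sums_zero sums_zeta3]) auto
  have c: "c \<ge> 0" using norm_bvec_sq(2)[of 1] by (simp add: c_def)
  have bound: "\<bar>onorm (hilbert_L \<nu>) - (1 / \<nu> + pi\<^sup>2 / 6 * \<nu> + zeta3 * \<nu>\<^sup>2)\<bar> \<le> C * \<nu> ^ 3"
    if \<nu>: "0 < \<nu>" "\<nu> < nu0" "\<nu> \<le> 1/8" for \<nu>
  proof -
    define l where "l = onorm (hilbert_L \<nu>)"
    define b where "b = bvec \<nu>"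
    define L where "L = hilbert_L (1 + \<nu>)"
    obtain W where W: "l = 1 / \<nu> + inner b W" "inner b W \<ge> 0" "l *\<^sub>R W = b + L W"
      using eigenvector_tail[OF \<nu>(1,2)] unfolding l_def b_def L_def by metis
    have \<mu>: "1 + \<nu> > 0" using \<nu> by simp
    \<comment> \<open>The crude Schur bound equals 4 because the parameter 1 + \<nu> exceeds 1; its
      square is the 16 in the remainder estimate.\<close>
    have L4: "norm (L f) \<le> 4 * norm f" for f
      using norm_hilbert_L_le[OF \<mu>, of f] \<nu> by (simp add: L_def max_def)
    have sym: "inner (L f) g = inner f (L g)" for f g
      unfolding L_def by (rule hilbert_L_symmetric[OF \<mu>])
    have l4: "l > 4" unfolding l_def by (rule onorm_gt_4[OF \<nu>(1,2)])
    define R where "R = inner (L b) (L W)"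
    have e1: "l * inner b W = (norm b)\<^sup>2 + inner (L b) W"
    proof -
      have "l * inner b W = inner b (l *\<^sub>R W)" by simp
      also have "\<dots> = (norm b)\<^sup>2 + inner b (L W)" unfolding W(3) by (simp add: inner_add_right dot_square_norm)
      finally show ?thesis by (simp add: sym)
    qed
    have e2: "l * inner (L b) W = inner (L b) b + R"
    proof -
      have "l * inner (L b) W = inner (L b) (l *\<^sub>R W)" by simp
      then show ?thesis unfolding W(3) by (simp add: inner_add_right R_def)
    qed
    have eq: "l\<^sup>2 * inner b W = l * (norm b)\<^sup>2 + inner (L b) b + R"
    proof -
      have "l\<^sup>2 * inner b W = l * (l * inner b W)" by (simp add: power2_eq_square)
      also have "\<dots> = l * (norm b)\<^sup>2 + l * inner (L b) W" unfolding e1 by (simp add: distrib_left)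
      finally show ?thesis unfolding e2 by simp
    qed
    \<comment> \<open>Since l > 4, the tail equation can be solved for W by the triangle
      inequality.\<close>
    have nW: "(l - 4) * norm W \<le> norm b"
    proof -
      have "l * norm W = norm (b + L W)" using l4 unfolding W(3)[symmetric] by simp
      also have "\<dots> \<le> norm b + 4 * norm W" using norm_triangle_ineq[of b "L W"] L4[of W] by linarith
      finally show ?thesis by (simp add: left_diff_distrib)
    qed
    have R: "\<bar>R\<bar> * (l - 4) \<le> 16 * (norm b)\<^sup>2"
    proof -
      have "\<bar>R\<bar> \<le> norm (L b) * norm (L W)" unfolding R_def by (rule Cauchy_Schwarz_ineq2)
      also have "\<dots> \<le> (4 * norm b) * (4 * norm W)" by (intro mult_mono L4) auto
      finally have "\<bar>R\<bar> * (l - 4) \<le> (4 * norm b) * (4 * norm W) * (l - 4)"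
        using l4 by (intro mult_right_mono) auto
      also have "\<dots> = 16 * norm b * ((l - 4) * norm W)" by simp
      also have "\<dots> \<le> 16 * norm b * norm b" using nW by (intro mult_left_mono) auto
      finally show ?thesis by (simp add: power2_eq_square)
    qed
    have \<nu>1: "\<nu> \<le> 1" using \<nu> by simp
    have "\<bar>inner b W - a * \<nu> - z * \<nu>\<^sup>2\<bar> \<le> C * \<nu> ^ 3"
      unfolding C_def
    proof (rule asymptotic_arithmetic[OF \<nu>(1,3) W(1,2) eq R _ _ _ _ _ _ z c])
      show "0 \<le> (norm b)\<^sup>2" by simp
      show "(norm b)\<^sup>2 \<le> a" unfolding a_def b_def by (rule norm_bvec_sq(1)[OF \<nu>(1)])
      show "\<bar>(norm b)\<^sup>2 - (a - 2 * \<nu> * z)\<bar> \<le> 3 * \<nu>\<^sup>2 * c"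
        unfolding a_def b_def z_def c_def by (rule norm_bvec_sq(2)[OF \<nu>(1)])
      show "0 \<le> inner (L b) b" "inner (L b) b \<le> 3 * z" "3 * z - inner (L b) b \<le> 12 * z * \<nu>"
        unfolding L_def b_def z_def by (rule inner_hilbert_L_bvec[OF \<nu>(1) \<nu>1])+
    qed
    moreover have "onorm (hilbert_L \<nu>) - (1 / \<nu> + pi\<^sup>2 / 6 * \<nu> + zeta3 * \<nu>\<^sup>2) = inner b W - a * \<nu> - z * \<nu>\<^sup>2"
      using W(1) by (simp add: l_def a_def z_def)
    ultimately show ?thesis by (simp only:)
  qed
  have "eventually (\<lambda>\<nu>. \<nu> \<in> {0<..<min nu0 (1/8)}) (at_right 0)"
    using nu0(1) by (intro eventually_at_right_real) simp
  then show ?thesis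
  proof (intro bigoI[of _ C], eventually_elim)
    case (elim \<nu>)
    then show ?case using bound[of \<nu>] by simp
  qed
qed

theorem theorem38:
  shows "(\<forall>\<nu>>0.
            (\<nu> \<ge> nu0 \<longrightarrow> point_spectrum (hilbert_L \<nu>) = {}) \<and>
            (\<nu> < nu0 \<longrightarrow>
               point_spectrum (hilbert_L \<nu>) = {complex_of_real (onorm (hilbert_L \<nu>))} \<and>
               onorm (hilbert_L \<nu>) = 4 / (1 - 4 * (x0 \<nu>)\<^sup>2)))
       \<and> ((\<lambda>\<nu>. onorm (hilbert_L \<nu>)) \<in> {0<..<nu0} \<rightarrow> {4<..} \<and>
          real_analytic_on (\<lambda>\<nu>. onorm (hilbert_L \<nu>)) {0<..<nu0} \<and>
          strict_antimono_on {0<..<nu0} (\<lambda>\<nu>. onorm (hilbert_L \<nu>)))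
       \<and> (\<forall>\<nu>>0. onorm (hilbert_L \<nu>) \<ge> max 4 (\<nu> * deriv Digamma \<nu>))
       \<and> (\<lambda>\<nu>. onorm (hilbert_L \<nu>) - (1 / \<nu> + pi\<^sup>2 / 6 * \<nu> + zeta3 * \<nu>\<^sup>2))
           \<in> O[at_right 0](\<lambda>\<nu>. \<nu> ^ 3)"
proof (intro conjI allI impI)
  show "(\<lambda>\<nu>. onorm (hilbert_L \<nu>)) \<in> {0<..<nu0} \<rightarrow> {4<..}"
    using onorm_gt_4 by auto
  fix \<nu> :: real assume "\<nu> > 0"
  then show "onorm (hilbert_L \<nu>) \<ge> max 4 (\<nu> * deriv Digamma \<nu>)"
    using onorm_ge_4 onorm_ge_trigamma by simp
qed (rule onorm_analytic onorm_strict_antimono onorm_asymptotics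
    | simp add: point_spectrum_large point_spectrum_small onorm_x0)+

end
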